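(* For all integers $n\ge 3$ and $r\ge 1$, $$\widehat{\mathrm{ct}}^{(r)}_1=(-1)^r\frac{2^{2-r}\,r}{\varphi(n)\,n^r}\sum_{\chi\in\mathcal{X}^{(r)}}f_\chi^{\,r-1}\prod_{p\mid n}\left(1-\frac{\chi_f(p)}{p^r}\right)^{-1}\frac{\tau(\overline{\chi}_f)}{B^{(r)}_{\overline{\chi}_f}},$$ where $p$ runs through the prime divisors of $n$ and $\varphi$ is Euler's function.
   Context: Inverse cotangent numbers: for $(j,n)=1$, $\widehat{\mathrm{ct}}^{(r)}_j=\dfrac{-i^r\pi^r}{(r-1)!\,n^r}\,d^{(r)}_j$ with $d^{(r)}_j=\sum_{m\in\mathbb{Z},\,m\equiv j\,(\mathrm{mod}\,n)}\mu(|m|)/m^r$, where $\mu$ is the Möbius function; for $r=1$ the series is understood as $\lim_{k\to\infty}\sum_{|m|\le k}$. $\mathcal{X}^{(r)}$ is the set of Dirichlet characters $\chi$ mod $n$ with $\chi(-1)=(-1)^r$. For a Dirichlet character $\chi$ mod $n$, $f_\chi$ is its conductor and $\chi_f$ is the (primitive) Dirichlet character mod $f_\chi$ attached to $\chi$, so $\chi_f(j)=\chi(j)$ if $(j,n)=1$; $\overline\chi$ is the complex-conjugate character, which has the same conductor, and $\overline\chi_f$ is the primitive character attached to it. Gauss sum (note the sign in the exponent): $\tau(\chi_f)=\sum_{j=1}^{f_\chi}\chi_f(j)\,\zeta_{f_\chi}^{-j}$, where $\zeta_m=e^{2\pi i/m}$. Generalized Bernoulli number: $B^{(r)}_{\chi_f}=f_\chi^{\,r-1}\sum_{j=1}^{f_\chi}\chi_f(j)\,B^{(r)}(j/f_\chi)$,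 where $B^{(r)}(x)$ is the $r$th Bernoulli polynomial. *)

theory Defs
  imports "HOL-Analysis.Analysis" "HOL-Number_Theory.Number_Theory"
    "HOL-Computational_Algebra.Squarefree"
begin

definition moebius_mu :: "nat \<Rightarrow> int" where
  "moebius_mu m = (if squarefree m then (-1) ^ card (prime_factors m) else 0)"

(* Bernoulli numbers, with the convention that the number of index 1 is -1/2. *)
fun bernoulli :: "nat \<Rightarrow> real" where
  "bernoulli 0 = 1"
| "bernoulli (Suc k) =
     - (\<Sum>i\<le>k. real (Suc (Suc k) choose i) * bernoulli i) / real (Suc (Suc k))"

declare bernoulli.simps(2) [simp del]

definition bernpoly :: "nat \<Rightarrow> real \<Rightarrow> real" where
  "bernpoly r x = (\<Sum>k\<le>r. real (r choose k) * bernoulli k * x ^ (r - k))"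

text \<open>Dirichlet characters modulo \<open>n\<close> are functions on all integers, vanishing exactly at the
  integers not coprime to \<open>n\<close>. Modulo 1 the only one is the constant function 1.\<close>

definition dirichlet_char :: "nat \<Rightarrow> (int \<Rightarrow> complex) \<Rightarrow> bool" where
  "dirichlet_char n chi \<longleftrightarrow>
     (\<forall>a b. chi (a * b) = chi a * chi b) \<and>
     (\<forall>a. chi (a + int n) = chi a) \<and>
     (\<forall>a. chi a \<noteq> 0 \<longleftrightarrow> coprime a (int n))"

definition conj_char :: "(int \<Rightarrow> complex) \<Rightarrow> int \<Rightarrow> complex" where
  "conj_char chi = (\<lambda>a. cnj (chi a))"

definition parity_chars :: "nat \<Rightarrow> nat \<Rightarrow> (int \<Rightarrow> complex) set" where
  "parity_chars n r = {chi. dirichlet_char n chi \<and> chi (-1) = (-1) ^ r}"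

text \<open>\<open>char_induced_by n chi d \<psi>\<close>: the character \<open>chi\<close> modulo \<open>n\<close> is induced by the
  character \<open>\<psi>\<close> modulo the divisor \<open>d\<close> of \<open>n\<close>.\<close>

definition char_induced_by ::
    "nat \<Rightarrow> (int \<Rightarrow> complex) \<Rightarrow> nat \<Rightarrow> (int \<Rightarrow> complex) \<Rightarrow> bool" where
  "char_induced_by n chi d \<psi> \<longleftrightarrow>
     d dvd n \<and> dirichlet_char d \<psi> \<and> (\<forall>a. coprime a (int n) \<longrightarrow> \<psi> a = chi a)"

definition conductor :: "nat \<Rightarrow> (int \<Rightarrow> complex) \<Rightarrow> nat" where
  "conductor n chi = (LEAST d. 0 < d \<and> (\<exists>\<psi>. char_induced_by n chi d \<psi>))"

definition primitive_dirichlet_char :: "nat \<Rightarrow> (int \<Rightarrow> complex) \<Rightarrow> bool" where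
  "primitive_dirichlet_char n chi \<longleftrightarrow> dirichlet_char n chi \<and> conductor n chi = n"

(* Existence and uniqueness are proved in primitive_char_ex1 below. *)
definition primitive_char :: "nat \<Rightarrow> (int \<Rightarrow> complex) \<Rightarrow> int \<Rightarrow> complex" where
  "primitive_char n chi =
     (THE \<psi>. primitive_dirichlet_char (conductor n chi) \<psi> \<and>
            (\<forall>a. coprime a (int n) \<longrightarrow> \<psi> a = chi a))"

definition zeta_root :: "nat \<Rightarrow> complex" where
  "zeta_root m = exp (2 * of_real pi * \<i> / of_nat m)"

(* The sign of the exponent is opposite to the most common convention. *)
definition gauss_sum :: "nat \<Rightarrow> (int \<Rightarrow> complex) \<Rightarrow> complex" where
  "gauss_sum f \<psi> = (\<Sum>j = 1..f. \<psi> (int j) * zeta_root f powi (- int j))"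

definition gen_bernoulli :: "nat \<Rightarrow> nat \<Rightarrow> (int \<Rightarrow> complex) \<Rightarrow> complex" where
  "gen_bernoulli r f \<psi> =
     of_nat f ^ (r - 1) *
       (\<Sum>j = 1..f. \<psi> (int j) * of_real (bernpoly r (real j / real f)))"

text \<open>For \<open>r = 1\<close> the two-sided series is only conditionally convergent and is summed
  symmetrically.\<close>

definition inv_cot_series :: "nat \<Rightarrow> nat \<Rightarrow> int \<Rightarrow> real" where
  "inv_cot_series n r j =
     (if r = 1
      then lim (\<lambda>k. \<Sum>m | \<bar>m\<bar> \<le> int k \<and> [m = j] (mod int n).
                  of_int (moebius_mu (nat \<bar>m\<bar>)) / of_int m ^ r)
      else (\<Sum>\<^sub>\<infinity>m \<in> {m. [m = j] (mod int n)}.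
                  of_int (moebius_mu (nat \<bar>m\<bar>)) / of_int m ^ r))"

definition inv_cot_number :: "nat \<Rightarrow> nat \<Rightarrow> int \<Rightarrow> complex" where
  "inv_cot_number n r j =
     - (\<i> ^ r * of_real pi ^ r) / (fact (r - 1) * of_nat n ^ r) *
       of_real (inv_cot_series n r j)"


text \<open>Well-definedness of the notions above.\<close>

lemma dirichlet_char_1:
  assumes "dirichlet_char n chi"
  shows "chi 1 = 1"
proof -
  have "chi (1 * 1) = chi 1 * chi 1"
    using assms unfolding dirichlet_char_def by blast
  moreover have "chi 1 \<noteq> 0"
    using assms unfolding dirichlet_char_def by simp
  ultimately show ?thesis by simp
qed

lemma dirichlet_char_nonzero_iff:
  assumes "dirichlet_char n chi"
  shows "chi a \<noteq> 0 \<longleftrightarrow> coprime a (int n)"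
  using assms unfolding dirichlet_char_def by blast

lemma dirichlet_char_add_mult:
  assumes "dirichlet_char n chi"
  shows "chi (a + k * int n) = chi a"
proof (induction k rule: int_induct[where k = 0])
  case base
  show ?case by simp
next
  case (step1 i)
  have "a + (i + 1) * int n = (a + i * int n) + int n" by (simp add: algebra_simps)
  then show ?case using assms step1 unfolding dirichlet_char_def by metis
next
  case (step2 i)
  have "a + i * int n = (a + (i - 1) * int n) + int n" by (simp add: algebra_simps)
  then show ?case using assms step2 unfolding dirichlet_char_def by metis
qed

lemma dirichlet_char_cong:
  assumes "dirichlet_char n chi" "[a = b] (mod int n)"
  shows "chi a = chi b"
proof -
  obtain k where "b = a + k * int n"
    using assms(2) by (metis cong_iff_lin mult.commute)
  then show ?thesis using dirichlet_char_add_mult[OF assms(1)] by simp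
qed

lemma dirichlet_char_power:
  assumes "dirichlet_char n chi"
  shows "chi (a ^ k) = chi a ^ k"
proof (induction k)
  case 0
  show ?case using dirichlet_char_1[OF assms] by simp
next
  case (Suc k)
  have "chi (a * a ^ k) = chi a * chi (a ^ k)"
    using assms unfolding dirichlet_char_def by blast
  then show ?case using Suc by simp
qed

lemma finite_dirichlet_chars:
  assumes "n > 0"
  shows "finite {chi. dirichlet_char n chi}"
proof -
  let ?V = "insert 0 {z::complex. z ^ totient n = 1}"
  have finV: "finite ?V"
    using assms by (auto intro!: finite_roots_unity simp: Suc_leI)
  have val: "chi a \<in> ?V" if "dirichlet_char n chi" for chi a
  proof (cases "coprime a (int n)")
    case True
    have "[nat (a mod int n) ^ totient n = 1] (mod n)"
    proof (rule euler_theorem)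
      have "coprime (a mod int n) (int n)" using True assms by simp
      then show "coprime (nat (a mod int n)) n"
        using assms by (metis coprime_int_iff nat_0_le of_nat_0_less_iff pos_mod_sign)
    qed
    then have "[int (nat (a mod int n)) ^ totient n = 1] (mod int n)"
      by (metis cong_int_iff of_nat_1 of_nat_power)
    then have "[(a mod int n) ^ totient n = 1] (mod int n)"
      using assms by simp
    then have "chi (a mod int n) ^ totient n = 1"
      using dirichlet_char_cong[OF that] dirichlet_char_power[OF that]
        dirichlet_char_1[OF that] by metis
    moreover have "chi (a mod int n) = chi a"
      by (rule dirichlet_char_cong[OF that]) simp
    ultimately show ?thesis by simp
  next
    case False
    then show ?thesis using that unfolding dirichlet_char_def by auto
  qed
  let ?F = "\<lambda>chi. restrict chi {0..<int n}"
  have "inj_on ?F {chi. dirichlet_char n chi}"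
  proof (rule inj_onI)
    fix chi \<psi> assume *: "chi \<in> {chi. dirichlet_char n chi}" "\<psi> \<in> {chi. dirichlet_char n chi}" "?F chi = ?F \<psi>"
    show "chi = \<psi>"
    proof
      fix a
      have "chi a = chi (a mod int n)" "\<psi> a = \<psi> (a mod int n)"
        using * by (auto intro!: dirichlet_char_cong[of n])
      moreover have "a mod int n \<in> {0..<int n}" using assms by simp
      then have "chi (a mod int n) = \<psi> (a mod int n)"
        using *(3) by (metis restrict_apply')
      ultimately show "chi a = \<psi> a" by simp
    qed
  qed
  moreover have "?F ` {chi. dirichlet_char n chi} \<subseteq> {0..<int n} \<rightarrow>\<^sub>E ?V"
    by (intro image_subsetI PiE_I) (use val in \<open>auto simp: restrict_def\<close>)
  then have "finite (?F ` {chi. dirichlet_char n chi})"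
    by (rule finite_subset) (intro finite_PiE finV ballI, simp)
  ultimately show ?thesis by (rule finite_imageD[rotated])
qed

lemma finite_parity_chars:
  assumes "n > 0"
  shows "finite (parity_chars n r)"
  by (rule finite_subset[OF _ finite_dirichlet_chars[OF assms]]) (auto simp: parity_chars_def)

lemma conductor_induced:
  assumes "n > 0" "dirichlet_char n chi"
  shows "0 < conductor n chi \<and> (\<exists>\<psi>. char_induced_by n chi (conductor n chi) \<psi>)"
  unfolding conductor_def
  by (rule LeastI[of "\<lambda>d. 0 < d \<and> (\<exists>\<psi>. char_induced_by n chi d \<psi>)" n])
     (use assms in \<open>auto simp: char_induced_by_def\<close>)

lemma conductor_le:
  assumes "0 < d" "char_induced_by n chi d \<psi>"
  shows "conductor n chi \<le> d"
  unfolding conductor_def by (rule Least_le) (use assms in blast)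

lemma ex_coprime_shift:
  fixes a :: int and d n :: nat
  assumes "n > 0" "coprime a (int d)"
  shows "\<exists>k. coprime (a + k * int d) (int n)"
proof -
  define k where "k = \<Prod>{p \<in> prime_factors (int n). \<not> p dvd a}"
  have "coprime (a + k * int d) (int n)"
  proof (rule ccontr)
    assume "\<not> ?thesis"
    then have unit: "\<not> is_unit (gcd (a + k * int d) (int n))"
      by (simp add: coprime_iff_gcd_eq_1)
    have "gcd (a + k * int d) (int n) \<noteq> 0" using assms(1) by simp
    from prime_divisor_exists[OF this unit] obtain p
      where "prime p" "p dvd gcd (a + k * int d) (int n)" by blast
    then have p: "prime p" "p dvd a + k * int d" "p dvd int n" by simp_all
    show False
    proof (cases "p dvd a")
      case True
      then have "p dvd k * int d" using p(2) by (simp add: dvd_add_right_iff)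
      moreover have "\<not> p dvd int d"
        using True p(1) assms(2) by (meson coprime_common_divisor not_prime_unit)
      ultimately have "p dvd k" using p(1) by (simp add: prime_dvd_mult_iff)
      then obtain q where q: "q \<in> prime_factors (int n)" "\<not> q dvd a" "p dvd q"
        unfolding k_def using p(1) by (auto simp: prime_dvd_prod_iff)
      then have "p = q" using p(1) by (auto intro: primes_dvd_imp_eq)
      then show False using True q by simp
    next
      case False
      have "p \<in> {p \<in> prime_factors (int n). \<not> p dvd a}"
        using False p assms(1) by (auto simp: prime_factors_dvd)
      then have "p dvd k" unfolding k_def by (intro dvd_prodI) auto
      then have "p dvd k * int d" by simp
      then show False using p(2) False by (simp add: dvd_add_left_iff)
    qed
  qed
  then show ?thesis ..
qed

lemma char_induced_by_unique:
  assumes "n > 0" "char_induced_by n chi d \<psi>" "char_induced_by n chi d \<psi>'"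
  shows "\<psi> = \<psi>'"
proof
  fix a
  have \<psi>: "dirichlet_char d \<psi>" and \<psi>': "dirichlet_char d \<psi>'"
    using assms(2,3) unfolding char_induced_by_def by simp_all
  show "\<psi> a = \<psi>' a"
  proof (cases "coprime a (int d)")
    case True
    then obtain k where k: "coprime (a + k * int d) (int n)"
      using ex_coprime_shift assms(1) by blast
    then have "\<psi> (a + k * int d) = \<psi>' (a + k * int d)"
      using assms(2,3) unfolding char_induced_by_def by simp
    then show ?thesis
      unfolding dirichlet_char_add_mult[OF \<psi>] dirichlet_char_add_mult[OF \<psi>'] .
  next
    case False
    then have "\<psi> a = 0" "\<psi>' a = 0"
      using dirichlet_char_nonzero_iff[OF \<psi>, of a] dirichlet_char_nonzero_iff[OF \<psi>', of a]
      by simp_all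
    then show ?thesis by simp
  qed
qed

lemma char_induced_by_conductor_primitive:
  assumes "n > 0" "char_induced_by n chi (conductor n chi) \<psi>" "0 < conductor n chi"
  shows "primitive_dirichlet_char (conductor n chi) \<psi>"
proof -
  let ?f = "conductor n chi"
  have \<psi>: "dirichlet_char ?f \<psi>" using assms(2) unfolding char_induced_by_def by simp
  obtain \<psi>' where \<psi>': "char_induced_by ?f \<psi> (conductor ?f \<psi>) \<psi>'" and pos: "0 < conductor ?f \<psi>"
    using conductor_induced[OF assms(3) \<psi>] by blast
  have "coprime a (int ?f)" if "coprime a (int n)" for a
    using that assms(2) unfolding char_induced_by_def
    by (meson coprime_divisors dvd_refl int_dvd_int_iff)
  then have "char_induced_by n chi (conductor ?f \<psi>) \<psi>'"
    using \<psi>' assms(2) unfolding char_induced_by_def by (metis dvd_trans)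
  then have "?f \<le> conductor ?f \<psi>"
    using pos conductor_le by blast
  moreover have "conductor ?f \<psi> \<le> ?f"
    using \<psi>' assms(3) unfolding char_induced_by_def by (auto intro: dvd_imp_le)
  ultimately show ?thesis using \<psi> unfolding primitive_dirichlet_char_def by simp
qed

lemma primitive_char_ex1:
  assumes "n > 0" "dirichlet_char n chi"
  shows "\<exists>!\<psi>. primitive_dirichlet_char (conductor n chi) \<psi> \<and>
               (\<forall>a. coprime a (int n) \<longrightarrow> \<psi> a = chi a)"
proof -
  obtain \<psi> where \<psi>: "char_induced_by n chi (conductor n chi) \<psi>" and pos: "0 < conductor n chi"
    using conductor_induced[OF assms] by blast
  show ?thesis
  proof (rule ex1I[of _ \<psi>])
    show "primitive_dirichlet_char (conductor n chi) \<psi> \<and> (\<forall>a. coprime a (int n) \<longrightarrow> \<psi> a = chi a)"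
      using char_induced_by_conductor_primitive[OF assms(1) \<psi> pos] \<psi>
      unfolding char_induced_by_def by simp
  next
    fix \<psi>' assume "primitive_dirichlet_char (conductor n chi) \<psi>' \<and>
                   (\<forall>a. coprime a (int n) \<longrightarrow> \<psi>' a = chi a)"
    then have "char_induced_by n chi (conductor n chi) \<psi>'"
      using \<psi> unfolding char_induced_by_def primitive_dirichlet_char_def by simp
    then show "\<psi>' = \<psi>" using char_induced_by_unique[OF assms(1) _ \<psi>] by simp
  qed
qed

end

theory Submission
  imports Defs "HOL-Complex_Analysis.Complex_Analysis"
begin

text \<open>
  By orthogonality, the two-sided series over \<open>m \<equiv> 1 (mod n)\<close> is \<open>2 / \<phi>(n)\<close> times the sum
  over the characters \<open>\<chi>\<close> with \<open>\<chi>(-1) = (-1)\<^sup>r\<close> of \<open>\<Sum> \<mu>(k) \<chi>(k) / k\<^sup>r = 1 / L(r, \<chi>)\<close>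
  (\<open>inv_cot_partial_sum\<close>). Removing the Euler factors at the primes dividing \<open>n\<close> reduces
  \<open>L(r, \<chi>)\<close> to \<open>L(r, \<chi>\<^sub>f)\<close>. Substituting the Fourier series of the Bernoulli polynomial into
  the generalized Bernoulli number of the conjugate character expresses the latter as an
  explicit nonzero multiple of \<open>\<tau> L(r, \<chi>\<^sub>f)\<close> (\<open>gen_bernoulli_eq_L\<close>). As \<open>\<tau>\<close> and \<open>L\<close> do not
  vanish, the formula follows (\<open>parity_char_moebius_value\<close>).

  For \<open>r \<ge> 2\<close> all series converge absolutely. For \<open>r = 1\<close> the mere convergence of
  \<open>\<Sum> \<mu>(k) \<chi>(k) / k\<close> is a statement of the depth of the prime number theorem in arithmetic
  progressions. It is obtained from the Tauberian theorem of Ingham, with the contour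
  argument of Newman (\<open>newman_ingham\<close>), applied to \<open>1 / L(s, \<chi>)\<close>. That function is
  holomorphic on a neighbourhood of \<open>Re s \<ge> 1\<close> because \<open>L\<close> has no zero on the line
  \<open>Re s = 1\<close> (\<open>char_L_nonzero\<close>). For this last fact, a zero at \<open>1 + it\<close> would make
  \<open>\<zeta>(s)\<^sup>2 L(s + it, \<chi>) L(s - it, cnj \<chi>)\<close> holomorphic for \<open>Re s > 0\<close>, although its Dirichlet
  coefficients are nonnegative and at least 1 at squares, which is incompatible with
  Landau's lemma (\<open>landau_nonneg\<close>) at \<open>s = 1 / 2\<close>.

  The Fourier series of the Bernoulli polynomials is needed pointwise even for \<open>r = 1\<close>,
  where it converges only conditionally. It is treated through its Abel means: for \<open>r = 1\<close>
  these are given by the complex logarithm, and the passage from \<open>r\<close> to \<open>r + 1\<close> is an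
  integration (\<open>fourier_error_L1_tendsto\<close>). The orthogonality relations rest on the
  extension of characters from subgroups of the units (\<open>partial_char_extend\<close>).
\<close>

section \<open>Dirichlet convolution and multiplicative functions\<close>

definition dconv :: "(nat \<Rightarrow> 'a::comm_semiring_1) \<Rightarrow> (nat \<Rightarrow> 'a) \<Rightarrow> nat \<Rightarrow> 'a" where
  "dconv f g n = (\<Sum>d | d dvd n. f d * g (n div d))"

text \<open>Nothing is required at 0, so that the notion applies to functions with an arbitrary value
  there.\<close>
definition mult_fun :: "(nat \<Rightarrow> 'a::comm_semiring_1) \<Rightarrow> bool" where
  "mult_fun f \<longleftrightarrow> f 1 = 1 \<and> (\<forall>a b. a > 0 \<longrightarrow> b > 0 \<longrightarrow> coprime a b \<longrightarrow> f (a * b) = f a * f b)"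

text \<open>The map \<open>(a, b) \<mapsto> (a * b, a)\<close> is a bijection from pairs of positive integers to pairs
  \<open>(n, d)\<close> with \<open>d\<close> a divisor of \<open>n\<close>, and by absolute convergence the double series may be
  summed along the fibres of \<open>n\<close>. The values at 0 have to vanish because 0 takes no part in
  this bijection.\<close>
lemma dconv_sums:
  fixes f g :: "nat \<Rightarrow> complex"
  assumes f: "f 0 = 0" "summable (\<lambda>n. norm (f n))" and g: "g 0 = 0" "summable (\<lambda>n. norm (g n))"
  shows "summable (\<lambda>n. norm (dconv f g n))" "suminf (dconv f g) = suminf f * suminf g"
proof -
  have hf: "(f has_sum suminf f) UNIV" and hg: "(g has_sum suminf g) UNIV"
    using f g by (auto intro!: norm_summable_imp_has_sum summable_sums dest: summable_norm_cancel)
  have af: "(\<lambda>n. norm (f n)) summable_on UNIV" and ag: "(\<lambda>n. norm (g n)) summable_on UNIV"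
    using f g by (auto intro!: norm_summable_imp_summable_on)
  have hf1: "(f has_sum suminf f) {0<..}" and hg1: "(g has_sum suminf g) {0<..}"
    using hf hg f(1) g(1) by (auto elim!: has_sum_cong_neutral[THEN iffD1, rotated -1] intro!: Nat.gr0I)
  have af1: "(\<lambda>n. norm (f n)) summable_on {0<..}" and ag1: "(\<lambda>n. norm (g n)) summable_on {0<..}"
    using af ag by (auto intro: summable_on_subset_banach)
  let ?h = "\<lambda>(a,b). f a * g b"
  have abs: "(\<lambda>x. norm (?h x)) summable_on ({0<..} \<times> {0<..})"
  proof (rule summable_on_SigmaI)
    show "((\<lambda>y. norm (?h (x, y))) has_sum (norm (f x) * (\<Sum>\<^sub>\<infinity>y\<in>{0<..}. norm (g y)))) {0<..}" for x
      using has_sum_cmult_right[OF has_sum_infsum[OF ag1], of "norm (f x)"] by (simp add: norm_mult)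
    show "(\<lambda>x. norm (f x) * (\<Sum>\<^sub>\<infinity>y\<in>{0<..}. norm (g y))) summable_on {0<..}"
      using summable_on_cmult_left[OF af1] by simp
  qed auto
  have hs: "(?h has_sum (suminf f * suminf g)) ({0<..} \<times> {0<..})"
  proof (rule has_sum_SigmaI)
    show "((\<lambda>y. ?h (x, y)) has_sum (f x * suminf g)) {0<..}" for x
      using has_sum_cmult_right[OF hg1, of "f x"] by simp
    show "((\<lambda>x. f x * suminf g) has_sum (suminf f * suminf g)) {0<..}"
      using has_sum_cmult_left[OF hf1] by simp
    show "?h summable_on ({0<..} \<times> {0<..})"
      using abs by (rule abs_summable_summable)
  qed
  let ?S = "SIGMA n:{0<..}. {d. d dvd n}"
  let ?k = "\<lambda>(n,d). f d * g (n div d)"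
  have bij: "bij_betw (\<lambda>(a::nat,b). (a*b, a)) ({0<..} \<times> {0<..}) ?S"
    by (rule bij_betw_byWitness[where f' = "\<lambda>(n,d). (d, n div d)"])
      (auto simp: dvd_div_eq_0_iff intro: dvd_pos_nat intro!: Nat.gr0I)
  have hs2: "(?k has_sum (suminf f * suminf g)) ?S"
    using hs has_sum_reindex_bij_betw[OF bij, of ?k] by (simp add: case_prod_unfold)
      (smt (verit, best) SigmaE case_prod_unfold fst_conv greaterThan_iff has_sum_cong neq0_conv nonzero_mult_div_cancel_left snd_conv)
  have abs2: "(\<lambda>x. norm (?k x)) summable_on ?S"
  proof -
    have "(\<lambda>x. norm (?k ((\<lambda>(a,b). (a*b, a)) x))) summable_on ({0<..} \<times> {0<..})"
      by (rule summable_on_cong[THEN iffD1, OF _ abs]) auto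
    then show ?thesis
      using summable_on_reindex_bij_betw[OF bij, of "\<lambda>x. norm (?k x)"] by simp
  qed
  have fin: "finite {d. d dvd n}" if "n > 0" for n :: nat using that by simp
  have "(dconv f g has_sum (suminf f * suminf g)) {0<..}"
  proof (rule has_sum_Sigma'[OF hs2])
    show "((\<lambda>y. ?k (x, y)) has_sum dconv f g x) {d. d dvd x}" if "x \<in> {0<..}" for x
      using that by (auto simp: dconv_def intro!: has_sum_finiteI fin)
  qed
  then have h: "(dconv f g has_sum (suminf f * suminf g)) UNIV"
    by (rule has_sum_cong_neutral[THEN iffD1, rotated -1]) (auto simp: dconv_def)
  then show "suminf (dconv f g) = suminf f * suminf g"
    by (auto dest!: has_sum_imp_sums sums_unique)
  have "(\<lambda>n. \<Sum>\<^sub>\<infinity>d\<in>{d. d dvd n}. norm (?k (n,d))) summable_on {0<..}"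
  proof (rule summable_on_SigmaD[OF abs2])
    show "(\<lambda>y. norm (?k (x, y))) summable_on {d. d dvd x}" if "x \<in> {0<..}" for x
      using that fin by (intro summable_on_finite) auto
  qed
  then have "(\<lambda>n. norm (dconv f g n)) summable_on {0<..}"
  proof (rule summable_on_comparison_test)
    show "norm (dconv f g n) \<le> (\<Sum>\<^sub>\<infinity>d\<in>{d. d dvd n}. norm (?k (n,d)))" if "n \<in> {0<..}" for n
      using that fin[of n] by (auto simp: dconv_def intro!: sum_norm_le)
  qed auto
  then have "(\<lambda>n. norm (dconv f g n)) summable_on UNIV"
    by (rule summable_on_cong_neutral[THEN iffD1, rotated -1]) (auto simp: dconv_def)
  then show "summable (\<lambda>n. norm (dconv f g n))"
    by (rule summable_on_imp_summable)
qed

lemma dconv_mult_fun: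
  assumes f: "mult_fun f" and g: "mult_fun g"
  shows "mult_fun (dconv f g)"
  unfolding mult_fun_def
proof (intro conjI allI impI)
  show "dconv f g 1 = 1"
    using f g by (simp add: dconv_def mult_fun_def)
next
  fix a b :: nat assume ab: "a > 0" "b > 0" "coprime a b"
  have inj: "inj_on (\<lambda>(d,e). d * e) ({d. d dvd a} \<times> {d. d dvd b})"
  proof (rule inj_onI, clarsimp)
    fix d e d' e' assume *: "d dvd a" "e dvd b" "d' dvd a" "e' dvd b" "d * e = d' * e'"
    have "d = gcd (d * e) a" if "d dvd a" "e dvd b" for d e
      using that ab by (metis coprime_commute coprime_divisors dvd_refl gcd_mult_right_right_cancel gcd.commute gcd_nat.absorb1)
    then have "d = d'" using * by metis
    moreover have "d \<noteq> 0" using * ab by auto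
    ultimately show "d = d' \<and> e = e'" using * by auto
  qed
  have im: "(\<lambda>(d,e). d * e) ` ({d. d dvd a} \<times> {d. d dvd b}) = {d. d dvd a * b}"
  proof (intro equalityI subsetI)
    fix x assume "x \<in> {d. d dvd a * b}"
    then obtain d e where "x = d * e" "d dvd a" "e dvd b"
      using division_decomp[of x a b] by auto
    then show "x \<in> (\<lambda>(d,e). d * e) ` ({d. d dvd a} \<times> {d. d dvd b})" by force
  qed (auto intro: mult_dvd_mono)
  have "dconv f g (a * b) = (\<Sum>(d,e)\<in>{d. d dvd a} \<times> {d. d dvd b}. f (d * e) * g (a * b div (d * e)))"
    unfolding dconv_def im[symmetric] by (subst sum.reindex[OF inj]) (simp add: case_prod_unfold)
  also have "\<dots> = (\<Sum>(d,e)\<in>{d. d dvd a} \<times> {d. d dvd b}. (f d * g (a div d)) * (f e * g (b div e)))"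
  proof (intro sum.cong refl, clarify)
    fix d e assume de: "d dvd a" "e dvd b"
    have pos: "d > 0" "e > 0" "a div d > 0" "b div e > 0"
      using de ab by (auto simp: dvd_div_eq_0_iff intro: dvd_pos_nat intro!: Nat.gr0I)
    have "coprime d e" "coprime (a div d) (b div e)"
      using de ab(3) by (auto intro: coprime_divisors[OF _ _ ab(3)] div_dvd_iff_mult)
        (metis coprime_divisors dvd_div_mult_self dvd_triv_left)
    then show "f (d * e) * g (a * b div (d * e)) = f d * g (a div d) * (f e * g (b div e))"
      using f g pos de unfolding mult_fun_def by (simp add: div_mult_div_if_dvd[symmetric] mult_ac)
  qed
  also have "\<dots> = dconv f g a * dconv f g b"
    unfolding dconv_def sum_product sum.cartesian_product ..
  finally show "dconv f g (a * b) = dconv f g a * dconv f g b" .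
qed

lemma dconv_prime_power:
  assumes "prime p"
  shows "dconv f g (p ^ k) = (\<Sum>i\<le>k. f (p ^ i) * g (p ^ (k - i)))"
proof -
  have eq: "{d. d dvd p ^ k} = (\<lambda>i. p ^ i) ` {..k}"
    using assms by (auto simp: divides_primepow_nat)
  have inj: "inj_on (\<lambda>i. p ^ i) {..k}"
    using assms by (auto intro!: inj_onI dest: prime_gt_1_nat simp: power_inject_exp)
  show ?thesis
    unfolding dconv_def eq using assms
    by (subst sum.reindex[OF inj]) (auto intro!: sum.cong simp: power_diff prime_gt_0_nat)
qed

lemma mult_fun_prod_prime_powers:
  assumes f: "mult_fun f" and n: "n > 0"
  shows "f n = (\<Prod>p\<in>prime_factors n. f (p ^ multiplicity p n))"
proof -
  have "f (\<Prod>p\<in>A. p ^ k p) = (\<Prod>p\<in>A. f (p ^ k p))"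
    if "finite A" "\<And>p. p \<in> A \<Longrightarrow> prime p" for A and k :: "nat \<Rightarrow> nat"
    using that
  proof (induction A rule: finite_induct)
    case empty
    then show ?case using f by (simp add: mult_fun_def)
  next
    case (insert q A)
    have "coprime (q ^ k q) (\<Prod>p\<in>A. p ^ k p)"
      using insert by (intro prod_coprime_right coprime_power_left_iff[THEN iffD2] disjI1 coprime_power_right_iff[THEN iffD2]) (auto intro!: primes_coprime)
    moreover have "q ^ k q > 0" "(\<Prod>p\<in>A. p ^ k p) > 0"
      using insert by (auto intro!: prod_pos prime_gt_0_nat)
    ultimately show ?case using insert f by (simp add: mult_fun_def)
  qed
  from this[of "prime_factors n" "\<lambda>p. multiplicity p n"] show ?thesis
    using prime_factorization_nat[OF n] by (metis finite_set_mset in_prime_factors_imp_prime)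
qed

lemma moebius_mult_fun: "mult_fun moebius_mu"
  unfolding mult_fun_def
proof (intro conjI allI impI)
  show "moebius_mu 1 = 1" by (simp add: moebius_mu_def)
next
  fix a b :: nat assume ab: "a > 0" "b > 0" "coprime a b"
  have "squarefree (a * b) \<longleftrightarrow> squarefree a \<and> squarefree b"
    using ab squarefree_mult_coprime squarefree_multD by metis
  moreover have "card (prime_factors (a * b)) = card (prime_factors a) + card (prime_factors b)"
  proof -
    have "prime_factors a \<inter> prime_factors b = {}"
    proof (intro equals0I)
      fix p assume "p \<in> prime_factors a \<inter> prime_factors b"
      then have "p dvd a" "p dvd b" "prime p" by auto
      then show False using ab(3) coprime_common_divisor not_prime_unit by blast
    qed
    then show ?thesis using ab
      by (simp add: prime_factors_product card_Un_disjoint)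
  qed
  ultimately show "moebius_mu (a * b) = moebius_mu a * moebius_mu b"
    by (auto simp: moebius_mu_def power_add)
qed

lemma moebius_prime_power:
  assumes "prime p"
  shows "moebius_mu (p ^ k) = (if k = 0 then 1 else if k = 1 then -1 else 0)"
proof -
  have "squarefree (p ^ k) \<longleftrightarrow> k \<le> 1"
    using assms by (auto simp: squarefree_power_iff squarefree_prime dest: not_prime_unit)
  then show ?thesis
    using assms by (auto simp: moebius_mu_def prime_factors_power prime_prime_factors prime_factorization_prime)
qed

text \<open>The convolution of \<open>\<mu>\<close> with the constant 1 is multiplicative, and at \<open>p\<^sup>k\<close> with \<open>k > 0\<close> it
  is \<open>\<mu> 1 + \<mu> p = 0\<close>.\<close>
lemma sum_moebius_divisors:
  assumes "n > 0"
  shows "(\<Sum>d | d dvd n. moebius_mu d) = (if n = 1 then 1 else 0)"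
proof -
  have m: "mult_fun (dconv moebius_mu (\<lambda>_. 1))"
    by (intro dconv_mult_fun moebius_mult_fun) (simp add: mult_fun_def)
  have pp: "dconv moebius_mu (\<lambda>_. 1) (p ^ k) = 0" if "prime p" "k > 0" for p k
  proof -
    have "dconv moebius_mu (\<lambda>_. 1) (p ^ k) = (\<Sum>i\<le>k. if i = 0 then 1 else if i = 1 then -1 else 0)"
      using that by (simp add: dconv_prime_power moebius_prime_power)
    also have "\<dots> = (\<Sum>i\<in>{0,1::nat}. if i = 0 then 1 else if i = 1 then -1 else 0)"
      using that by (intro sum.mono_neutral_right) auto
    finally show ?thesis by simp
  qed
  have "dconv moebius_mu (\<lambda>_. 1) n = (if n = 1 then 1 else 0)"
  proof (cases "n = 1")
    case True
    then show ?thesis using m by (simp add: mult_fun_def)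
  next
    case False
    then obtain p where p: "p \<in> prime_factors n"
      using assms by (metis prime_factors_dvd prime_factor_nat neq0_conv mem_Collect_eq in_prime_factors_iff)
    then have "dconv moebius_mu (\<lambda>_. 1) (p ^ multiplicity p n) = 0"
      by (intro pp) (auto simp: prime_factors_multiplicity)
    then show ?thesis
      unfolding mult_fun_prod_prime_powers[OF m assms] using p False by auto
  qed
  then show ?thesis by (simp add: dconv_def)
qed

text \<open>A completely multiplicative \<open>h\<close> distributes over convolution, so \<open>\<mu> h * h = h (\<mu> * 1)\<close>,
  which is supported at 1.\<close>
lemma moebius_dirichlet_inverse:
  fixes h :: "nat \<Rightarrow> complex"
  assumes h: "h 0 = 0" "h 1 = 1" "\<And>a b. h (a * b) = h a * h b" "summable (\<lambda>n. norm (h n))"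
  shows "(\<Sum>n. of_int (moebius_mu n) * h n) * (\<Sum>n. h n) = 1"
proof -
  have mu: "norm (of_int (moebius_mu n) :: complex) \<le> 1" for n
    by (simp add: moebius_mu_def norm_power)
  have s: "summable (\<lambda>n. norm (of_int (moebius_mu n) * h n))"
    by (rule summable_comparison_test'[OF h(4), of 0])
      (use mu in \<open>auto simp: norm_mult intro!: mult_left_le_one_le\<close>)
  have "dconv (\<lambda>n. of_int (moebius_mu n) * h n) h n = (if n = 1 then 1 else 0)" for n
  proof (cases "n = 0")
    case False
    have "dconv (\<lambda>n. of_int (moebius_mu n) * h n) h n = (\<Sum>d | d dvd n. of_int (moebius_mu d) * h n)"
      unfolding dconv_def
    proof (intro sum.cong refl)
      fix d assume "d \<in> {d. d dvd n}"
      then have "h d * h (n div d) = h n" by (simp flip: h(3))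
      then show "of_int (moebius_mu d) * h d * h (n div d) = of_int (moebius_mu d) * h n" by simp
    qed
    also have "\<dots> = of_int (\<Sum>d | d dvd n. moebius_mu d) * h n"
      by (simp add: sum_distrib_right)
    finally show ?thesis using False h(2) by (simp add: sum_moebius_divisors)
  qed (simp add: dconv_def)
  then have "dconv (\<lambda>n. of_int (moebius_mu n) * h n) h = (\<lambda>n. if n = 1 then 1 else 0)" by auto
  moreover have "suminf (\<lambda>n. if n = 1 then 1 else 0 :: complex) = 1"
    using sums_unique[OF sums_single[of 1 "\<lambda>_. 1::complex"]] by simp
  ultimately show ?thesis using dconv_sums(2)[OF _ s h(1,4)] h(1) by simp
qed

text \<open>This is the local factor of \<open>\<zeta>(s)\<^sup>2 L(s + it, \<chi>) L(s - it, cnj \<chi>)\<close>: for \<open>w\<close> of norm 1 the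
  numbers \<open>S k\<close> are the coefficients of \<open>1 / ((1 - x)\<^sup>2 (1 - w x) (1 - cnj w x))\<close>. From
  \<open>l (i + 1) = 1 + w l i\<close> one obtains \<open>S (k + 2) = S k + |l (k + 2)|\<^sup>2\<close>, whence all \<open>S k\<close>
  are nonnegative and those of even index are at least \<open>S 0 = 1\<close>. For \<open>w = 0\<close> all \<open>l i\<close>
  equal 1.\<close>
lemma geometric_conv_nonneg:
  fixes w :: complex and k :: nat
  defines "l \<equiv> \<lambda>i. \<Sum>j\<le>i. w ^ j"
  defines "S \<equiv> \<lambda>k. \<Sum>i\<le>k. l i * cnj (l (k - i))"
  assumes w: "norm w = 1 \<or> w = 0"
  shows "\<exists>x\<ge>0. S k = of_real x \<and> (even k \<longrightarrow> x \<ge> 1)"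
proof (cases "w = 0")
  case True
  have "l i = 1" for i
    unfolding l_def True by (induction i) auto
  then show ?thesis by (intro exI[of _ "real k + 1"]) (simp add: S_def)
next
  case False
  then have ww: "w * cnj w = 1" using w by (simp add: complex_norm_square[symmetric])
  have l1: "l (Suc i) = 1 + w * l i" for i
    by (simp add: l_def sum.atMost_Suc_shift sum_distrib_left del: sum.atMost_Suc)
  \<comment> \<open>The last summand is the sum of \<open>w\<^sup>m\<close> for \<open>- (j + 1) \<le> m \<le> i + 1\<close> if \<open>w\<close> has norm 1.\<close>
  have step: "l (Suc i) * cnj (l (Suc j)) = l i * cnj (l j) + (l (Suc i) + cnj (l (Suc j)) - 1)" for i j
  proof -
    have "l (Suc i) * cnj (l (Suc j)) = 1 + w * l i + cnj w * cnj (l j) + (w * cnj w) * (l i * cnj (l j))"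
      unfolding l1 by (simp add: algebra_simps)
    then show ?thesis unfolding ww by (simp add: l1)
  qed
  have l0: "l 0 = 1" by (simp add: l_def)
  \<comment> \<open>Summing the increments of the previous identity along the diagonal.\<close>
  have Q: "l K * cnj (l K) = (\<Sum>i\<le>K. l i + cnj (l (K - i)) - 1)" for K
  proof -
    have "(\<Sum>i\<le>K. cnj (l (K - i))) = (\<Sum>i\<le>K. cnj (l i))"
      by (rule sum.reindex_bij_witness[of _ "\<lambda>i. K - i" "\<lambda>i. K - i"]) auto
    then have "(\<Sum>i\<le>K. l i + cnj (l (K - i)) - 1) = (\<Sum>i\<le>K. l i + cnj (l i) - 1)"
      by (simp add: sum.distrib sum_subtractf)
    also have "\<dots> = l K * cnj (l K)"
    proof (induction K)
      case (Suc K)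
      then show ?case using step[of K K] by simp
    qed (simp add: l0)
    finally show ?thesis by simp
  qed
  have rec: "S (Suc (Suc k)) = S k + l (Suc (Suc k)) * cnj (l (Suc (Suc k)))" for k
  proof -
    let ?K = "Suc (Suc k)"
    have split: "(\<Sum>i\<le>?K. F i) = F 0 + F ?K + (\<Sum>i\<le>k. F (Suc i))" for F :: "nat \<Rightarrow> complex"
      by (subst sum.atMost_Suc, subst sum.atMost_Suc_shift) simp
    have "S ?K = cnj (l ?K) + l ?K + (\<Sum>i\<le>k. l (Suc i) * cnj (l (Suc (k - i))))"
      unfolding S_def split[of "\<lambda>i. l i * cnj (l (?K - i))"]
      by (auto simp: l0 Suc_diff_le intro!: sum.cong)
    also have "(\<Sum>i\<le>k. l (Suc i) * cnj (l (Suc (k - i)))) = S k + (\<Sum>i\<le>k. l (Suc i) + cnj (l (Suc (k - i))) - 1)"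
      by (simp only: step S_def sum.distrib)
    also have "l ?K * cnj (l ?K) = cnj (l ?K) + l ?K + (\<Sum>i\<le>k. l (Suc i) + cnj (l (Suc (k - i))) - 1)"
      unfolding Q split by (auto simp: l0 Suc_diff_le intro!: sum.cong)
    ultimately show ?thesis by simp
  qed
  show ?thesis
  proof (induction k rule: induct_nat_012)
    case 0
    show ?case by (intro exI[of _ 1]) (simp add: S_def l0)
  next
    case 1
    have "S 1 = l 1 * cnj (l 1)"
      unfolding Q by (simp add: S_def l0)
    then have "S 1 = of_real ((norm (l 1))\<^sup>2)" by (simp only: complex_norm_square)
    then show ?case by (intro exI[of _ "(norm (l 1))\<^sup>2"]) simp
  next
    case (ge2 n)
    then obtain x where x: "x \<ge> 0" "S n = of_real x" "even n \<longrightarrow> x \<ge> 1" by blast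
    have "S (Suc (Suc n)) = of_real (x + (norm (l (Suc (Suc n))))\<^sup>2)"
      unfolding rec x by (simp only: complex_norm_square of_real_add)
    with x show ?case by (intro exI[of _ "x + (norm (l (Suc (Suc n))))\<^sup>2"]) (auto intro: add_increasing2)
  qed
qed

text \<open>Everything in sight is multiplicative, so the claim reduces to prime powers, where the
  inner convolution is a geometric sum. At a square all exponents are even and every local
  factor is at least 1.\<close>
lemma conv_square_nonneg:
  fixes a :: "nat \<Rightarrow> complex"
  assumes a1: "a 1 = 1" and am: "\<And>x y. x > 0 \<Longrightarrow> y > 0 \<Longrightarrow> a (x * y) = a x * a y"
    and an: "\<And>x. x > 0 \<Longrightarrow> norm (a x) = 1 \<or> a x = 0"
  defines "l \<equiv> dconv (\<lambda>_. 1) a"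
  defines "c \<equiv> dconv l (\<lambda>n. cnj (l n))"
  assumes n: "n > 0"
  shows "\<exists>x\<ge>0. c n = of_real x \<and> ((\<exists>m. n = m ^ 2) \<longrightarrow> x \<ge> 1)"
proof -
  have l: "mult_fun l" unfolding l_def
    by (rule dconv_mult_fun) (use a1 am in \<open>auto simp: mult_fun_def\<close>)
  then have c: "mult_fun c" unfolding c_def
    by (intro dconv_mult_fun) (auto simp: mult_fun_def)
  have "\<exists>x\<ge>0. c (p ^ k) = of_real x \<and> (even k \<longrightarrow> x \<ge> 1)" if p: "prime p" for p k
  proof -
    have p0: "p > 0" using p by (simp add: prime_gt_0_nat)
    have ap: "a (p ^ k) = a p ^ k" for k
      by (induction k) (use a1 am p0 in auto)
    have "l (p ^ i) = (\<Sum>j\<le>i. a p ^ (i - j))" for i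
      by (simp add: l_def dconv_prime_power[OF p] ap)
    also have "(\<Sum>j\<le>i. a p ^ (i - j)) = (\<Sum>j\<le>i. a p ^ j)" for i
      by (rule sum.reindex_bij_witness[of _ "\<lambda>j. i - j" "\<lambda>j. i - j"]) auto
    finally show ?thesis
      using geometric_conv_nonneg[of "a p" k] an[OF p0]
      unfolding c_def dconv_prime_power[OF p] by simp
  qed
  then obtain x where x: "\<And>p k. prime p \<Longrightarrow> x p k \<ge> 0 \<and> c (p ^ k) = of_real (x p k) \<and> (even k \<longrightarrow> x p k \<ge> 1)"
    by metis
  let ?y = "\<Prod>p\<in>prime_factors n. x p (multiplicity p n)"
  have "c n = of_real ?y"
    unfolding mult_fun_prod_prime_powers[OF c n] of_real_prod using x by (intro prod.cong) auto
  moreover have "?y \<ge> 0" using x by (intro prod_nonneg) auto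
  moreover have "?y \<ge> 1" if "\<exists>m. n = m ^ 2"
  proof (rule prod_ge_1)
    fix p assume p: "p \<in> prime_factors n"
    from that obtain m where "n = m ^ 2" by blast
    with p n have "prime_elem p" "m \<noteq> 0" by auto
    with \<open>n = m ^ 2\<close> have "even (multiplicity p n)"
      by (simp add: prime_elem_multiplicity_power_distrib)
    with x p show "x p (multiplicity p n) \<ge> 1" by auto
  qed
  ultimately show ?thesis by blast
qed

section \<open>Orthogonality of Dirichlet characters\<close>

text \<open>A character of a subgroup of the units modulo \<open>n\<close>. The subgroup is represented by the set
  \<open>H\<close> of all integers in its residue classes; closure under inverses is automatic in a
  finite group.\<close>
definition partial_char :: "nat \<Rightarrow> int set \<Rightarrow> (int \<Rightarrow> complex) \<Rightarrow> bool" where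
  "partial_char n H chi \<longleftrightarrow>
     H \<subseteq> {a. coprime a (int n)} \<and> 1 \<in> H \<and> (\<forall>a\<in>H. \<forall>b\<in>H. a * b \<in> H) \<and>
     (\<forall>a\<in>H. \<forall>b. [a = b] (mod int n) \<longrightarrow> b \<in> H \<and> chi b = chi a) \<and>
     (\<forall>a\<in>H. \<forall>b\<in>H. chi (a * b) = chi a * chi b) \<and> (\<forall>a\<in>H. chi a \<noteq> 0)"

lemma partial_char_1:
  assumes "partial_char n H chi" shows "chi 1 = 1"
proof -
  have "chi (1 * 1) = chi 1 * chi 1" "chi 1 \<noteq> 0"
    using assms unfolding partial_char_def by blast+
  then show ?thesis by simp
qed

lemma partial_char_power:
  assumes "partial_char n H chi" "a \<in> H" shows "a ^ i \<in> H \<and> chi (a ^ i) = chi a ^ i"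
proof (induction i)
  case 0
  then show ?case using partial_char_1[OF assms(1)] assms(1) by (simp add: partial_char_def)
next
  case (Suc i)
  then show ?case using assms unfolding partial_char_def power_Suc by metis
qed

lemma coprime_power_totient_cong:
  fixes a :: int assumes "n > 0" "coprime a (int n)" shows "[a ^ totient n = 1] (mod int n)"
proof -
  have "[nat (a mod int n) ^ totient n = 1] (mod n)"
  proof (rule euler_theorem)
    have "coprime (a mod int n) (int n)" using assms by simp
    then show "coprime (nat (a mod int n)) n"
      using assms by (metis coprime_int_iff nat_0_le of_nat_0_less_iff pos_mod_sign)
  qed
  then have "[int (nat (a mod int n)) ^ totient n = 1] (mod int n)"
    by (metis cong_int_iff of_nat_1 of_nat_power)
  then have "[(a mod int n) ^ totient n = 1] (mod int n)"
    using assms by simp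
  moreover have "[(a mod int n) ^ totient n = a ^ totient n] (mod int n)"
    by (intro cong_pow) simp
  ultimately show ?thesis by (metis cong_sym cong_trans)
qed

lemma partial_char_cancel:
  assumes p: "partial_char n H chi" and n: "n > 0" and h: "h \<in> H" "h * x \<in> H"
  shows "x \<in> H"
proof -
  have cop: "coprime h (int n)" using p h unfolding partial_char_def by auto
  have t: "totient n > 0" using n by simp
  have "h ^ (totient n - 1) * (h * x) \<in> H"
    using p h partial_char_power[OF p h(1), of "totient n - 1"] unfolding partial_char_def by blast
  also have "h ^ (totient n - 1) * (h * x) = h ^ totient n * x"
    using t by (simp flip: power_Suc2 mult.assoc)
  finally have 1: "h ^ totient n * x \<in> H" .
  have "[h ^ totient n * x = 1 * x] (mod int n)"
    by (intro cong_mult coprime_power_totient_cong cop n cong_refl)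
  with 1 p show ?thesis unfolding partial_char_def by (metis mult_1)
qed

text \<open>Let \<open>k\<close> be the order of \<open>g\<close> modulo the subgroup \<open>H\<close>. Every element of the subgroup
  generated by \<open>H\<close> and \<open>g\<close> is congruent to some \<open>h g\<^sup>i\<close>, and \<open>h g\<^sup>i \<mapsto> chi h z\<^sup>i\<close> is well
  defined exactly because \<open>z\<^sup>k = chi (g\<^sup>k)\<close>: two representations differ by a power of \<open>g\<^sup>k\<close>.\<close>
lemma partial_char_extend_by_root:
  assumes p: "partial_char n H chi" and n: "n > 0" and g: "coprime g (int n)"
    and k: "k > 0" "g ^ k \<in> H" "\<And>j. 0 < j \<Longrightarrow> j < k \<Longrightarrow> g ^ j \<notin> H"
    and z: "z ^ k = chi (g ^ k)"
  shows "\<exists>K chi'. partial_char n K chi' \<and> H \<subseteq> K \<and> g \<in> K \<and> (\<forall>x\<in>H. chi' x = chi x) \<and> chi' g = z"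
proof -
  have H1: "1 \<in> H" and Hmult: "\<And>a b. a \<in> H \<Longrightarrow> b \<in> H \<Longrightarrow> a * b \<in> H"
    and Hcop: "\<And>a. a \<in> H \<Longrightarrow> coprime a (int n)"
    and Hcong: "\<And>a b. a \<in> H \<Longrightarrow> [a = b] (mod int n) \<Longrightarrow> b \<in> H \<and> chi b = chi a"
    and chim: "\<And>a b. a \<in> H \<Longrightarrow> b \<in> H \<Longrightarrow> chi (a * b) = chi a * chi b"
    and chi0: "\<And>a. a \<in> H \<Longrightarrow> chi a \<noteq> 0"
    using p unfolding partial_char_def by blast+
  have z0: "z \<noteq> 0" using z chi0[OF k(2)] k(1) by (auto simp: power_0_left)
  have kdvd: "k dvd d \<and> chi (g ^ d) = z ^ d" if d: "g ^ d \<in> H" for d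
  proof -
    have "g ^ d = (g ^ k) ^ (d div k) * g ^ (d mod k)"
      by (simp flip: power_mult power_add)
    then have "g ^ (d mod k) \<in> H"
      using partial_char_cancel[OF p n] partial_char_power[OF p k(2)] d by metis
    then have 0: "d mod k = 0" using k(1) k(3)[of "d mod k"] by (metis mod_less_divisor not_gr0)
    have "g ^ d = (g ^ k) ^ (d div k)" using 0 by (metis mult_div_mod_eq add.right_neutral power_mult)
    then have "chi (g ^ d) = (z ^ k) ^ (d div k)" using partial_char_power[OF p k(2)] z by simp
    also have "\<dots> = z ^ d" using 0 by (metis mult_div_mod_eq add.right_neutral power_mult)
    finally show ?thesis using 0 by auto
  qed
  have wd_le: "chi h * z ^ i = chi h' * z ^ j"
    if hh: "h \<in> H" "h' \<in> H" and c: "[h * g ^ i = h' * g ^ j] (mod int n)" and ij: "i \<le> j" for h h' i j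
  proof -
    have "h' * g ^ j = (h' * g ^ (j - i)) * g ^ i"
      using ij by (simp add: mult.assoc flip: power_add)
    with c have "[h * g ^ i = (h' * g ^ (j - i)) * g ^ i] (mod int n)" by simp
    moreover have "coprime (g ^ i) (int n)" using g by simp
    ultimately have c': "[h = h' * g ^ (j - i)] (mod int n)"
      using cong_mult_rcancel by blast
    with Hcong[OF hh(1)] have 1: "h' * g ^ (j - i) \<in> H" "chi (h' * g ^ (j - i)) = chi h" by blast+
    then have 2: "g ^ (j - i) \<in> H" using partial_char_cancel[OF p n hh(2)] by blast
    have "chi h = chi h' * z ^ (j - i)" using 1 chim[OF hh(2) 2] kdvd[OF 2] by simp
    then show ?thesis using ij by (simp add: mult.assoc flip: power_add)
  qed
  have wd: "chi h * z ^ i = chi h' * z ^ j"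
    if hh: "h \<in> H" "h' \<in> H" and c: "[h * g ^ i = h' * g ^ j] (mod int n)" for h h' i j
    using wd_le[OF hh c] wd_le[OF hh(2,1) cong_sym[OF c]] by (cases "i \<le> j") auto
  define K where "K = {x. \<exists>h\<in>H. \<exists>i. [x = h * g ^ i] (mod int n)}"
  \<comment> \<open>Uniqueness of the value, by the preceding fact, makes the description definite.\<close>
  define chi' where "chi' x = (THE y. \<exists>h\<in>H. \<exists>i. [x = h * g ^ i] (mod int n) \<and> y = chi h * z ^ i)" for x
  have chi': "chi' x = chi h * z ^ i" if "h \<in> H" "[x = h * g ^ i] (mod int n)" for x h i
    unfolding chi'_def
  proof (rule the_equality)
    show "\<exists>ha\<in>H. \<exists>ia. [x = ha * g ^ ia] (mod int n) \<and> chi h * z ^ i = chi ha * z ^ ia"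
      using that by blast
  next
    fix y assume "\<exists>h\<in>H. \<exists>i. [x = h * g ^ i] (mod int n) \<and> y = chi h * z ^ i"
    then obtain h' j where "h' \<in> H" "[x = h' * g ^ j] (mod int n)" "y = chi h' * z ^ j" by blast
    then show "y = chi h * z ^ i" using wd[of h' h j i] that by (metis cong_sym cong_trans)
  qed
  have HK: "x \<in> K \<and> chi' x = chi x" if "x \<in> H" for x
  proof -
    have x: "[x = x * g ^ 0] (mod int n)" by simp
    have "x \<in> K" unfolding K_def using that x by blast
    then show ?thesis using chi'[OF that x] by simp
  qed
  have gK: "g \<in> K \<and> chi' g = z"
  proof -
    have x: "[g = 1 * g ^ 1] (mod int n)" by simp
    have "g \<in> K" unfolding K_def using H1 x by blast
    then show ?thesis using chi'[OF H1 x] partial_char_1[OF p] by simp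
  qed
  have "partial_char n K chi'"
    unfolding partial_char_def
  proof (intro conjI ballI allI impI subsetI)
    show "1 \<in> K" using HK H1 by blast
    fix a assume a: "a \<in> K"
    then obtain h i where hi: "h \<in> H" "[a = h * g ^ i] (mod int n)" unfolding K_def by blast
    have "coprime (h * g ^ i) (int n)" using Hcop[OF hi(1)] g by simp
    then have "coprime a (int n)" using hi(2) by (meson cong_imp_coprime cong_sym)
    then show "a \<in> {a. coprime a (int n)}" by simp
    show "chi' a \<noteq> 0" using chi'[OF hi] chi0[OF hi(1)] z0 by simp
    { fix b assume "[a = b] (mod int n)"
      then have "[b = h * g ^ i] (mod int n)" using hi(2) by (metis cong_sym cong_trans)
      then show "b \<in> K" "chi' b = chi' a" using hi chi' unfolding K_def by auto }
    fix b assume b: "b \<in> K"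
    then obtain h' j where hj: "h' \<in> H" "[b = h' * g ^ j] (mod int n)" unfolding K_def by blast
    have "[a * b = (h * g ^ i) * (h' * g ^ j)] (mod int n)" using hi hj by (intro cong_mult)
    then have ab: "[a * b = (h * h') * g ^ (i + j)] (mod int n)" by (simp add: power_add mult_ac)
    show "a * b \<in> K" using ab Hmult[OF hi(1) hj(1)] unfolding K_def by blast
    show "chi' (a * b) = chi' a * chi' b"
      unfolding chi'[OF Hmult[OF hi(1) hj(1)] ab] chi'[OF hi] chi'[OF hj]
      using chim[OF hi(1) hj(1)] by (simp add: power_add)
  qed
  then show ?thesis using HK gK by blast
qed

lemma coprime_add_modulus: "coprime (a + int n) (int n) \<longleftrightarrow> coprime a (int n)"
  by (metis coprime_iff_gcd_eq_1 gcd_add1)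

text \<open>As long as a unit lies outside \<open>H\<close>, adjoin it by means of any suitable root; the number of
  residue classes not yet covered decreases.\<close>
lemma partial_char_extend:
  assumes "partial_char n H chi" "n > 0"
  shows "\<exists>chi'. dirichlet_char n chi' \<and> (\<forall>x\<in>H. chi' x = chi x)"
  using assms
proof (induction "n - card (H \<inter> {0..<int n})" arbitrary: H chi rule: less_induct)
  case less
  note p = less.prems(1) and n = less.prems(2)
  show ?case
  proof (cases "\<exists>g. coprime g (int n) \<and> g \<notin> H")
    case False
    then have H: "x \<in> H \<longleftrightarrow> coprime x (int n)" for x using p unfolding partial_char_def by auto
    define chi' where "chi' x = (if coprime x (int n) then chi x else 0)" for x
    have "dirichlet_char n chi'"
      unfolding dirichlet_char_def
    proof (intro conjI allI)
      have pm: "chi (a * b) = chi a * chi b" if "coprime a (int n)" "coprime b (int n)" for a b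
        using p that unfolding partial_char_def H[symmetric] by blast
      have pc: "chi b = chi a" if "coprime a (int n)" "[a = b] (mod int n)" for a b
        using p that unfolding partial_char_def H[symmetric] by blast
      have p0: "chi a \<noteq> 0" if "coprime a (int n)" for a
        using p that unfolding partial_char_def H[symmetric] by blast
      fix a b
      show "chi' (a * b) = chi' a * chi' b" using pm by (simp add: chi'_def)
      show "chi' (a + int n) = chi' a"
        using pc[of a "a + int n"] by (auto simp: chi'_def cong_def coprime_add_modulus)
      show "(chi' a \<noteq> 0) = coprime a (int n)" using p0 by (simp add: chi'_def)
    qed
    then show ?thesis using H chi'_def by auto
  next
    case True
    then obtain g where g: "coprime g (int n)" "g \<notin> H" by blast
    define k where "k = (LEAST k. k > 0 \<and> g ^ k \<in> H)"
    have "1 \<in> H" and Hc: "\<And>a b. a \<in> H \<Longrightarrow> [a = b] (mod int n) \<Longrightarrow> b \<in> H"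
      using p unfolding partial_char_def by blast+
    then have "g ^ totient n \<in> H" "totient n > 0"
      using coprime_power_totient_cong[OF n g(1)] n by (auto intro: Hc cong_sym)
    then have ex: "\<exists>k. k > 0 \<and> g ^ k \<in> H" by blast
    have k: "k > 0" "g ^ k \<in> H" using LeastI_ex[OF ex] unfolding k_def by auto
    have kl: "\<And>j. 0 < j \<Longrightarrow> j < k \<Longrightarrow> g ^ j \<notin> H" unfolding k_def using not_less_Least by blast
    have "chi (g ^ k) \<noteq> 0" using p k(2) unfolding partial_char_def by blast
    moreover define z where "z = exp (Ln (chi (g ^ k)) / of_nat k)"
    ultimately have z: "z ^ k = chi (g ^ k)" using k(1) by (simp flip: exp_of_nat_mult)
    obtain K chi' where K: "partial_char n K chi'" "H \<subseteq> K" "g \<in> K" "\<forall>x\<in>H. chi' x = chi x"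
      using partial_char_extend_by_root[OF p n g(1) k kl z] by blast
    have "g mod int n \<in> K \<inter> {0..<int n}"
      using K n unfolding partial_char_def by (auto simp: cong_def)
    moreover have "g mod int n \<notin> H" using Hc[of "g mod int n" g] g(2) by (auto simp: cong_def)
    ultimately have "H \<inter> {0..<int n} \<subset> K \<inter> {0..<int n}" using K(2) by auto
    then have "card (H \<inter> {0..<int n}) < card (K \<inter> {0..<int n})" by (intro psubset_card_mono) auto
    moreover have "card (K \<inter> {0..<int n}) \<le> n"
      using card_mono[of "{0..<int n}" "K \<inter> {0..<int n}"] by simp
    ultimately obtain chi'' where "dirichlet_char n chi''" "\<forall>x\<in>K. chi'' x = chi' x"
      using less.hyps[OF _ K(1) n] by (metis diff_less_mono2 order_less_le_trans)
    then show ?thesis using K by (intro exI[of _ chi'']) auto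
  qed
qed

text \<open>Start from the trivial subgroup and adjoin \<open>a\<close>. Its order \<open>k\<close> is at least 2, so there is a
  \<open>k\<close>-th root of unity other than 1 to which \<open>a\<close> may be sent.\<close>
lemma dirichlet_chars_separate:
  assumes n: "n > 0" and a: "coprime a (int n)" "\<not> [a = 1] (mod int n)"
  shows "\<exists>chi. dirichlet_char n chi \<and> chi a \<noteq> 1"
proof -
  let ?H = "{x. [x = 1] (mod int n)}"
  have p: "partial_char n ?H (\<lambda>_. 1)"
    unfolding partial_char_def
  proof (intro conjI ballI allI impI subsetI)
    fix x y assume x: "x \<in> ?H"
    then show "x \<in> {a. coprime a (int n)}" by (auto intro: cong_imp_coprime[OF cong_sym])
    show "[x = y] (mod int n) \<Longrightarrow> y \<in> ?H" using x by (auto intro: cong_trans cong_sym)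
    show "y \<in> ?H \<Longrightarrow> x * y \<in> ?H" using x cong_mult[of x 1 "int n" y 1] by simp
  qed auto
  define k where "k = (LEAST k. k > 0 \<and> a ^ k \<in> ?H)"
  have "a ^ totient n \<in> ?H" "totient n > 0" using coprime_power_totient_cong[OF n a(1)] n by auto
  then have ex: "\<exists>k. k > 0 \<and> a ^ k \<in> ?H" by blast
  have k: "k > 0" "a ^ k \<in> ?H" using LeastI_ex[OF ex] unfolding k_def by auto
  have kl: "\<And>j. 0 < j \<Longrightarrow> j < k \<Longrightarrow> a ^ j \<notin> ?H" unfolding k_def using not_less_Least by blast
  have "k \<noteq> 1" using k a(2) by auto
  then have k2: "k \<ge> 2" using k by simp
  obtain z :: complex where z: "z ^ k = 1" "z \<noteq> 1"
  proof -
    have "card {z::complex. z ^ k = 1} = k" by (rule card_roots_unity_eq) (use k in auto)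
    then have "\<not> {z::complex. z ^ k = 1} \<subseteq> {1}" using k2 card_mono[of "{1::complex}" "{z::complex. z ^ k = 1}"] by auto
    then show ?thesis using that by auto
  qed
  obtain K chi' where K: "partial_char n K chi'" "a \<in> K" "chi' a = z"
    using partial_char_extend_by_root[OF p n a(1) k kl, of z] z(1) by auto
  then show ?thesis using partial_char_extend[OF K(1) n] z by metis
qed

lemma dirichlet_char_mult:
  assumes "dirichlet_char n chi" shows "chi (a * b) = chi a * chi b"
  using assms unfolding dirichlet_char_def by blast

lemma dirichlet_char_norm:
  assumes "dirichlet_char n chi" "n > 0"
  shows "norm (chi a) = (if coprime a (int n) then 1 else 0)"
proof (cases "coprime a (int n)")
  case True
  have "chi a ^ totient n = 1"
    using dirichlet_char_cong[OF assms(1) coprime_power_totient_cong[OF assms(2) True]]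
      dirichlet_char_power[OF assms(1)] dirichlet_char_1[OF assms(1)] by simp
  then have "norm (chi a) ^ totient n = 1" by (metis norm_one norm_power)
  moreover have "totient n \<noteq> 0" using assms by simp
  ultimately have "norm (chi a) = 1"
    using power_eq_imp_eq_base[of "norm (chi a)" "totient n" 1] by simp
  then show ?thesis using True by simp
qed (use dirichlet_char_nonzero_iff[OF assms(1)] in auto)

lemma dirichlet_char_conj:
  assumes "dirichlet_char n chi" shows "dirichlet_char n (conj_char chi)"
  using assms unfolding dirichlet_char_def conj_char_def by simp

lemma residues_mult_bij:
  assumes "n > 0" "coprime b (int n)"
  shows "bij_betw (\<lambda>a. (a * b) mod int n) {0..<int n} {0..<int n}"
proof -
  have "inj_on (\<lambda>a. (a * b) mod int n) {0..<int n}"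
  proof (rule inj_onI)
    fix x y assume *: "x \<in> {0..<int n}" "y \<in> {0..<int n}" "(x * b) mod int n = (y * b) mod int n"
    then have "[x = y] (mod int n)" using assms(2) by (metis cong_def cong_mult_rcancel)
    then show "x = y" using * by (auto simp: cong_def)
  qed
  moreover have "(\<lambda>a. (a * b) mod int n) ` {0..<int n} \<subseteq> {0..<int n}" using assms by auto
  ultimately show ?thesis
    by (simp add: bij_betw_def endo_inj_surj)
qed

lemma sum_residues_mult:
  fixes g :: "int \<Rightarrow> complex"
  assumes "n > 0" "coprime b (int n)" and g: "\<And>x y. [x = y] (mod int n) \<Longrightarrow> g x = g y"
  shows "(\<Sum>a\<in>{0..<int n}. g (a * b)) = (\<Sum>a\<in>{0..<int n}. g a)"
proof -
  have "(\<Sum>a\<in>{0..<int n}. g (a * b)) = (\<Sum>a\<in>{0..<int n}. g ((a * b) mod int n))"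
    by (intro sum.cong refl g) (simp add: cong_def)
  also have "\<dots> = (\<Sum>a\<in>{0..<int n}. g a)"
    by (rule sum.reindex_bij_betw[OF residues_mult_bij[OF assms(1,2)]])
  finally show ?thesis .
qed

text \<open>If \<open>chi b \<noteq> 1\<close>, then multiplication by \<open>b\<close> permutes the residues and scales the sum by
  \<open>chi b\<close>.\<close>
lemma sum_dirichlet_char_residues:
  assumes n: "n > 0" and c: "dirichlet_char n chi"
  shows "(\<Sum>a\<in>{0..<int n}. chi a) = (if \<forall>a. coprime a (int n) \<longrightarrow> chi a = 1 then of_nat (totient n) else 0)"
proof (cases "\<forall>a. coprime a (int n) \<longrightarrow> chi a = 1")
  case True
  have "(\<Sum>a\<in>{0..<int n}. chi a) = (\<Sum>a\<in>{0..<int n}. if coprime a (int n) then 1 else 0)"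
    using True dirichlet_char_nonzero_iff[OF c] by (intro sum.cong) auto
  also have "\<dots> = of_nat (card {a\<in>{0..<int n}. coprime a (int n)})"
    by (simp add: sum.If_cases Int_def)
  also have "card {a\<in>{0..<int n}. coprime a (int n)} = card (totatives n)"
  proof (rule bij_betw_same_card, rule bij_betw_byWitness[where f = "\<lambda>a. if a = 0 then n else nat a" and f' = "\<lambda>k. if k = n then 0 else int k"])
    show "(\<lambda>k. if k = n then 0 else int k) ` totatives n \<subseteq> {a \<in> {0..<int n}. coprime a (int n)}"
      using n by (auto simp: totatives_def coprime_int_iff)
    show "(\<lambda>a. if a = 0 then n else nat a) ` {a \<in> {0..<int n}. coprime a (int n)} \<subseteq> totatives n"
      using n by (auto simp: totatives_def) (metis coprime_int_iff nat_0_le)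
  qed (use n in \<open>auto simp: totatives_def\<close>)
  finally show ?thesis using True by (simp add: totient_def)
next
  case False
  then obtain b where b: "coprime b (int n)" "chi b \<noteq> 1" by blast
  have "(\<Sum>a\<in>{0..<int n}. chi a) = (\<Sum>a\<in>{0..<int n}. chi (a * b))"
    by (rule sum_residues_mult[symmetric, OF n b(1)]) (rule dirichlet_char_cong[OF c])
  also have "\<dots> = (\<Sum>a\<in>{0..<int n}. chi a) * chi b"
    by (simp add: dirichlet_char_mult[OF c] sum_distrib_right)
  finally have "(\<Sum>a\<in>{0..<int n}. chi a) * (chi b - 1) = 0" by (simp add: algebra_simps)
  then have "(\<Sum>a\<in>{0..<int n}. chi a) = 0" using b by simp
  then show ?thesis using False by (simp only: if_False)
qed

text \<open>If \<open>psi a \<noteq> 1\<close> for some character, then multiplication by \<open>psi\<close> permutes the characters and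
  scales the sum by \<open>psi a\<close>, so the sum vanishes. The number of characters is \<open>\<phi>(n)\<close>, as one
  sees by computing the sum of \<open>chi a\<close> over all pairs \<open>(chi, a)\<close> in both orders.\<close>
lemma sum_dirichlet_chars:
  assumes n: "n \<ge> 2"
  shows "(\<Sum>chi | dirichlet_char n chi. chi a) = (if [a = 1] (mod int n) then of_nat (totient n) else 0)"
proof -
  have n0: "n > 0" using n by simp
  let ?D = "{chi. dirichlet_char n chi}"
  have fin: "finite ?D" by (rule finite_dirichlet_chars[OF n0])
  have zero: "(\<Sum>chi\<in>?D. chi a) = 0" if a: "\<not> [a = 1] (mod int n)" for a
  proof (cases "coprime a (int n)")
    case False
    then show ?thesis using dirichlet_char_nonzero_iff by (intro sum.neutral) blast
  next
    case True
    then obtain psi where psi: "dirichlet_char n psi" "psi a \<noteq> 1"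
      using dirichlet_chars_separate[OF n0 True a] by blast
    have inj: "inj_on (\<lambda>chi x. psi x * chi x) ?D"
    proof (rule inj_onI, rule ext)
      fix chi chi' x assume *: "chi \<in> ?D" "chi' \<in> ?D" "(\<lambda>x. psi x * chi x) = (\<lambda>x. psi x * chi' x)"
      have "psi x * chi x = psi x * chi' x" using *(3) by meson
      then show "chi x = chi' x" using * psi(1) dirichlet_char_nonzero_iff by (metis mem_Collect_eq mult_cancel_left)
    qed
    have "(\<lambda>chi x. psi x * chi x) ` ?D \<subseteq> ?D"
      using psi(1) by (auto simp: dirichlet_char_def)
    then have im: "(\<lambda>chi x. psi x * chi x) ` ?D = ?D" using endo_inj_surj[OF fin _ inj] by blast
    have "(\<Sum>chi\<in>?D. chi a) = (\<Sum>chi\<in>(\<lambda>chi x. psi x * chi x) ` ?D. chi a)" by (simp only: im)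
    also have "\<dots> = psi a * (\<Sum>chi\<in>?D. chi a)" by (simp add: sum.reindex[OF inj] sum_distrib_left)
    finally have "(psi a - 1) * (\<Sum>chi\<in>?D. chi a) = 0" by (simp add: algebra_simps)
    then show ?thesis using psi by simp
  qed
  define chi0 :: "int \<Rightarrow> complex" where "chi0 = (\<lambda>a. if coprime a (int n) then 1 else 0)"
  have chi0: "chi0 \<in> ?D" 
    unfolding chi0_def dirichlet_char_def by (simp add: coprime_add_modulus)
  have "(\<Sum>chi\<in>?D. chi 1) = (\<Sum>chi\<in>?D. 1)"
    by (intro sum.cong refl) (auto dest: dirichlet_char_1)
  then have "of_nat (card ?D) = (\<Sum>chi\<in>?D. chi 1)" by simp
  also have "\<dots> = (\<Sum>a\<in>{1}. \<Sum>chi\<in>?D. chi a)" by simp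
  also have "\<dots> = (\<Sum>a\<in>{0..<int n}. \<Sum>chi\<in>?D. chi a)"
    using n by (intro sum.mono_neutral_left) (auto intro!: zero simp: cong_def)
  also have "\<dots> = (\<Sum>chi\<in>?D. \<Sum>a\<in>{0..<int n}. chi a)" by (rule sum.swap)
  also have "\<dots> = (\<Sum>chi\<in>?D. if chi = chi0 then of_nat (totient n) else 0)"
  proof (intro sum.cong refl)
    fix chi assume chi: "chi \<in> ?D"
    have "(\<forall>a. coprime a (int n) \<longrightarrow> chi a = 1) \<longleftrightarrow> chi = chi0"
      using chi dirichlet_char_nonzero_iff[of n chi] by (auto simp: chi0_def fun_eq_iff)
    then show "(\<Sum>a\<in>{0..<int n}. chi a) = (if chi = chi0 then of_nat (totient n) else 0)"
      using sum_dirichlet_char_residues[OF n0] chi by simp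
  qed
  also have "\<dots> = of_nat (totient n)" using fin chi0 by (simp add: sum.delta')
  finally have card: "of_nat (card ?D) = (of_nat (totient n) :: complex)" .
  show ?thesis
  proof (cases "[a = 1] (mod int n)")
    case True
    have "chi a = 1" if "chi \<in> ?D" for chi
      using that dirichlet_char_cong[OF _ True, of chi] dirichlet_char_1[of n chi] by auto
    then have "(\<Sum>chi\<in>?D. chi a) = (\<Sum>chi\<in>?D. 1)" by (intro sum.cong refl)
    then show ?thesis using True card by simp
  qed (use zero in simp)
qed

text \<open>The characters of the given parity are selected by the weight \<open>(1 + (-1)\<^sup>r chi (-1)) / 2\<close>,
  and \<open>chi (-1) chi a = chi (-a)\<close>.\<close>
lemma sum_parity_chars:
  assumes n: "n \<ge> 2"
  shows "(\<Sum>chi\<in>parity_chars n r. chi a) =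
    of_nat (totient n) / 2 * ((if [a = 1] (mod int n) then 1 else 0) + (-1) ^ r * (if [a = -1] (mod int n) then 1 else 0))"
proof -
  let ?D = "{chi. dirichlet_char n chi}"
  have fin: "finite ?D" by (rule finite_dirichlet_chars) (use n in simp)
  have pm: "chi (-1) = 1 \<or> chi (-1) = -1" if "chi \<in> ?D" for chi
  proof -
    have "chi (-1) * chi (-1) = 1"
      using that dirichlet_char_mult[of n chi "-1" "-1"] dirichlet_char_1[of n chi] by simp
    then show ?thesis by (simp add: square_eq_1_iff)
  qed
  have "(\<Sum>chi\<in>parity_chars n r. chi a) = (\<Sum>chi\<in>?D. if chi (-1) = (-1) ^ r then chi a else 0)"
    unfolding parity_chars_def
    using sum.inter_filter[OF fin, of "\<lambda>chi. chi a" "\<lambda>chi. chi (-1) = (-1) ^ r"] by simp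
  also have "\<dots> = (\<Sum>chi\<in>?D. (chi a + (-1) ^ r * chi (- a)) / 2)"
  proof (intro sum.cong refl)
    fix chi assume chi: "chi \<in> ?D"
    have "chi (- a) = chi (-1) * chi a" using chi dirichlet_char_mult[of n chi "-1" a] by simp
    then show "(if chi (-1) = (-1) ^ r then chi a else 0) = (chi a + (-1) ^ r * chi (- a)) / 2"
      using pm[OF chi] by (cases "even r") auto
  qed
  also have "\<dots> = ((\<Sum>chi\<in>?D. chi a) + (-1) ^ r * (\<Sum>chi\<in>?D. chi (- a))) / 2"
    by (simp add: sum.distrib sum_distrib_left flip: sum_divide_distrib)
  also have "[- a = 1] (mod int n) \<longleftrightarrow> [a = -1] (mod int n)"
    using cong_minus_minus_iff[of a "-1" "int n"] by simp
  ultimately show ?thesis by (auto simp: sum_dirichlet_chars[OF n] field_simps)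
qed

section \<open>Primitive characters and Gauss sums\<close>

lemma conj_conj_char [simp]: "conj_char (conj_char chi) = chi"
  by (simp add: conj_char_def)

lemma char_induced_by_conj:
  assumes "char_induced_by n chi d psi"
  shows "char_induced_by n (conj_char chi) d (conj_char psi)"
proof -
  have "dirichlet_char d (conj_char psi)"
    using assms dirichlet_char_conj unfolding char_induced_by_def by blast
  then show ?thesis using assms unfolding char_induced_by_def by (simp add: conj_char_def)
qed

lemma conductor_conj: "conductor n (conj_char chi) = conductor n chi"
proof -
  have "(\<exists>psi. char_induced_by n (conj_char chi) d psi) \<longleftrightarrow> (\<exists>psi. char_induced_by n chi d psi)" for d
    using char_induced_by_conj[of n chi d] char_induced_by_conj[of n "conj_char chi" d]
    unfolding conj_conj_char by blast
  then show ?thesis unfolding conductor_def by simp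
qed

lemma primitive_char_props:
  assumes "n > 0" "dirichlet_char n chi"
  shows "primitive_dirichlet_char (conductor n chi) (primitive_char n chi)"
    "coprime a (int n) \<Longrightarrow> primitive_char n chi a = chi a"
    "conductor n chi dvd n" "conductor n chi > 0"
    "dirichlet_char (conductor n chi) (primitive_char n chi)"
proof -
  have *: "primitive_dirichlet_char (conductor n chi) (primitive_char n chi) \<and>
            (\<forall>a. coprime a (int n) \<longrightarrow> primitive_char n chi a = chi a)"
    unfolding primitive_char_def by (rule theI'[OF primitive_char_ex1[OF assms]])
  then show "primitive_dirichlet_char (conductor n chi) (primitive_char n chi)"
    "coprime a (int n) \<Longrightarrow> primitive_char n chi a = chi a" by blast+
  then show "dirichlet_char (conductor n chi) (primitive_char n chi)"
    unfolding primitive_dirichlet_char_def by blast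
  show "conductor n chi dvd n" "conductor n chi > 0"
    using conductor_induced[OF assms] unfolding char_induced_by_def by blast+
qed

lemma primitive_char_conj:
  assumes "n > 0" "dirichlet_char n chi"
  shows "primitive_char n (conj_char chi) = conj_char (primitive_char n chi)"
proof -
  note * = primitive_char_props[OF assms]
  have "primitive_dirichlet_char (conductor n (conj_char chi)) (conj_char (primitive_char n chi))"
    using *(1) dirichlet_char_conj conductor_conj unfolding primitive_dirichlet_char_def by metis
  moreover have "\<forall>a. coprime a (int n) \<longrightarrow> conj_char (primitive_char n chi) a = conj_char chi a"
    using *(2) by (simp add: conj_char_def)
  ultimately show ?thesis
    unfolding primitive_char_def[of n "conj_char chi"]
    by (intro the1_equality primitive_char_ex1 assms dirichlet_char_conj) blast
qed

lemma zeta_root_nonzero [simp]: "zeta_root m \<noteq> 0"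
  by (simp add: zeta_root_def)

lemma zeta_root_powi: "zeta_root m powi k = exp (2 * of_real pi * \<i> * of_int k / of_nat m)"
  by (simp add: zeta_root_def exp_power_int mult_ac)

lemma zeta_root_powi_cong:
  assumes "m > 0" "[a = b] (mod int m)"
  shows "zeta_root m powi a = zeta_root m powi b"
proof -
  obtain k where "a = b + int m * k" using assms(2) by (metis cong_iff_lin cong_sym)
  then have "2 * of_real pi * \<i> * of_int a / of_nat m = 2 * of_real pi * \<i> * of_int b / of_nat m + (2 * of_int k * of_real pi) * \<i>"
    using assms(1) by (simp add: field_simps)
  moreover have "exp ((2 * of_int k * of_real pi) * \<i>) = 1"
    using exp_integer_2pi[of "of_int k"] by (simp add: mult_ac)
  ultimately show ?thesis unfolding zeta_root_powi by (simp add: exp_add)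
qed

lemma zeta_root_powi_eq_1_iff:
  assumes "m > 0" shows "zeta_root m powi a = 1 \<longleftrightarrow> int m dvd a"
proof
  assume "zeta_root m powi a = 1"
  then obtain k :: int where k: "Im (2 * of_real pi * \<i> * of_int a / of_nat m) = of_int (2 * k) * pi"
    unfolding zeta_root_powi exp_eq_1 by blast
  have "2 * pi * of_int a / real m = of_int (2 * k) * pi" using k by (simp add: Im_divide_of_nat)
  then have "of_int a = (of_int (k * int m) :: real)" using assms by (simp add: field_simps)
  then have "a = k * int m" by (simp only: of_int_eq_iff)
  then show "int m dvd a" by simp
next
  assume "int m dvd a"
  then have "[a = 0] (mod int m)" by (simp add: cong_0_iff)
  then show "zeta_root m powi a = 1" using zeta_root_powi_cong[OF assms] by simp
qed

lemma sum_zeta_root_powi: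
  assumes f: "f > 0"
  shows "(\<Sum>k\<in>{0..<int f}. zeta_root f powi (k * m)) = (if int f dvd m then of_nat f else 0)"
proof (cases "int f dvd m")
  case True
  then have "zeta_root f powi (k * m) = 1" for k by (simp add: zeta_root_powi_eq_1_iff f)
  then show ?thesis using True by simp
next
  case False
  let ?w = "zeta_root f powi m"
  have pw: "zeta_root f powi (int k * m) = ?w ^ k" for k
    by (metis mult.commute power_int_mult power_int_of_nat)
  have "(\<Sum>k\<in>{0..<int f}. zeta_root f powi (k * m)) = (\<Sum>k<f. ?w ^ k)"
    by (rule sum.reindex_bij_witness[of _ int nat]) (auto simp flip: pw)
  also have "\<dots> = (?w ^ f - 1) / (?w - 1)"
    using False f by (intro geometric_sum) (simp add: zeta_root_powi_eq_1_iff)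
  also have "?w ^ f = zeta_root f powi (m * int f)" by (simp add: power_int_mult power_int_of_nat)
  also have "\<dots> = 1" by (simp add: zeta_root_powi_eq_1_iff f)
  finally show ?thesis using False by simp
qed

lemma sum_periodic_shift:
  fixes g :: "int \<Rightarrow> complex"
  assumes "f > 0" and g: "g (int f) = g 0"
  shows "(\<Sum>j = 1..f. g (int j)) = (\<Sum>a\<in>{0..<int f}. g a)"
proof -
  have "(\<Sum>j = 1..f. g (int j)) = (\<Sum>a\<in>{1..int f}. g a)"
    by (rule sum.reindex_bij_witness[of _ nat int]) auto
  also have "{1..int f} = insert (int f) {1..<int f}" using assms(1) by auto
  also have "(\<Sum>a\<in>insert (int f) {1..<int f}. g a) = (\<Sum>a\<in>insert 0 {1..<int f}. g a)" using g by simp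
  also have "insert 0 {1..<int f} = {0..<int f}" using assms(1) by auto
  finally show ?thesis .
qed

text \<open>The finite Fourier transform of \<open>psi\<close>, with the sign of the exponent chosen as in
  \<open>gauss_sum\<close>.\<close>
definition twisted_gauss_sum :: "nat \<Rightarrow> (int \<Rightarrow> complex) \<Rightarrow> int \<Rightarrow> complex" where
  "twisted_gauss_sum f psi k = (\<Sum>a\<in>{0..<int f}. psi a * zeta_root f powi (- (a * k)))"

lemma gauss_sum_conv_twisted:
  assumes "f > 0" "dirichlet_char f psi"
  shows "gauss_sum f psi = twisted_gauss_sum f psi 1"
  unfolding gauss_sum_def twisted_gauss_sum_def
proof (subst sum_periodic_shift[OF assms(1), where g = "\<lambda>a. psi a * zeta_root f powi (- a)"])
  have "psi (int f) = psi 0" by (rule dirichlet_char_cong[OF assms(2)]) (simp add: cong_def)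
  moreover have "zeta_root f powi (- int f) = 1" using zeta_root_powi_eq_1_iff[OF assms(1), of "- int f"] by simp
  ultimately show "psi (int f) * zeta_root f powi - int f = psi 0 * zeta_root f powi - 0" by simp
qed simp

lemma twisted_gauss_sum_mult:
  assumes f: "f > 0" and c: "dirichlet_char f psi" and b: "coprime b (int f)"
  shows "twisted_gauss_sum f psi k = psi b * twisted_gauss_sum f psi (k * b)"
proof -
  let ?g = "\<lambda>a. psi a * zeta_root f powi (- (a * k))"
  have g: "?g x = ?g y" if "[x = y] (mod int f)" for x y
    using dirichlet_char_cong[OF c that] that
    by (intro arg_cong2[of _ _ _ _ "(*)"] zeta_root_powi_cong f) (auto intro: cong_mult simp: cong_minus_minus_iff)
  have "twisted_gauss_sum f psi k = (\<Sum>a\<in>{0..<int f}. ?g (a * b))"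
    unfolding twisted_gauss_sum_def by (rule sum_residues_mult[OF f b g, symmetric])
  then show ?thesis
    unfolding twisted_gauss_sum_def by (simp add: dirichlet_char_mult[OF c] sum_distrib_left mult_ac)
qed

text \<open>A character trivial on the units congruent to 1 modulo \<open>d\<close> depends only on residues modulo
  \<open>d\<close>, hence is induced by a character modulo \<open>d\<close>; to evaluate the latter at \<open>a\<close>, shift \<open>a\<close>
  by a multiple of \<open>d\<close> to a unit modulo \<open>f\<close>. For \<open>d < f\<close> this contradicts the minimality of
  the conductor.\<close>
lemma primitive_char_nontrivial_on_kernel:
  assumes f: "f > 0" and p: "primitive_dirichlet_char f psi" and d: "d dvd f" "d < f"
  shows "\<exists>b. coprime b (int f) \<and> [b = 1] (mod int d) \<and> psi b \<noteq> 1"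
proof (rule ccontr)
  assume "\<not> ?thesis"
  then have ker: "psi b = 1" if "coprime b (int f)" "[b = 1] (mod int d)" for b using that by blast
  have c: "dirichlet_char f psi" using p unfolding primitive_dirichlet_char_def by simp
  have d0: "d > 0" using d f by (auto intro: Nat.gr0I)
  have df: "[x = y] (mod int d)" if "[x = y] (mod int f)" for x y
    using that d(1) by (meson cong_dvd_modulus int_dvd_int_iff)
  have same: "psi x = psi y" if xy: "coprime x (int f)" "coprime y (int f)" "[x = y] (mod int d)" for x y
  proof -
    define y' where "y' = y ^ (totient f - 1)"
    have "y * y' = y ^ totient f" using f by (simp add: y'_def flip: power_Suc)
    then have yy: "[y * y' = 1] (mod int f)" using coprime_power_totient_cong[OF f xy(2)] by simp
    have "[x * y' = y * y'] (mod int d)" using xy(3) by (rule cong_mult) simp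
    then have "[x * y' = 1] (mod int d)" using df[OF yy] cong_trans by blast
    moreover have "coprime (x * y') (int f)" using xy by (simp add: y'_def)
    ultimately have "psi x * psi y' = 1" using ker dirichlet_char_mult[OF c] by metis
    moreover have "psi y * psi y' = 1"
      using dirichlet_char_cong[OF c yy] dirichlet_char_1[OF c] dirichlet_char_mult[OF c] by simp
    ultimately show ?thesis by (metis mult_cancel_right mult_zero_right zero_neq_one)
  qed
  define lift where "lift a = a + (SOME k. coprime (a + k * int d) (int f)) * int d" for a
  have lift: "coprime (lift a) (int f)" "[lift a = a] (mod int d)" if "coprime a (int d)" for a
    using someI_ex[OF ex_coprime_shift[OF f that]] by (auto simp: lift_def cong_def)
  define psi' where "psi' a = (if coprime a (int d) then psi (lift a) else 0)" for a
  have "dirichlet_char d psi'"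
    unfolding dirichlet_char_def
  proof (intro conjI allI)
    fix a b
    show "psi' (a * b) = psi' a * psi' b"
    proof (cases "coprime a (int d) \<and> coprime b (int d)")
      case True
      have "psi (lift (a * b)) = psi (lift a * lift b)"
        using True by (intro same) (auto intro!: lift cong_trans[OF lift(2)] cong_sym[OF cong_mult] lift)
      then show ?thesis using True by (simp add: psi'_def dirichlet_char_mult[OF c])
    qed (auto simp: psi'_def)
    show "psi' (a + int d) = psi' a"
    proof (cases "coprime a (int d)")
      case True
      then have 1: "coprime (a + int d) (int d)" by (simp add: coprime_add_modulus)
      have "[lift (a + int d) = lift a] (mod int d)"
        using lift(2)[OF 1] lift(2)[OF True] by (simp add: cong_def)
      then show ?thesis using True 1 by (simp add: psi'_def same lift)
    qed (simp add: psi'_def coprime_add_modulus)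
    show "(psi' a \<noteq> 0) = coprime a (int d)"
      using lift dirichlet_char_nonzero_iff[OF c] by (simp add: psi'_def)
  qed
  moreover have "psi' a = psi a" if "coprime a (int f)" for a
  proof -
    have 1: "coprime a (int d)" using that d(1) by (meson coprime_divisors dvd_refl int_dvd_int_iff)
    then show ?thesis using same[OF lift(1) that lift(2)] by (simp add: psi'_def)
  qed
  ultimately have "char_induced_by f psi d psi'"
    unfolding char_induced_by_def using d by auto
  then have "conductor f psi \<le> d" by (rule conductor_le[OF d0])
  then show False using p d unfolding primitive_dirichlet_char_def by simp
qed

text \<open>For \<open>k\<close> coprime to \<open>f\<close> substitute \<open>a \<mapsto> a k\<close>. Otherwise \<open>k b\<close> and \<open>k\<close> are congruent modulo
  \<open>f\<close> for each \<open>b\<close> congruent to 1 modulo \<open>f / gcd k f\<close>; choosing such a \<open>b\<close> with \<open>psi b \<noteq> 1\<close>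
  forces the sum to vanish, and here primitivity enters.\<close>
lemma primitive_twisted_gauss_sum:
  assumes f: "f > 0" and p: "primitive_dirichlet_char f psi"
  shows "twisted_gauss_sum f psi k = cnj (psi k) * twisted_gauss_sum f psi 1"
proof -
  have c: "dirichlet_char f psi" using p unfolding primitive_dirichlet_char_def by simp
  show ?thesis
  proof (cases "coprime k (int f)")
    case True
    have "cnj (psi k) * psi k = 1"
      using dirichlet_char_norm[OF c f, of k] True by (simp add: complex_norm_square[symmetric] mult.commute)
    moreover have "twisted_gauss_sum f psi 1 = psi k * twisted_gauss_sum f psi k"
      using twisted_gauss_sum_mult[OF f c True, of 1] by simp
    ultimately show ?thesis by (simp flip: mult.assoc)
  next
    case False
    define g where "g = nat (gcd k (int f))"
    have g: "int g = gcd k (int f)" by (simp add: g_def)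
    have "g dvd f" by (metis g gcd_dvd2 int_dvd_int_iff)
    then obtain d where d: "f = g * d" by blast
    have "g \<noteq> 1" using False g by (metis coprime_iff_gcd_eq_1 of_nat_1)
    moreover have "g \<noteq> 0" "d \<noteq> 0" using d f by (metis mult_0 mult_0_right not_gr0)+
    ultimately have "d < f" "d dvd f" using d by (auto simp: mult_less_cancel2 dest: neq0_conv[THEN iffD1])
    then obtain b where b: "coprime b (int f)" "[b = 1] (mod int d)" "psi b \<noteq> 1"
      using primitive_char_nontrivial_on_kernel[OF f p] by blast
    have "int g * int d dvd k * (b - 1)"
      using b(2) g by (intro mult_dvd_mono) (auto simp: cong_iff_dvd_diff)
    then have "int f dvd k * b - k" using d by (simp add: algebra_simps)
    then have kb: "[k * b = k] (mod int f)" by (simp add: cong_iff_dvd_diff)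
    have "twisted_gauss_sum f psi (k * b) = twisted_gauss_sum f psi k"
      unfolding twisted_gauss_sum_def
      by (intro sum.cong refl arg_cong2[of _ _ _ _ "(*)"] zeta_root_powi_cong f)
        (use kb in \<open>simp add: cong_minus_minus_iff cong_mult\<close>)
    then have "(psi b - 1) * twisted_gauss_sum f psi k = 0"
      using twisted_gauss_sum_mult[OF f c b(1), of k] by (simp add: algebra_simps)
    then have "twisted_gauss_sum f psi k = 0" using b(3) by simp
    moreover have "psi k = 0" using False dirichlet_char_nonzero_iff[OF c] by auto
    ultimately show ?thesis by simp
  qed
qed

text \<open>Otherwise the whole finite Fourier transform of \<open>psi\<close> would vanish, whereas Fourier
  inversion recovers \<open>psi 1 = 1\<close> from it.\<close>
lemma primitive_gauss_sum_nonzero: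
  assumes f: "f > 0" and p: "primitive_dirichlet_char f psi"
  shows "twisted_gauss_sum f psi 1 \<noteq> 0"
proof
  assume 0: "twisted_gauss_sum f psi 1 = 0"
  have c: "dirichlet_char f psi" using p unfolding primitive_dirichlet_char_def by simp
  have "0 = (\<Sum>k\<in>{0..<int f}. zeta_root f powi k * twisted_gauss_sum f psi k)"
    using primitive_twisted_gauss_sum[OF f p, unfolded 0] by simp
  also have "\<dots> = (\<Sum>k\<in>{0..<int f}. \<Sum>a\<in>{0..<int f}. psi a * zeta_root f powi (k * (1 - a)))"
    unfolding twisted_gauss_sum_def sum_distrib_left
  proof (intro sum.cong refl)
    fix k a
    have "zeta_root f powi (k * (1 - a)) = zeta_root f powi k * zeta_root f powi (- (a * k))"
      by (subst power_int_add[symmetric]) (auto simp: right_diff_distrib mult.commute)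
    then show "zeta_root f powi k * (psi a * zeta_root f powi (- (a * k))) = psi a * zeta_root f powi (k * (1 - a))"
      by (simp add: mult_ac)
  qed
  also have "\<dots> = (\<Sum>a\<in>{0..<int f}. psi a * (\<Sum>k\<in>{0..<int f}. zeta_root f powi (k * (1 - a))))"
    by (subst sum.swap) (simp add: sum_distrib_left)
  also have "\<dots> = (\<Sum>a\<in>{0..<int f}. psi a * (if int f dvd (1 - a) then of_nat f else 0))"
    by (simp only: sum_zeta_root_powi[OF f])
  also have "\<dots> = (\<Sum>a\<in>{0..<int f}. if a = 1 mod int f then psi 1 * of_nat f else 0)"
  proof (intro sum.cong refl)
    fix a assume a: "a \<in> {0..<int f}"
    have iff: "int f dvd (1 - a) \<longleftrightarrow> a = 1 mod int f"
      using a by (auto simp: mod_eq_dvd_iff[symmetric])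
    show "psi a * (if int f dvd (1 - a) then of_nat f else 0) = (if a = 1 mod int f then psi 1 * of_nat f else 0)"
    proof (cases "a = 1 mod int f")
      case True
      then have "psi a = psi 1" by (intro dirichlet_char_cong[OF c]) (simp add: cong_def)
      then show ?thesis using iff True by simp
    qed (use iff in simp)
  qed
  also have "\<dots> = of_nat f" using f by (simp add: dirichlet_char_1[OF c])
  finally show False using f by simp
qed

section \<open>Fourier series of the Bernoulli polynomials by Abel summation\<close>

lemma bernpoly_deriv:
  "(bernpoly (Suc r) has_field_derivative (real (Suc r) * bernpoly r x)) (at x)"
proof -
  have eq: "real (Suc r choose k) * real (Suc r - k) = real (Suc r) * real (r choose k)" for k
    using binomial_absorb_comp[of "Suc r" k] by (metis diff_Suc_1 mult.commute of_nat_mult)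
  have "((\<lambda>x. \<Sum>k\<le>Suc r. real (Suc r choose k) * bernoulli k * x ^ (Suc r - k)) has_field_derivative
      (\<Sum>k\<le>Suc r. real (Suc r choose k) * bernoulli k * (real (Suc r - k) * x ^ (Suc r - k - 1)))) (at x)"
    by (intro DERIV_sum) (auto intro!: derivative_eq_intros)
  also have "(\<Sum>k\<le>Suc r. real (Suc r choose k) * bernoulli k * (real (Suc r - k) * x ^ (Suc r - k - 1)))
      = (\<Sum>k\<le>r. real (Suc r choose k) * bernoulli k * (real (Suc r - k) * x ^ (Suc r - k - 1)))"
    by simp
  also have "\<dots> = (\<Sum>k\<le>r. real (Suc r) * (real (r choose k) * bernoulli k * x ^ (r - k)))"
  proof (intro sum.cong refl)
    fix k assume "k \<in> {..r}"
    have "real (Suc r choose k) * bernoulli k * (real (Suc r - k) * x ^ (Suc r - k - 1))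
       = (real (Suc r choose k) * real (Suc r - k)) * bernoulli k * x ^ (r - k)" by simp
    then show "real (Suc r choose k) * bernoulli k * (real (Suc r - k) * x ^ (Suc r - k - 1))
       = real (Suc r) * (real (r choose k) * bernoulli k * x ^ (r - k))" unfolding eq by simp
  qed
  also have "\<dots> = real (Suc r) * bernpoly r x" by (simp only: bernpoly_def sum_distrib_left)
  finally show ?thesis unfolding bernpoly_def .
qed

lemma bernpoly_1: "bernpoly (Suc 0) x = x - 1 / 2"
  by (simp add: bernpoly_def bernoulli.simps(2))

text \<open>This is the recursion defining the Bernoulli numbers; it fails for the polynomial of degree
  1.\<close>
lemma bernpoly_endpoints: "bernpoly (Suc (Suc k)) 1 = bernpoly (Suc (Suc k)) 0"
proof -
  have "bernpoly (Suc (Suc k)) 1 = (\<Sum>i\<le>k. real (Suc (Suc k) choose i) * bernoulli i)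
     + real (Suc (Suc k)) * bernoulli (Suc k) + bernoulli (Suc (Suc k))"
    by (simp add: bernpoly_def)
  also have "\<dots> = bernoulli (Suc (Suc k))"
    unfolding bernoulli.simps(2)[of k] by (simp add: field_simps)
  also have "\<dots> = bernpoly (Suc (Suc k)) 0"
    by (simp add: bernpoly_def power_0_left if_distrib[of "\<lambda>x. _ * x"] cong: if_cong)
  finally show ?thesis .
qed

text \<open>For \<open>r > 0\<close> the term with \<open>k = 0\<close> is a division by zero, hence 0, and this is the usual
  polylogarithm.\<close>
definition polylog :: "nat \<Rightarrow> complex \<Rightarrow> complex" where
  "polylog r z = (\<Sum>k. z ^ k / of_nat k ^ r)"

lemma polylog_summable:
  fixes z :: complex
  assumes "norm z < 1" "r > 0"
  shows "summable (\<lambda>k. z ^ k / of_nat k ^ r)"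
proof (rule summable_comparison_test')
  show "summable (\<lambda>k. norm z ^ k)" using assms by (simp add: summable_geometric)
  show "norm (z ^ k / of_nat k ^ r) \<le> norm z ^ k" if "k \<ge> 0" for k
  proof (cases "k = 0")
    case False
    then have "1 \<le> real k ^ r" by simp
    then show ?thesis by (simp add: norm_divide norm_power divide_le_eq mult_right_le_one_le mult_le_cancel_left1)
  qed (use assms in \<open>simp add: power_0_left\<close>)
qed

text \<open>Termwise, \<open>z\<close> times the derivative of \<open>z\<^sup>k / k\<^bsup>r + 1\<^esup>\<close> is \<open>z\<^sup>k / k\<^sup>r\<close>.\<close>
lemma polylog_deriv:
  assumes z: "norm z < 1" and r: "r > 0"
  shows "\<exists>d. (polylog (Suc r) has_field_derivative d) (at z) \<and> d * z = polylog r z"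
proof -
  let ?c = "\<lambda>k. 1 / of_nat k ^ Suc r :: complex"
  have s: "summable (\<lambda>k. ?c k * w ^ k)" if "norm w < 1" for w
    using polylog_summable[OF that, of "Suc r"] by simp
  have "((\<lambda>z. \<Sum>k. ?c k * z ^ k) has_field_derivative (\<Sum>k. diffs ?c k * z ^ k)) (at z)"
    by (rule termdiffs_strong'[OF s z])
  moreover have "(\<lambda>z. \<Sum>k. ?c k * z ^ k) = polylog (Suc r)"
    by (simp add: polylog_def fun_eq_iff)
  moreover have "(\<Sum>k. diffs ?c k * z ^ k) * z = polylog r z"
  proof -
    have "polylog r z = (\<Sum>k. z ^ Suc k / of_nat (Suc k) ^ r)"
      unfolding polylog_def
      using suminf_split_head[OF polylog_summable[OF z r]] r by (simp add: power_0_left)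
    also have "(\<lambda>k. z ^ Suc k / of_nat (Suc k) ^ r) = (\<lambda>k. diffs ?c k * z ^ k * z)"
      by (simp add: diffs_def fun_eq_iff field_simps del: of_nat_Suc)
    also have "(\<Sum>k. diffs ?c k * z ^ k * z) = (\<Sum>k. diffs ?c k * z ^ k) * z"
    proof (rule suminf_mult2[symmetric])
      show "summable (\<lambda>k. diffs ?c k * z ^ k)" by (rule termdiff_converges[OF z s])
    qed
    finally show ?thesis by simp
  qed
  ultimately show ?thesis by auto
qed

lemma polylog_1:
  assumes "norm z < 1" shows "polylog (Suc 0) z = - Ln (1 - z)"
proof -
  have "(\<lambda>k. - (z ^ k) / of_nat k) sums Ln (1 - z)"
    using Ln_series'[of "- z"] assms by simp
  from sums_minus[OF this] show ?thesis
    unfolding polylog_def by (simp add: sums_iff)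
qed

lemma polylog_continuous: "r > 0 \<Longrightarrow> norm z < 1 \<Longrightarrow> isCont (polylog r) z"
proof (cases r)
  case (Suc s)
  assume z: "norm z < 1"
  show ?thesis
  proof (cases "s = 0")
    case True
    have "isCont (\<lambda>z. - Ln (1 - z)) z"
      using z by (intro continuous_intros) (use complex_Re_le_cmod[of z] in \<open>auto simp: complex_nonpos_Reals_iff\<close>)
    moreover have "eventually (\<lambda>w. polylog r w = - Ln (1 - w)) (nhds z)"
      using eventually_nhds_in_open[of "ball 0 1" z] z
      by (auto elim!: eventually_mono simp: polylog_1 True Suc)
    ultimately show ?thesis by (simp add: isCont_cong)
  next
    case False
    then show ?thesis using polylog_deriv[OF z, of s] Suc DERIV_isCont by blast
  qed
qed simp

definition e2pi :: "real \<Rightarrow> complex" where "e2pi x = exp (2 * of_real pi * \<i> * of_real x)"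

lemma norm_e2pi [simp]: "norm (e2pi x) = 1"
  using norm_exp_i_times[of "2 * pi * x"] by (simp add: e2pi_def mult_ac)

lemma e2pi_of_int: "e2pi (of_int k) = 1"
proof -
  have "2 * of_real pi * \<i> * of_real (of_int k) = of_real (2 * of_int k * pi) * \<i>" by simp
  then show ?thesis unfolding e2pi_def using exp_integer_2pi[of "of_int k"] by (simp only: Ints_of_int)
qed
lemma e2pi_integers [simp]: "e2pi 0 = 1" "e2pi 1 = 1" "e2pi (-1) = 1"
proof -
  show "e2pi 0 = 1" using e2pi_of_int[of 0] by (simp only: of_int_0)
  show "e2pi 1 = 1" using e2pi_of_int[of 1] by (simp only: of_int_1)
  show "e2pi (-1) = 1" using e2pi_of_int[of "-1"] by (simp only: of_int_minus of_int_1)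
qed

lemma e2pi_deriv: "(e2pi has_vector_derivative (2 * of_real pi * \<i> * e2pi x)) (at x within S)"
proof -
  have "((\<lambda>z. exp (2 * of_real pi * \<i> * z)) has_field_derivative (2 * of_real pi * \<i> * e2pi x)) (at (of_real x))"
    unfolding e2pi_def by (auto intro!: derivative_eq_intros)
  then have "((\<lambda>z. exp (2 * of_real pi * \<i> * of_real z)) has_vector_derivative (2 * of_real pi * \<i> * e2pi x)) (at x within S)"
    by (rule has_vector_derivative_real_field)
  then show ?thesis unfolding e2pi_def .
qed

text \<open>The Abel means \<open>\<Sum>\<close> \<open>t\<^bsup>|k|\<^esup> e(kx) / k\<^sup>r\<close> over nonzero integers \<open>k\<close> of the Fourier series
  that represents \<open>- (2 \<pi> \<i>)\<^sup>r B\<^sub>r(x) / r!\<close>.\<close>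
definition abel_fourier :: "nat \<Rightarrow> real \<Rightarrow> real \<Rightarrow> complex" where
  "abel_fourier r t x = polylog r (of_real t * e2pi x) + (-1) ^ r * polylog r (of_real t * e2pi (- x))"

lemma abel_fourier_deriv:
  assumes t: "0 \<le> t" "t < 1" and r: "r > 0"
  shows "(abel_fourier (Suc r) t has_vector_derivative (2 * of_real pi * \<i> * abel_fourier r t x)) (at x within S)"
proof -
  have n: "norm (of_real t * e2pi y) < 1" for y using t by (simp add: norm_mult)
  obtain d where d: "(polylog (Suc r) has_field_derivative d) (at (of_real t * e2pi x))" "d * (of_real t * e2pi x) = polylog r (of_real t * e2pi x)"
    using polylog_deriv[OF n r] by blast
  obtain d' where d': "(polylog (Suc r) has_field_derivative d') (at (of_real t * e2pi (- x)))" "d' * (of_real t * e2pi (- x)) = polylog r (of_real t * e2pi (- x))"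
    using polylog_deriv[OF n r] by blast
  have 1: "((\<lambda>x. of_real t * e2pi x) has_vector_derivative (of_real t * (2 * of_real pi * \<i> * e2pi x))) (at x within S)"
    by (intro has_vector_derivative_mult_right e2pi_deriv)
  have "(e2pi \<circ> uminus has_vector_derivative ((-1) *\<^sub>R (2 * of_real pi * \<i> * e2pi (- x)))) (at x within S)"
    by (rule vector_diff_chain_within) (auto intro!: e2pi_deriv derivative_eq_intros)
  then have "((\<lambda>x. e2pi (- x)) has_vector_derivative (- (2 * of_real pi * \<i> * e2pi (- x)))) (at x within S)"
    by (simp add: o_def)
  then have 2: "((\<lambda>x. of_real t * e2pi (- x)) has_vector_derivative (of_real t * (- (2 * of_real pi * \<i> * e2pi (- x))))) (at x within S)"
    by (intro has_vector_derivative_mult_right)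
  have 3: "((\<lambda>x. polylog (Suc r) (of_real t * e2pi x)) has_vector_derivative (of_real t * (2 * of_real pi * \<i> * e2pi x)) * d) (at x within S)"
    using field_vector_diff_chain_within[OF 1, of "polylog (Suc r)" d] d(1)
    by (auto simp: o_def intro: has_field_derivative_at_within)
  have 4: "((\<lambda>x. polylog (Suc r) (of_real t * e2pi (- x))) has_vector_derivative (of_real t * (- (2 * of_real pi * \<i> * e2pi (- x)))) * d') (at x within S)"
    using field_vector_diff_chain_within[OF 2, of "polylog (Suc r)" d'] d'(1)
    by (auto simp: o_def intro: has_field_derivative_at_within)
  have "(abel_fourier (Suc r) t has_vector_derivative
      ((of_real t * (2 * of_real pi * \<i> * e2pi x)) * d + (-1) ^ Suc r * ((of_real t * (- (2 * of_real pi * \<i> * e2pi (- x)))) * d'))) (at x within S)"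
    unfolding abel_fourier_def by (intro has_vector_derivative_add has_vector_derivative_mult_right 3 4)
  also have "((of_real t * (2 * of_real pi * \<i> * e2pi x)) * d + (-1) ^ Suc r * ((of_real t * (- (2 * of_real pi * \<i> * e2pi (- x)))) * d'))
     = 2 * of_real pi * \<i> * (d * (of_real t * e2pi x) + (-1) ^ r * (d' * (of_real t * e2pi (- x))))"
    by (simp add: algebra_simps)
  finally show ?thesis unfolding d(2) d'(2) abel_fourier_def .
qed

text \<open>The deviation of the Abel means from their expected limit. Differentiation in \<open>x\<close> lowers
  \<open>r\<close> by one, up to the factor \<open>2 \<pi> \<i>\<close>, for both summands.\<close>
definition fourier_error :: "nat \<Rightarrow> real \<Rightarrow> real \<Rightarrow> complex" where
  "fourier_error r t x = abel_fourier r t x + (2 * of_real pi * \<i>) ^ r / fact r * of_real (bernpoly r x)"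

lemma fourier_error_deriv:
  assumes t: "0 \<le> t" "t < 1" and r: "r > 0"
  shows "(fourier_error (Suc r) t has_vector_derivative (2 * of_real pi * \<i> * fourier_error r t x)) (at x within S)"
proof -
  have b: "((\<lambda>x. of_real (bernpoly (Suc r) x) :: complex) has_vector_derivative of_real (real (Suc r) * bernpoly r x)) (at x within S)"
    using bernpoly_deriv[of r x] by (intro has_vector_derivative_of_real) (auto intro: has_field_derivative_at_within simp: has_real_derivative_iff_has_vector_derivative[symmetric])
  have "(fourier_error (Suc r) t has_vector_derivative (2 * of_real pi * \<i> * abel_fourier r t x +
     (2 * of_real pi * \<i>) ^ Suc r / fact (Suc r) * of_real (real (Suc r) * bernpoly r x))) (at x within S)"
    unfolding fourier_error_def by (intro has_vector_derivative_add has_vector_derivative_mult_right b abel_fourier_deriv t r)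
  also have "(2 * of_real pi * \<i>) ^ Suc r / fact (Suc r) * of_real (real (Suc r) * bernpoly r x)
     = 2 * of_real pi * \<i> * ((2 * of_real pi * \<i>) ^ r / fact r * of_real (bernpoly r x))"
    by (simp add: field_simps del: of_nat_Suc)
  finally show ?thesis unfolding fourier_error_def by (simp add: algebra_simps)
qed

lemma e2pi_continuous: "continuous_on S e2pi"
  by (rule continuous_on_vector_derivative, rule e2pi_deriv)

lemma fourier_error_continuous:
  assumes t: "0 \<le> t" "t < 1" and r: "r > 0"
  shows "continuous_on S (fourier_error r t)"
proof -
  have n: "norm (of_real t * e2pi y) < 1" for y using t by (simp add: norm_mult)
  have p: "continuous_on (ball 0 1) (polylog r)"
    using polylog_continuous[OF r] by (auto intro!: continuous_at_imp_continuous_on)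
  have e: "continuous_on S (\<lambda>x. e2pi (- x))"
    by (rule continuous_on_compose2[OF e2pi_continuous[of UNIV]]) (auto intro: continuous_intros)
  have c: "continuous_on S (\<lambda>x. polylog r (of_real t * e2pi x))" "continuous_on S (\<lambda>x. polylog r (of_real t * e2pi (- x)))"
    by (rule continuous_on_compose2[OF p], use n in \<open>auto intro!: continuous_intros e2pi_continuous e\<close>)+
  have "continuous_on S (bernpoly r)"
    unfolding bernpoly_def
    by (intro continuous_on_sum continuous_on_mult continuous_on_const continuous_on_power continuous_on_id)
  then show ?thesis unfolding fourier_error_def abel_fourier_def
    by (intro continuous_on_add continuous_on_mult continuous_on_const continuous_on_of_real c)
qed

lemma fourier_error_integral:
  assumes t: "0 \<le> t" "t < 1" and r: "r > 0" and ab: "a \<le> b"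
  shows "((\<lambda>x. 2 * of_real pi * \<i> * fourier_error r t x) has_integral (fourier_error (Suc r) t b - fourier_error (Suc r) t a)) {a..b}"
  by (rule fundamental_theorem_of_calculus[OF ab], rule fourier_error_deriv[OF t r])

text \<open>The error of index \<open>r + 1\<close> is an antiderivative, up to a constant factor, and it takes the
  same value at 0 and 1.\<close>
lemma fourier_error_mean_zero:
  assumes t: "0 \<le> t" "t < 1" and r: "r > 0"
  shows "(fourier_error r t has_integral 0) {0..1}"
proof -
  obtain k where k: "r = Suc k" using r by (cases r) auto
  have "fourier_error (Suc r) t 1 = fourier_error (Suc r) t 0"
    unfolding fourier_error_def abel_fourier_def k bernpoly_endpoints by simp
  then have "((\<lambda>x. 2 * of_real pi * \<i> * fourier_error r t x) has_integral 0) {0..1}"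
    using fourier_error_integral[OF t r, of 0 1] by simp
  from has_integral_mult_right[OF this, of "1 / (2 * of_real pi * \<i>)"] show ?thesis
    by simp
qed

text \<open>The error of index \<open>r + 1\<close> has mean zero over the unit interval, so its value at \<open>x\<close> is the
  average of its differences from \<open>x\<close>, and each difference is at most \<open>2 \<pi>\<close> times the \<open>L\<^sup>1\<close>
  norm of the error of index \<open>r\<close>.\<close>
lemma fourier_error_sup_bound:
  assumes t: "0 \<le> t" "t < 1" and r: "r > 0" and x: "x \<in> {0..1}"
  shows "norm (fourier_error (Suc r) t x) \<le> 2 * pi * integral {0..1} (\<lambda>y. norm (fourier_error r t y))"
proof -
  let ?I = "integral {0..1} (\<lambda>y. norm (fourier_error r t y))"
  have int: "(\<lambda>y. norm (fourier_error r t y)) integrable_on {a..b}" for a b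
    by (intro integrable_continuous_real continuous_on_norm fourier_error_continuous t r)
  have le: "norm (fourier_error (Suc r) t b - fourier_error (Suc r) t a) \<le> 2 * pi * ?I"
    if ab: "0 \<le> a" "a \<le> b" "b \<le> 1" for a b
  proof -
    have "norm (fourier_error (Suc r) t b - fourier_error (Suc r) t a) \<le> integral {a..b} (\<lambda>y. 2 * pi * norm (fourier_error r t y))"
    proof -
      have "fourier_error r t integrable_on {a..b}"
        by (intro integrable_continuous_real fourier_error_continuous t r)
      then have "norm (integral {a..b} (\<lambda>x. 2 * of_real pi * \<i> * fourier_error r t x)) \<le> integral {a..b} (\<lambda>y. 2 * pi * norm (fourier_error r t y))"
        by (intro integral_norm_bound_integral integrable_on_mult_right int) (auto simp: norm_mult)
      then show ?thesis using integral_unique[OF fourier_error_integral[OF t r ab(2)]] by simp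
    qed
    also have "\<dots> = 2 * pi * integral {a..b} (\<lambda>y. norm (fourier_error r t y))" by simp
    also have "\<dots> \<le> 2 * pi * ?I"
      using ab by (intro mult_left_mono integral_subset_le int) auto
    finally show ?thesis .
  qed
  have le': "norm (fourier_error (Suc r) t x - fourier_error (Suc r) t y) \<le> 2 * pi * ?I" if "y \<in> {0..1}" for y
    using le[of x y] le[of y x] x that by (cases "x \<le> y") (auto simp: norm_minus_commute)
  have "((\<lambda>y. fourier_error (Suc r) t x - fourier_error (Suc r) t y) has_integral (fourier_error (Suc r) t x - 0)) {0..1}"
    using fourier_error_mean_zero[OF t, of "Suc r"] has_integral_const_real[of "fourier_error (Suc r) t x" 0 1]
    by (intro has_integral_diff) auto
  moreover have "0 \<le> 2 * pi * ?I" using integral_nonneg[OF int] by simp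
  ultimately have "norm (fourier_error (Suc r) t x - 0) \<le> (2 * pi * ?I) * measure lborel {0..1::real}"
    by (intro has_integral_bound_real) (use le' in auto)
  then show ?thesis by simp
qed

text \<open>For \<open>r = 1\<close> the polylogarithm is \<open>- Ln (1 - z)\<close>, and the two summands are complex
  conjugates up to sign.\<close>
lemma abel_fourier_1:
  assumes t: "0 \<le> t" "t < 1"
  shows "abel_fourier (Suc 0) t x = - (2 * \<i> * of_real (Im (Ln (1 - of_real t * e2pi x))))"
proof -
  have n: "norm (of_real t * e2pi y) < 1" for y using t by (simp add: norm_mult)
  have "e2pi (- x) = cnj (e2pi x)" by (simp add: e2pi_def exp_cnj)
  then have c: "1 - of_real t * e2pi (- x) = cnj (1 - of_real t * e2pi x)" by simp
  have "Re (of_real t * e2pi x) < 1" using n[of x] complex_Re_le_cmod le_less_trans by blast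
  then have "1 - of_real t * e2pi x \<notin> \<real>\<^sub>\<le>\<^sub>0" by (simp add: complex_nonpos_Reals_iff)
  then have "Ln (1 - of_real t * e2pi (- x)) = cnj (Ln (1 - of_real t * e2pi x))"
    unfolding c by (metis cnj_Ln)
  then show ?thesis
    unfolding abel_fourier_def by (simp add: polylog_1 n complex_eq_iff)
qed

text \<open>With \<open>s = sin (\<pi> x) > 0\<close> one has \<open>1 - e(x) = 2 s exp (\<i> (\<pi> x - \<pi> / 2))\<close>, where the angle
  lies within the range of the principal logarithm.\<close>
lemma Ln_one_minus_e2pi:
  assumes "0 < x" "x < 1" shows "Im (Ln (1 - e2pi x)) = pi * x - pi / 2" "1 - e2pi x \<notin> \<real>\<^sub>\<le>\<^sub>0"
proof -
  have s: "sin (pi * x) > 0" using assms by (intro sin_gt_zero) auto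
  let ?z = "Complex (ln (2 * sin (pi * x))) (pi * x - pi / 2)"
  have cs: "cos (2 * pi * x) = 1 - 2 * (sin (pi * x))\<^sup>2" "sin (2 * pi * x) = 2 * sin (pi * x) * cos (pi * x)"
    using cos_double_sin[of "pi * x"] sin_double[of "pi * x"] by (simp_all add: mult_ac)
  have e: "e2pi x = Complex (cos (2 * pi * x)) (sin (2 * pi * x))"
    by (simp add: e2pi_def exp_eq_polar complex_eq_iff Re_exp Im_exp)
  have "exp ?z = 1 - e2pi x"
    unfolding e using s
    by (simp add: complex_eq_iff Re_exp Im_exp cs sin_diff cos_diff power2_eq_square)
  then have "Ln (1 - e2pi x) = ?z"
  proof (intro Ln_unique)
    have "0 < pi * x" "pi * x < pi" using assms by auto
    then show "- pi < Im ?z" "Im ?z \<le> pi" unfolding complex.sel using pi_gt_zero by linarith+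
  qed
  then show "Im (Ln (1 - e2pi x)) = pi * x - pi / 2" by simp
  have "Re (1 - e2pi x) = 2 * (sin (pi * x))\<^sup>2" unfolding e cs by simp
  also have "\<dots> > 0" using s by simp
  finally show "1 - e2pi x \<notin> \<real>\<^sub>\<le>\<^sub>0" by (simp add: complex_nonpos_Reals_iff)
qed

context
  fixes t :: "nat \<Rightarrow> real"
  assumes t0: "\<And>m. 0 \<le> t m" and t1: "\<And>m. t m < 1" and tlim: "t \<longlonglongrightarrow> 1"
begin

lemma fourier_error_1_tendsto:
  assumes x: "0 < x" "x < 1"
  shows "(\<lambda>m. fourier_error (Suc 0) (t m) x) \<longlonglongrightarrow> 0"
proof -
  note L = Ln_one_minus_e2pi[OF x]
  have "(\<lambda>m. Ln (1 - of_real (t m) * e2pi x)) \<longlonglongrightarrow> Ln (1 - of_real 1 * e2pi x)"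
    by (intro tendsto_Ln tendsto_intros tlim) (use L(2) in auto)
  note lim = this
  have "(\<lambda>m. - (2 * \<i> * of_real (Im (Ln (1 - of_real (t m) * e2pi x)))) + (2 * of_real pi * \<i>) ^ Suc 0 / fact (Suc 0) * of_real (bernpoly (Suc 0) x))
     \<longlonglongrightarrow> - (2 * \<i> * of_real (Im (Ln (1 - of_real 1 * e2pi x)))) + (2 * of_real pi * \<i>) ^ Suc 0 / fact (Suc 0) * of_real (bernpoly (Suc 0) x)"
    by (intro lim tendsto_intros)
  also have "- (2 * \<i> * of_real (Im (Ln (1 - of_real 1 * e2pi x)))) + (2 * of_real pi * \<i>) ^ Suc 0 / fact (Suc 0) * of_real (bernpoly (Suc 0) x) = 0"
    by (simp add: L(1) bernpoly_1 complex_eq_iff algebra_simps)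
  finally show ?thesis by (simp only: fourier_error_def abel_fourier_1[OF t0 t1])
qed

text \<open>For \<open>r = 1\<close> the error is bounded and tends to 0 in the open interval, so dominated
  convergence applies. The error of any larger index is bounded uniformly by the \<open>L\<^sup>1\<close> norm
  of its predecessor.\<close>
lemma fourier_error_L1_tendsto:
  "(\<lambda>m. integral {0..1} (\<lambda>y. norm (fourier_error (Suc r) (t m) y))) \<longlonglongrightarrow> 0"
proof (induction r)
  case 0
  \<comment> \<open>At the two endpoints the Abel means vanish and the error stays at \<open>\<pi>\<close> in norm.\<close>
  let ?g = "\<lambda>x. if x \<in> {0,1::real} then pi else 0"
  have "(\<lambda>m. integral {0..1} (\<lambda>y. norm (fourier_error (Suc 0) (t m) y))) \<longlonglongrightarrow> integral {0..1} ?g"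
  proof (rule dominated_convergence(2))
    show "(\<lambda>y. norm (fourier_error (Suc 0) (t m) y)) integrable_on {0..1}" for m
      by (intro integrable_continuous_real continuous_on_norm fourier_error_continuous t0 t1) simp
    show "(\<lambda>_. 3 * pi) integrable_on {0..1::real}" by (rule integrable_const_ivl)
    fix m and x :: real assume x: "x \<in> {0..1}"
    have "norm (abel_fourier (Suc 0) (t m) x) \<le> 2 * pi"
    proof -
      have "Re (of_real (t m) * e2pi x) < 1"
        using t0[of m] t1[of m] complex_Re_le_cmod[of "of_real (t m) * e2pi x"] by (simp add: norm_mult)
      then have "1 - of_real (t m) * e2pi x \<noteq> 0" by (metis eq_iff_diff_eq_0 less_irrefl one_complex.simps(1))
      then have "\<bar>Im (Ln (1 - of_real (t m) * e2pi x))\<bar> \<le> pi" using mpi_less_Im_Ln Im_Ln_le_pi by (metis abs_le_iff less_eq_real_def minus_le_iff)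
      then show ?thesis by (simp add: abel_fourier_1[OF t0 t1] norm_mult)
    qed
    moreover have "norm ((2 * of_real pi * \<i>) ^ Suc 0 / fact (Suc 0) * of_real (bernpoly (Suc 0) x) :: complex) \<le> pi"
    proof -
      have "\<bar>x - 1 / 2\<bar> \<le> 1 / 2" unfolding abs_le_iff using x by auto
      then have "2 * pi * \<bar>x - 1 / 2\<bar> \<le> 2 * pi * (1 / 2)" by (rule mult_left_mono) simp
      moreover have "norm ((2 * of_real pi * \<i>) ^ Suc 0 / fact (Suc 0) * of_real (bernpoly (Suc 0) x) :: complex) = 2 * pi * \<bar>x - 1 / 2\<bar>"
        by (simp add: norm_mult bernpoly_1 del: of_real_diff)
      ultimately show ?thesis by linarith
    qed
    ultimately show "norm (norm (fourier_error (Suc 0) (t m) x)) \<le> 3 * pi"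
      unfolding fourier_error_def by (simp only: real_norm_def abs_norm_cancel) (rule norm_triangle_le, linarith)
  next
    fix x :: real assume x: "x \<in> {0..1}"
    show "(\<lambda>m. norm (fourier_error (Suc 0) (t m) x)) \<longlonglongrightarrow> ?g x"
    proof (cases "x \<in> {0,1}")
      case True
      have "e2pi x = 1" "e2pi (-x) = 1"
        using True by (elim insertE emptyE; simp)+
      then have "norm (fourier_error (Suc 0) (t m) x) = pi" for m
        using True by (auto simp: fourier_error_def abel_fourier_def bernpoly_1 norm_mult norm_divide)
      then show ?thesis using True by simp
    next
      case False
      then have "0 < x" "x < 1" using x by auto
      from tendsto_norm[OF fourier_error_1_tendsto[OF this]] show ?thesis using False by simp
    qed
  qed
  moreover have "integral {0..1} ?g = integral {0..1::real} (\<lambda>_. 0)"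
    by (rule integral_spike[of "{0,1}"]) auto
  ultimately show ?case by simp
next
  case (Suc r)
  let ?I = "\<lambda>r m. integral {0..1} (\<lambda>y. norm (fourier_error (Suc r) (t m) y))"
  have lim: "(\<lambda>m. 2 * pi * ?I r m) \<longlonglongrightarrow> 0" using tendsto_mult_right_zero[OF Suc] .
  show ?case
  proof (rule tendsto_sandwich[OF _ _ tendsto_const lim]; intro always_eventually allI)
    fix m
    have int: "(\<lambda>y. norm (fourier_error (Suc (Suc r)) (t m) y)) integrable_on {0..1}"
      by (intro integrable_continuous_real continuous_on_norm fourier_error_continuous t0 t1) simp
    show "0 \<le> ?I (Suc r) m" by (intro integral_nonneg int) simp
    have "?I (Suc r) m \<le> integral {0..1} (\<lambda>_::real. 2 * pi * ?I r m)"
      by (intro integral_le int integrable_const_ivl fourier_error_sup_bound t0 t1) auto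
    then show "?I (Suc r) m \<le> 2 * pi * ?I r m" by simp
  qed
qed

lemma abel_fourier_tendsto:
  assumes x: "0 < x \<and> x < 1 \<or> r \<ge> 2 \<and> 0 \<le> x \<and> x \<le> 1" and r: "r > 0"
  shows "(\<lambda>m. abel_fourier r (t m) x) \<longlonglongrightarrow> - ((2 * of_real pi * \<i>) ^ r / fact r * of_real (bernpoly r x))"
proof -
  have "(\<lambda>m. fourier_error r (t m) x) \<longlonglongrightarrow> 0"
  proof (cases "r = 1")
    case True
    then show ?thesis using fourier_error_1_tendsto x by auto
  next
    case False
    then obtain k where k: "r = Suc (Suc k)" using r by (metis One_nat_def gr0_implies_Suc not0_implies_Suc)
    have lim: "(\<lambda>m. 2 * pi * integral {0..1} (\<lambda>y. norm (fourier_error (Suc k) (t m) y))) \<longlonglongrightarrow> 0"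
      using tendsto_mult_right_zero[OF fourier_error_L1_tendsto] .
    show ?thesis unfolding k
      by (rule Lim_null_comparison[OF always_eventually lim])
        (use x in \<open>auto intro!: fourier_error_sup_bound t0 t1\<close>)
  qed
  from tendsto_diff[OF this tendsto_const[of "(2 * of_real pi * \<i>) ^ r / fact r * of_real (bernpoly r x)"]]
  show ?thesis by (simp add: fourier_error_def)
qed

text \<open>Abel's limit theorem along a sequence: with the partial sums \<open>s k\<close> one has
  \<open>\<Sum> a k u\<^sup>k - S = (1 - u) \<Sum> (s k - S) u\<^sup>k\<close>, and only finitely many \<open>s k - S\<close> are not small.\<close>
lemma abel_limit:
  fixes a :: "nat \<Rightarrow> complex"
  assumes a: "a sums S"
  shows "(\<lambda>m. \<Sum>k. a k * of_real (t m) ^ k) \<longlonglongrightarrow> S"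
proof (rule LIMSEQ_I)
  fix e :: real assume e: "e > 0"
  define s where "s k = (\<Sum>i\<le>k. a i)" for k
  have s: "s \<longlonglongrightarrow> S" using a unfolding sums_def_le s_def .
  have "a \<longlonglongrightarrow> 0" using a summable_LIMSEQ_zero sums_summable by blast
  then obtain A where A: "\<And>k. norm (a k) \<le> A" by (metis Bseq_def convergentI convergent_imp_Bseq)
  obtain B where B: "\<And>k. norm (s k - S) \<le> B"
    using convergent_imp_Bseq[OF convergentI[OF tendsto_diff[OF s tendsto_const[of S]]]] unfolding Bseq_def by blast
  have B0: "B \<ge> 0" using B[of 0] norm_ge_zero order_trans by blast
  obtain N where N: "\<And>k. k \<ge> N \<Longrightarrow> norm (s k - S) < e / 2" using LIMSEQ_D[OF s, of "e / 2"] e by auto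
  have bound: "norm ((\<Sum>k. a k * of_real u ^ k) - S) \<le> (1 - u) * (real N * B) + e / 2" if u: "0 \<le> u" "u < 1" for u
  proof -
    let ?u = "of_real u :: complex"
    have nu: "norm ?u < 1" using u by simp
    have sg: "summable (\<lambda>k. norm (?u ^ k))" using nu by (simp add: norm_power summable_geometric)
    have sa: "summable (\<lambda>k. norm (a k * ?u ^ k))"
      by (rule summable_comparison_test'[OF summable_mult[OF sg, of A], of 0]) (use A in \<open>auto simp: norm_mult intro!: mult_right_mono\<close>)
    have sd: "summable (\<lambda>k. norm ((s k - S) * ?u ^ k))"
      by (rule summable_comparison_test'[OF summable_mult[OF sg, of B], of 0]) (use B in \<open>auto simp: norm_mult intro!: mult_right_mono\<close>)
    have "(\<Sum>k. a k * ?u ^ k) * (\<Sum>k. ?u ^ k) = (\<Sum>k. \<Sum>i\<le>k. (a i * ?u ^ i) * ?u ^ (k - i))"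
      by (rule Cauchy_product[OF sa sg])
    also have "(\<lambda>k. \<Sum>i\<le>k. (a i * ?u ^ i) * ?u ^ (k - i)) = (\<lambda>k. s k * ?u ^ k)"
      by (auto simp: fun_eq_iff s_def sum_distrib_right mult.assoc simp flip: power_add)
    finally have "(\<Sum>k. a k * ?u ^ k) / (1 - ?u) = (\<Sum>k. s k * ?u ^ k)"
      using suminf_geometric[OF nu] by simp
    moreover have "(\<Sum>k. s k * ?u ^ k) = (\<Sum>k. (s k - S) * ?u ^ k + S * ?u ^ k)" by (simp add: algebra_simps)
    also have "\<dots> = (\<Sum>k. (s k - S) * ?u ^ k) + (\<Sum>k. S * ?u ^ k)"
      using sd nu by (intro suminf_add[symmetric] summable_mult) (auto dest: summable_norm_cancel)
    also have "(\<Sum>k. S * ?u ^ k) = S / (1 - ?u)"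
      using suminf_geometric[OF nu] nu by (simp add: suminf_mult)
    ultimately have "(\<Sum>k. a k * ?u ^ k) - S = (1 - ?u) * (\<Sum>k. (s k - S) * ?u ^ k)"
      using nu by (auto simp: field_simps)
    also have "norm \<dots> = (1 - u) * norm (\<Sum>k. (s k - S) * ?u ^ k)"
    proof -
      have "1 - ?u = of_real (1 - u)" by simp
      then show ?thesis using u by (simp only: norm_mult norm_of_real)
    qed
    also have "norm (\<Sum>k. (s k - S) * ?u ^ k) \<le> (\<Sum>k. norm ((s k - S) * ?u ^ k))" by (rule summable_norm[OF sd])
    also have "\<dots> \<le> (\<Sum>k. (if k < N then B else 0) + e / 2 * u ^ k)"
    proof (rule suminf_le[OF _ sd])
      show "summable (\<lambda>k. (if k < N then B else 0) + e / 2 * u ^ k)"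
        using u by (intro summable_add summable_mult summable_geometric summable_finite[of "{..<N}"]) auto
      fix k
      have u1: "u ^ k \<le> 1" "0 \<le> u ^ k" using u by (auto intro: power_le_one)
      show "norm ((s k - S) * ?u ^ k) \<le> (if k < N then B else 0) + e / 2 * u ^ k"
      proof (cases "k < N")
        case True
        have "norm (s k - S) * u ^ k \<le> B * 1" using B[of k] u1 B0 by (intro mult_mono) auto
        then show ?thesis using True u1 u e by (simp add: norm_mult norm_power add_increasing2)
      next
        case False
        then have "norm (s k - S) * u ^ k \<le> e / 2 * u ^ k" using N[of k] u1 by (intro mult_right_mono) auto
        then show ?thesis using False u by (simp add: norm_mult norm_power)
      qed
    qed
    also have "\<dots> = (\<Sum>k. (if k < N then B else 0)) + (\<Sum>k. e / 2 * u ^ k)"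
      using u by (intro suminf_add[symmetric] summable_mult summable_geometric summable_finite[of "{..<N}"]) auto
    also have "(\<Sum>k. (if k < N then B else 0)) = real N * B"
      using suminf_finite[of "{..<N}" "\<lambda>k. if k < N then B else 0"] by simp
    also have "(\<Sum>k. e / 2 * u ^ k) = e / 2 / (1 - u)"
      using u by (subst suminf_mult) (auto simp: suminf_geometric summable_geometric)
    finally have "norm ((\<Sum>k. a k * ?u ^ k) - S) \<le> (1 - u) * (real N * B + e / 2 / (1 - u))"
      using u by (simp add: mult_left_mono)
    also have "\<dots> = (1 - u) * (real N * B) + e / 2" using u by (simp add: field_simps)
    finally show ?thesis .
  qed
  have "(\<lambda>m. (1 - t m) * (real N * B) + e / 2) \<longlonglongrightarrow> (1 - 1) * (real N * B) + e / 2"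
    by (intro tendsto_intros tlim)
  from order_tendstoD(2)[OF this, of e]
  have "eventually (\<lambda>m. (1 - t m) * (real N * B) + e / 2 < e) sequentially"
    using e by simp
  then obtain M where "\<And>m. m \<ge> M \<Longrightarrow> (1 - t m) * (real N * B) + e / 2 < e"
    by (auto simp: eventually_sequentially)
  then show "\<exists>no. \<forall>m\<ge>no. norm ((\<Sum>k. a k * of_real (t m) ^ k) - S) < e"
    using bound[OF t0 t1] order_le_less_trans by blast
qed

end

section \<open>Generalized Bernoulli numbers as L-values\<close>

lemma e2pi_conv_zeta_root: "e2pi (of_int k / real m) = zeta_root m powi k"
  by (simp add: e2pi_def zeta_root_powi)

lemma e2pi_power: "e2pi x ^ k = e2pi (real k * x)"
proof -
  have "e2pi x ^ k = exp (of_nat k * (2 * of_real pi * \<i> * of_real x))"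
    unfolding e2pi_def by (rule exp_of_nat_mult[symmetric])
  then show ?thesis by (simp add: e2pi_def mult_ac)
qed

lemma primitive_char_conj_primitive:
  assumes "primitive_dirichlet_char f psi" shows "primitive_dirichlet_char f (conj_char psi)"
  using assms dirichlet_char_conj conductor_conj unfolding primitive_dirichlet_char_def by metis

text \<open>The finite Fourier expansion of \<open>psi\<close> in terms of additive characters, cleared of the Gauss
  sum.\<close>
lemma primitive_char_fourier_expansion:
  assumes f: "f > 0" and p: "primitive_dirichlet_char f psi"
  shows "(\<Sum>j = 1..f. conj_char psi (int j) * e2pi (- (of_int k * (real j / real f)))) = psi k * gauss_sum f (conj_char psi)"
proof -
  let ?c = "conj_char psi"
  have p': "primitive_dirichlet_char f ?c" by (rule primitive_char_conj_primitive[OF p])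
  then have c: "dirichlet_char f ?c" unfolding primitive_dirichlet_char_def by simp
  have e: "e2pi (- (of_int k * (real j / real f))) = zeta_root f powi (- (int j * k))" for j
    using e2pi_conv_zeta_root[of "- (int j * k)" f] by (simp add: mult.commute)
  have "(\<Sum>j = 1..f. ?c (int j) * e2pi (- (of_int k * (real j / real f)))) = (\<Sum>j = 1..f. ?c (int j) * zeta_root f powi (- (int j * k)))"
    by (simp only: e)
  also have "\<dots> = twisted_gauss_sum f ?c k"
    unfolding twisted_gauss_sum_def
  proof (rule sum_periodic_shift[OF f, where g = "\<lambda>a. ?c a * zeta_root f powi (- (a * k))"])
    have "?c (int f) = ?c 0" by (rule dirichlet_char_cong[OF c]) (simp add: cong_def)
    moreover have "zeta_root f powi (- (int f * k)) = 1" by (subst zeta_root_powi_eq_1_iff[OF f]) simp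
    ultimately show "?c (int f) * zeta_root f powi (- (int f * k)) = ?c 0 * zeta_root f powi (- (0 * k))" by simp
  qed
  also have "\<dots> = psi k * gauss_sum f ?c"
    using primitive_twisted_gauss_sum[OF f p', of k] gauss_sum_conv_twisted[OF f c] by (simp add: conj_char_def)
  finally show ?thesis .
qed

text \<open>Insert the Fourier series of the Bernoulli polynomial into the definition of the
  generalized Bernoulli number, regularized with a parameter \<open>u < 1\<close>. The finite sum over
  \<open>j\<close> then turns the \<open>k\<close>-th frequency into \<open>psi (- k)\<close> times the Gauss sum. By the parity of
  \<open>psi\<close> the frequencies \<open>k\<close> and \<open>- k\<close> contribute equally, and Abel's theorem lets \<open>u\<close> tend
  to 1. The value of the polynomial at the endpoint 1, where the expansion needs \<open>r \<ge> 2\<close>,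
  occurs only for \<open>f = 1\<close>; then \<open>r\<close> is even.\<close>
lemma gen_bernoulli_eq_L:
  assumes f: "f > 0" and p: "primitive_dirichlet_char f psi" and par: "psi (-1) = (-1) ^ r"
    and r: "r > 0" and L: "(\<lambda>k. psi (int k) / of_nat k ^ r) sums L"
  shows "gen_bernoulli r f (conj_char psi) * (2 * of_real pi * \<i>) ^ r =
    of_nat f ^ (r - 1) * ((-1) ^ (r + 1) * 2 * fact r * gauss_sum f (conj_char psi) * L)"
proof -
  let ?c = "conj_char psi"
  let ?tau = "gauss_sum f ?c"
  have c: "dirichlet_char f psi" using p unfolding primitive_dirichlet_char_def by simp
  \<comment> \<open>Any sequence in \<open>[0, 1)\<close> with limit 1 would do.\<close>
  define t where "t m = 1 - inverse (real (Suc m))" for m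
  have t0: "0 \<le> t m" and t1: "t m < 1" for m by (auto simp: t_def divide_simps)
  have tlim: "t \<longlonglongrightarrow> 1"
    unfolding t_def using tendsto_diff[OF tendsto_const[of 1] LIMSEQ_inverse_real_of_nat] by simp
  have sums: "(\<lambda>k. 2 * (-1) ^ r * ?tau * (psi (int k) / of_nat k ^ r * of_real u ^ k)) sums
      (\<Sum>j = 1..f. ?c (int j) * abel_fourier r u (real j / real f))" if u: "0 \<le> u" "u < 1" for u
  proof -
    have n: "norm (of_real u * e2pi y) < 1" for y using u by (simp add: norm_mult)
    have pl: "(\<lambda>k. (of_real u * e2pi y) ^ k / of_nat k ^ r) sums polylog r (of_real u * e2pi y)" for y
      unfolding polylog_def by (intro summable_sums polylog_summable n r)
    have "(\<lambda>k. \<Sum>j = 1..f. ?c (int j) * ((of_real u * e2pi (real j / real f)) ^ k / of_nat k ^ r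
              + (-1) ^ r * ((of_real u * e2pi (- (real j / real f))) ^ k / of_nat k ^ r)))
        sums (\<Sum>j = 1..f. ?c (int j) * abel_fourier r u (real j / real f))"
      unfolding abel_fourier_def by (intro sums_sum sums_mult sums_add pl)
    moreover have "(\<Sum>j = 1..f. ?c (int j) * ((of_real u * e2pi (real j / real f)) ^ k / of_nat k ^ r
              + (-1) ^ r * ((of_real u * e2pi (- (real j / real f))) ^ k / of_nat k ^ r)))
        = 2 * (-1) ^ r * ?tau * (psi (int k) / of_nat k ^ r * of_real u ^ k)" for k
    proof -
      let ?e = "\<lambda>l j. e2pi (- (of_int l * (real j / real f)))"
      have "(\<Sum>j = 1..f. ?c (int j) * ((of_real u * e2pi (real j / real f)) ^ k / of_nat k ^ r
              + (-1) ^ r * ((of_real u * e2pi (- (real j / real f))) ^ k / of_nat k ^ r)))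
         = (\<Sum>j = 1..f. of_real u ^ k / of_nat k ^ r * (?c (int j) * ?e (- int k) j + (-1) ^ r * (?c (int j) * ?e (int k) j)))"
        by (intro sum.cong refl) (simp add: power_mult_distrib e2pi_power ring_distribs mult_ac add_divide_distrib)
      also have "\<dots> = of_real u ^ k / of_nat k ^ r * ((\<Sum>j = 1..f. ?c (int j) * ?e (- int k) j) + (-1) ^ r * (\<Sum>j = 1..f. ?c (int j) * ?e (int k) j))"
        by (simp only: sum_distrib_left sum.distrib distrib_left mult.assoc)
      also have "\<dots> = of_real u ^ k / of_nat k ^ r * (psi (- int k) * ?tau + (-1) ^ r * (psi (int k) * ?tau))"
        by (simp only: primitive_char_fourier_expansion[OF f p])
      also have "psi (- int k) = (-1) ^ r * psi (int k)"
        using dirichlet_char_mult[OF c, of "-1" "int k"] par by simp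
      finally show ?thesis by simp
    qed
    ultimately show ?thesis by simp
  qed
  have lim1: "(\<lambda>m. \<Sum>k. 2 * (-1) ^ r * ?tau * (psi (int k) / of_nat k ^ r) * of_real (t m) ^ k) \<longlonglongrightarrow> 2 * (-1) ^ r * ?tau * L"
    by (rule abel_limit[OF t0 t1 tlim sums_mult[OF L]])
  have eq: "(\<Sum>k. 2 * (-1) ^ r * ?tau * (psi (int k) / of_nat k ^ r) * of_real (t m) ^ k)
      = (\<Sum>j = 1..f. ?c (int j) * abel_fourier r (t m) (real j / real f))" for m
    using sums_unique[OF sums[OF t0 t1, of m]] by (simp add: mult.assoc)
  have lim2: "(\<lambda>m. \<Sum>j = 1..f. ?c (int j) * abel_fourier r (t m) (real j / real f)) \<longlonglongrightarrow>
      (\<Sum>j = 1..f. ?c (int j) * - ((2 * of_real pi * \<i>) ^ r / fact r * of_real (bernpoly r (real j / real f))))"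
  proof (rule tendsto_sum)
    fix j assume j: "j \<in> {1..f}"
    show "(\<lambda>m. ?c (int j) * abel_fourier r (t m) (real j / real f)) \<longlonglongrightarrow>
      ?c (int j) * - ((2 * of_real pi * \<i>) ^ r / fact r * of_real (bernpoly r (real j / real f)))"
    proof (cases "j = f \<and> f > 1")
      case True
      then have "?c (int j) = 0"
        using dirichlet_char_nonzero_iff[OF c, of "int f"] by (auto simp: conj_char_def)
      then show ?thesis by simp
    next
      case False
      have "0 < real j / real f \<and> real j / real f < 1 \<or> r \<ge> 2 \<and> 0 \<le> real j / real f \<and> real j / real f \<le> 1"
      proof (cases "j < f")
        case True
        then show ?thesis using j by simp
      next
        case j': False
        then have "j = 1" "f = 1" using j False by auto
        have "psi (-1) = psi 1" by (rule dirichlet_char_cong[OF c]) (simp add: \<open>f = 1\<close> cong_def)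
        then have "even r" using par dirichlet_char_1[OF c] by (metis neg_one_odd_power one_neq_neg_one)
        then have "r \<ge> 2" using r by (cases "r = 1") auto
        then show ?thesis using \<open>j = 1\<close> \<open>f = 1\<close> by simp
      qed
      then show ?thesis by (intro tendsto_mult_left abel_fourier_tendsto[OF t0 t1 tlim] r)
    qed
  qed
  have "(\<Sum>j = 1..f. ?c (int j) * - ((2 * of_real pi * \<i>) ^ r / fact r * of_real (bernpoly r (real j / real f)))) = 2 * (-1) ^ r * ?tau * L"
    using LIMSEQ_unique[OF lim2] lim1 unfolding eq by blast
  moreover have "(\<Sum>j = 1..f. ?c (int j) * - ((2 * of_real pi * \<i>) ^ r / fact r * of_real (bernpoly r (real j / real f))))
     = - ((2 * of_real pi * \<i>) ^ r / fact r) * (\<Sum>j = 1..f. ?c (int j) * of_real (bernpoly r (real j / real f)))"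
    unfolding sum_distrib_left by (intro sum.cong refl) simp
  ultimately have "(2 * of_real pi * \<i>) ^ r * (\<Sum>j = 1..f. ?c (int j) * of_real (bernpoly r (real j / real f))) = fact r * ((-1) ^ (r + 1) * 2 * ?tau * L)"
    by (simp add: field_simps)
  then show ?thesis unfolding gen_bernoulli_def by (simp add: mult_ac)
qed

section \<open>Continuation of Dirichlet series and the lemma of Landau\<close>

text \<open>Mean value inequality for \<open>z \<mapsto> z\<^bsup>-s\<^esup>\<close> on a real segment.\<close>
lemma nat_powr_diff_bound:
  fixes s :: complex
  assumes n: "n \<ge> (1::nat)" and x: "real n \<le> x" and s: "Re s > 0"
  shows "norm (of_real x powr (- s) - of_nat n powr (- s)) \<le> norm s * real n powr (- Re s - 1) * (x - real n)"
proof -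
  let ?S = "closed_segment (of_nat n :: complex) (of_real x)"
  have mem: "z \<in> \<real> \<and> real n \<le> Re z" if "z \<in> ?S" for z
    using that x closed_segment_of_real[where ?'a = complex, of "real n" x] by (auto simp: closed_segment_eq_real_ivl)
  have pos: "z \<notin> \<real>\<^sub>\<le>\<^sub>0" if "z \<in> ?S" for z
    using mem[OF that] n by (auto simp: complex_nonpos_Reals_iff)
  have "norm (of_real x powr (- s) - of_nat n powr (- s)) \<le> norm s * real n powr (- Re s - 1) * norm (of_real x - of_nat n :: complex)"
  proof (rule field_differentiable_bound[where S = ?S and f' = "\<lambda>z. - s * z powr (- s - 1)"])
    fix z assume z: "z \<in> ?S"
    show "((\<lambda>z. z powr (- s)) has_field_derivative - s * z powr (- s - 1)) (at z within ?S)"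
      using has_field_derivative_powr[OF pos[OF z], of "- s"] by (rule has_field_derivative_at_within)
    have "norm (z powr (- s - 1)) = Re z powr (- Re s - 1)"
      using mem[OF z] n by (subst norm_powr_real_powr) auto
    also have "\<dots> \<le> real n powr (- Re s - 1)"
      using mem[OF z] n s by (intro powr_mono2') auto
    finally show "norm (- s * z powr (- s - 1)) \<le> norm s * real n powr (- Re s - 1)"
      by (simp add: norm_mult mult_left_mono)
  qed auto
  also have "norm (of_real x - of_nat n :: complex) = x - real n"
    using x by (metis abs_of_nonneg diff_ge_0_iff_ge norm_of_real of_real_diff of_real_of_nat_eq)
  finally show ?thesis .
qed

text \<open>On the disc around \<open>x\<close> of radius \<open>Re x / 2\<close> the series is dominated by a multiple of
  \<open>\<Sum> k\<^bsup>- Re x / 2 - 1\<^esup>\<close>, so it converges locally uniformly. Monotonicity of \<open>K\<close> makes the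
  dominating constant uniform on the disc.\<close>
lemma holomorphic_on_right_half_plane_series:
  fixes u :: "nat \<Rightarrow> complex \<Rightarrow> complex"
  assumes hol: "\<And>k. u k holomorphic_on {s. Re s > 0}"
    and bd: "\<And>k s. Re s > 0 \<Longrightarrow> norm (u k s) \<le> K (norm s) * real k powr (- Re s - 1)"
    and K: "mono K" "\<And>x. K x \<ge> 0" and u0: "\<And>s. u 0 s = 0"
  shows "(\<lambda>s. \<Sum>k. u k s) holomorphic_on {s. Re s > 0}"
    "Re s > 0 \<Longrightarrow> summable (\<lambda>k. u k s)"
proof -
  have op: "open {s::complex. Re s > 0}" by (rule open_halfspace_Re_gt)
  have bd': "norm (u k s) \<le> K (norm x + Re x / 2) * real k powr (- (Re x / 2) - 1)"
    if x: "Re x > 0" and s: "s \<in> cball x (Re x / 2)" for x s k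
  proof (cases "k = 0")
    case False
    have "norm (s - x) \<le> Re x / 2" using s by (simp add: dist_norm norm_minus_commute)
    then have 1: "norm s \<le> norm x + Re x / 2" using norm_triangle_ineq2[of s x] by linarith
    have "\<bar>Re (s - x)\<bar> \<le> Re x / 2" using abs_Re_le_cmod[of "s - x"] \<open>norm (s - x) \<le> Re x / 2\<close> by linarith
    then have 2: "Re s \<ge> Re x / 2" unfolding abs_le_iff by simp
    have "norm (u k s) \<le> K (norm s) * real k powr (- Re s - 1)" using 2 x by (intro bd) linarith
    also have "\<dots> \<le> K (norm x + Re x / 2) * real k powr (- (Re x / 2) - 1)"
      using 2 False by (intro mult_mono monoD[OF K(1)] 1 K(2) powr_mono) auto
    finally show ?thesis .
  qed (simp add: u0)
  have sm: "summable (\<lambda>k. K (norm x + Re x / 2) * real k powr (- (Re x / 2) - 1))" if "Re x > 0" for x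
    using that by (intro summable_mult) (simp add: summable_real_powr_iff)
  show "(\<lambda>s. \<Sum>k. u k s) holomorphic_on {s. Re s > 0}"
  proof (rule holomorphic_uniform_sequence[OF op])
    show "(\<lambda>s. \<Sum>k<m. u k s) holomorphic_on {s. Re s > 0}" for m
      by (intro holomorphic_intros hol)
    fix x :: complex assume "x \<in> {s. Re s > 0}"
    then have x: "Re x > 0" by simp
    have "cball x (Re x / 2) \<subseteq> {s. Re s > 0}"
    proof
      fix s assume "s \<in> cball x (Re x / 2)"
      then have "\<bar>Re (s - x)\<bar> \<le> Re x / 2"
        using abs_Re_le_cmod[of "s - x"] by (simp add: dist_norm norm_minus_commute)
      then show "s \<in> {s. Re s > 0}" using x unfolding abs_le_iff by simp
    qed
    moreover have "uniform_limit (cball x (Re x / 2)) (\<lambda>m s. \<Sum>k<m. u k s) (\<lambda>s. \<Sum>k. u k s) sequentially"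
      by (rule Weierstrass_m_test[OF bd'[OF x] sm[OF x]])
    ultimately show "\<exists>d>0. cball x d \<subseteq> {s. Re s > 0} \<and> uniform_limit (cball x d) (\<lambda>m s. \<Sum>k<m. u k s) (\<lambda>s. \<Sum>k. u k s) sequentially"
      using x by (intro exI[of _ "Re x / 2"]) auto
  qed
  show "summable (\<lambda>k. u k s)" if "Re s > 0"
    by (rule summable_comparison_test'[OF sm[OF that], of 0]) (use bd'[OF that, of s] that in auto)
qed

text \<open>The Dirichlet series of \<open>a\<close> after summation by parts.\<close>
definition abel_dirichlet :: "(nat \<Rightarrow> complex) \<Rightarrow> complex \<Rightarrow> complex" where
  "abel_dirichlet a s = (\<Sum>N. (\<Sum>k\<le>N. a k) * (of_nat N powr (- s) - of_nat (Suc N) powr (- s)))"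

text \<open>If the partial sums of \<open>a\<close> are bounded, then summation by parts gives a series of terms of
  size \<open>|s| N\<^bsup>- Re s - 1\<^esup>\<close>.\<close>
lemma abel_dirichlet:
  fixes a :: "nat \<Rightarrow> complex"
  assumes a0: "a 0 = 0" and C: "\<And>N. norm (\<Sum>k\<le>N. a k) \<le> C"
  shows "abel_dirichlet a holomorphic_on {s. Re s > 0}"
    "Re s > 0 \<Longrightarrow> (\<lambda>k. a k * of_nat k powr (- s)) sums abel_dirichlet a s"
proof -
  define A where "A N = (\<Sum>k\<le>N. a k)" for N
  define u where "u N s = A N * (of_nat N powr (- s) - of_nat (Suc N) powr (- s))" for N s
  have C0: "C \<ge> 0" using C[of 0] norm_ge_zero order_trans by blast
  have A0: "A 0 = 0" by (simp add: A_def a0)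
  have hol: "u k holomorphic_on {s. Re s > 0}" for k
  proof (cases "k = 0")
    case False
    then show ?thesis unfolding u_def by (intro holomorphic_intros) auto
  next
    case True
    then have "u k = (\<lambda>_. 0)" by (simp add: u_def A0 fun_eq_iff)
    then show ?thesis by simp
  qed
  have bd: "norm (u k s) \<le> C * norm s * real k powr (- Re s - 1)" if "Re s > 0" for k s
  proof (cases "k = 0")
    case False
    have "norm (of_real (real (Suc k)) powr (- s) - of_nat k powr (- s)) \<le> norm s * real k powr (- Re s - 1) * (real (Suc k) - real k)"
      using False that by (intro nat_powr_diff_bound) auto
    then have "norm (of_nat k powr (- s) - of_nat (Suc k) powr (- s) :: complex) \<le> norm s * real k powr (- Re s - 1)"
      by (simp add: norm_minus_commute)
    then have "norm (A k) * norm (of_nat k powr (- s) - of_nat (Suc k) powr (- s) :: complex) \<le> C * (norm s * real k powr (- Re s - 1))"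
      using C[of k] C0 by (intro mult_mono) (auto simp: A_def)
    then show ?thesis by (simp add: u_def norm_mult mult.assoc)
  qed (simp add: u_def A0)
  \<comment> \<open>Truncation makes the factor monotone and nonnegative on all reals.\<close>
  define K' where "K' x = C * max x 0" for x
  have K': "mono K'" "\<And>x. K' x \<ge> 0" using C0 by (auto simp: K'_def intro!: monoI mult_left_mono)
  have bd3: "norm (u k s) \<le> K' (norm s) * real k powr (- Re s - 1)" if "Re s > 0" for k s
    using bd[OF that, of k] by (simp only: K'_def max_absorb1 norm_ge_zero)
  have u0: "u 0 s = 0" for s by (simp add: u_def A0)
  have eq: "abel_dirichlet a = (\<lambda>s. \<Sum>k. u k s)"
    by (simp add: abel_dirichlet_def u_def A_def fun_eq_iff)
  show "abel_dirichlet a holomorphic_on {s. Re s > 0}"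
    unfolding eq by (rule holomorphic_on_right_half_plane_series(1)[OF hol bd3 K' u0])
  assume s: "Re s > 0"
  have "(\<lambda>k. u k s) sums abel_dirichlet a s"
    unfolding eq by (intro summable_sums holomorphic_on_right_half_plane_series(2)[OF hol bd3 K' u0] s)
  then have l1: "(\<lambda>M. \<Sum>k\<le>M. u k s) \<longlonglongrightarrow> abel_dirichlet a s" by (simp add: sums_def_le)
  have l2: "(\<lambda>M. A M * of_nat (Suc M) powr (- s)) \<longlonglongrightarrow> 0"
  proof (rule Lim_null_comparison[where g = "\<lambda>M. C * real (Suc M) powr (- Re s)"])
    show "\<forall>\<^sub>F M in sequentially. norm (A M * of_nat (Suc M) powr (- s)) \<le> C * real (Suc M) powr (- Re s)"
    proof (intro always_eventually allI)
      fix M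
      have "norm (of_nat (Suc M) powr (- s) :: complex) = real (Suc M) powr (- Re s)"
        by (subst norm_powr_real_powr) (auto simp del: of_nat_Suc)
      then show "norm (A M * of_nat (Suc M) powr (- s)) \<le> C * real (Suc M) powr (- Re s)"
        using C[of M] by (simp add: A_def norm_mult mult_right_mono del: of_nat_Suc)
    qed
    have "(\<lambda>M. real (Suc M) powr (- Re s)) \<longlonglongrightarrow> 0"
      using s by (intro tendsto_neg_powr filterlim_compose[OF filterlim_real_sequentially filterlim_Suc]) auto
    then show "(\<lambda>M. C * real (Suc M) powr (- Re s)) \<longlonglongrightarrow> 0" by (rule tendsto_mult_right_zero)
  qed
  have "(\<Sum>k\<le>M. a k * of_nat k powr (- s)) = (\<Sum>k\<le>M. u k s) + A M * of_nat (Suc M) powr (- s)" for M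
  proof (induction M)
    case (Suc M)
    have "A (Suc M) = A M + a (Suc M)" by (simp add: A_def)
    then show ?case using Suc by (simp add: u_def algebra_simps del: of_nat_Suc)
  qed (simp add: u_def A0 a0)
  then have "(\<lambda>M. \<Sum>k\<le>M. a k * of_nat k powr (- s)) \<longlonglongrightarrow> abel_dirichlet a s"
    using tendsto_add[OF l1 l2] by simp
  then show "(\<lambda>k. a k * of_nat k powr (- s)) sums abel_dirichlet a s" by (simp add: sums_def_le)
qed

text \<open>The function \<open>z\<close> is \<open>(s - 1) \<zeta>(s)\<close>, which equals 1 plus the sum of
  \<open>(s - 1) k\<^bsup>-s\<^esup> - (k\<^bsup>1-s\<^esup> - (k + 1)\<^bsup>1-s\<^esup>)\<close>; the subtracted differences telescope to 1 when
  \<open>Re s > 1\<close>. Each term is the error of a linear approximation to \<open>x\<^bsup>1-s\<^esup>\<close>, hence of size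
  \<open>k\<^bsup>- Re s - 1\<^esup>\<close>.\<close>
lemma zeta_continuation:
  obtains z :: "complex \<Rightarrow> complex" where "z holomorphic_on {s. Re s > 0}"
    "\<And>s. Re s > 1 \<Longrightarrow> (\<lambda>k. of_nat k powr (- s)) sums (z s / (s - 1))"
proof -
  define u where "u k s = (if k = 0 then 0 else (s - 1) * of_nat k powr (- s) - (of_nat k powr (1 - s) - of_nat (Suc k) powr (1 - s)))" for k :: nat and s :: complex
  have hol: "u k holomorphic_on {s. Re s > 0}" for k
  proof (cases "k = 0")
    case True
    then have "u k = (\<lambda>_. 0)" by (simp add: u_def fun_eq_iff)
    then show ?thesis by simp
  next
    case False
    then have "u k = (\<lambda>s. (s - 1) * of_nat k powr (- s) - (of_nat k powr (1 - s) - of_nat (Suc k) powr (1 - s)))"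
      by (simp add: u_def fun_eq_iff)
    moreover have "(\<lambda>s. (s - 1) * of_nat k powr (- s) - (of_nat k powr (1 - s) - of_nat (Suc k) powr (1 - s)) :: complex) holomorphic_on {s. Re s > 0}"
      using False by (intro holomorphic_intros) auto
    ultimately show ?thesis by simp
  qed
  define K where "K x = (max x 0 + 1) * max x 0" for x :: real
  have K: "mono K" "\<And>x. K x \<ge> 0" by (auto simp: K_def intro!: monoI mult_mono)
  have bd: "norm (u k s) \<le> K (norm s) * real k powr (- Re s - 1)" if s: "Re s > 0" for k s
  proof (cases "k = 0")
    case False
    let ?S = "closed_segment (of_nat k :: complex) (of_nat (Suc k))"
    define g where "g z = z powr (1 - s) + (s - 1) * of_nat k powr (- s) * z" for z :: complex
    have mem: "\<exists>x. z = of_real x \<and> real k \<le> x \<and> x \<le> real (Suc k)" if "z \<in> ?S" for z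
      using that closed_segment_of_real[where ?'a = complex, of "real k" "real (Suc k)"] by (auto simp: closed_segment_eq_real_ivl)
    have "norm (g (of_nat (Suc k)) - g (of_nat k)) \<le> norm (s - 1) * (norm s * real k powr (- Re s - 1)) * norm (of_nat (Suc k) - of_nat k :: complex)"
    proof (rule field_differentiable_bound[where S = ?S and f' = "\<lambda>z. (1 - s) * (z powr (- s) - of_nat k powr (- s))"])
      fix z assume "z \<in> ?S"
      then obtain x where x: "z = of_real x" "real k \<le> x" "x \<le> real (Suc k)" using mem by blast
      have "z \<notin> \<real>\<^sub>\<le>\<^sub>0" using x False by (auto simp: complex_nonpos_Reals_iff)
      then have "(g has_field_derivative (1 - s) * z powr (1 - s - 1) + (s - 1) * of_nat k powr (- s) * 1) (at z)"
        unfolding g_def by (intro DERIV_add has_field_derivative_powr DERIV_cmult DERIV_ident)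
      also have "(1 - s) * z powr (1 - s - 1) + (s - 1) * of_nat k powr (- s) * 1 = (1 - s) * (z powr (- s) - of_nat k powr (- s))"
        by (simp add: algebra_simps)
      finally show "(g has_field_derivative (1 - s) * (z powr (- s) - of_nat k powr (- s))) (at z within ?S)"
        by (rule has_field_derivative_at_within)
      have "norm (z powr (- s) - of_nat k powr (- s)) \<le> norm s * real k powr (- Re s - 1) * (x - real k)"
        unfolding x(1) using False x s by (intro nat_powr_diff_bound) auto
      also have "\<dots> \<le> norm s * real k powr (- Re s - 1) * 1" using x by (intro mult_left_mono) auto
      finally show "norm ((1 - s) * (z powr (- s) - of_nat k powr (- s))) \<le> norm (s - 1) * (norm s * real k powr (- Re s - 1))"
        by (simp add: norm_mult norm_minus_commute mult_left_mono)
    qed auto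
    also have "of_nat (Suc k) - of_nat k = (1 :: complex)" by simp
    also have "g (of_nat (Suc k)) - g (of_nat k) = u k s" using False by (simp add: g_def u_def algebra_simps)
    finally have "norm (u k s) \<le> (norm (s - 1) * norm s) * real k powr (- Re s - 1)" by simp
    also have "\<dots> \<le> K (norm s) * real k powr (- Re s - 1)"
      using norm_triangle_ineq4[of s 1] by (intro mult_right_mono) (auto simp: K_def intro!: mult_right_mono)
    finally show ?thesis .
  qed (simp add: u_def)
  have u0: "u 0 s = 0" for s by (simp add: u_def)
  define z where "z s = 1 + (\<Sum>k. u k s)" for s
  have "z holomorphic_on {s. Re s > 0}"
    unfolding z_def by (intro holomorphic_intros holomorphic_on_right_half_plane_series(1)[OF hol bd K u0])
  moreover have "(\<lambda>k. of_nat k powr (- s)) sums (z s / (s - 1))" if s: "Re s > 1" for s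
  proof -
    define v where "v k = (if k = 0 then 0 else of_nat k powr (1 - s) :: complex)" for k :: nat
    have s1: "(\<lambda>k. u k s) sums (\<Sum>k. u k s)"
      using s by (intro summable_sums holomorphic_on_right_half_plane_series(2)[OF hol bd K u0]) auto
    have s2: "(\<lambda>k. v (Suc k) - v k) sums (0 - v 0)"
    proof (rule telescope_sums)
      show "v \<longlonglongrightarrow> 0"
      proof (rule Lim_null_comparison[where g = "\<lambda>k. real k powr (1 - Re s)"])
        show "\<forall>\<^sub>F k in sequentially. norm (v k) \<le> real k powr (1 - Re s)"
          by (intro always_eventually allI) (auto simp: v_def norm_powr_real_powr)
        show "(\<lambda>k. real k powr (1 - Re s)) \<longlonglongrightarrow> 0"
          using s by (intro tendsto_neg_powr filterlim_real_sequentially) auto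
      qed
    qed
    have "(\<lambda>k. u k s - (v (Suc k) - v k) + (if k = 0 then 1 else 0)) sums ((\<Sum>k. u k s) - (0 - v 0) + 1)"
      by (rule sums_add[OF sums_diff[OF s1 s2] sums_single[of 0 "\<lambda>_. 1"]])
    moreover have "u k s - (v (Suc k) - v k) + (if k = 0 then 1 else 0) = (s - 1) * of_nat k powr (- s)" for k
      by (cases "k = 0") (auto simp: u_def v_def)
    ultimately have "(\<lambda>k. (s - 1) * of_nat k powr (- s)) sums z s" by (simp add: z_def v_def add.commute)
    moreover have "s - 1 \<noteq> 0" using s by auto
    ultimately show ?thesis using sums_divide[of "\<lambda>k. (s - 1) * of_nat k powr (- s)" "z s" "s - 1"] by simp
  qed
  ultimately show ?thesis using that by blast
qed

lemma higher_deriv_exp_sum: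
  fixes c l :: "nat \<Rightarrow> complex"
  shows "(deriv ^^ k) (\<lambda>s. \<Sum>n\<in>A. c n * exp (l n * s)) = (\<lambda>s. \<Sum>n\<in>A. c n * l n ^ k * exp (l n * s))"
proof (induction k)
  case (Suc k)
  have "deriv (\<lambda>s. \<Sum>n\<in>A. c n * l n ^ k * exp (l n * s)) s = (\<Sum>n\<in>A. c n * l n ^ Suc k * exp (l n * s))" for s
  proof (rule DERIV_imp_deriv)
    have "((\<lambda>s. \<Sum>n\<in>A. c n * l n ^ k * exp (l n * s)) has_field_derivative (\<Sum>n\<in>A. c n * l n ^ k * (exp (l n * s) * (l n * 1)))) (at s)"
      by (intro DERIV_sum DERIV_cmult DERIV_fun_exp DERIV_ident)
    then show "((\<lambda>s. \<Sum>n\<in>A. c n * l n ^ k * exp (l n * s)) has_field_derivative (\<Sum>n\<in>A. c n * l n ^ Suc k * exp (l n * s))) (at s)"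
      by (simp add: mult_ac)
  qed
  then show ?case by (simp add: Suc fun_eq_iff)
qed simp

text \<open>Landau's lemma for Dirichlet series with nonnegative coefficients, in the form needed
  below. The derivatives of \<open>g\<close> at 2 alternate in sign and dominate in absolute value those
  of each partial sum. As the Taylor series of \<open>g\<close> at 2 converges at \<open>1 / 2\<close>, where all its
  terms are nonnegative, comparing it term by term with the Taylor series of a partial sum
  bounds the latter at \<open>1 / 2\<close>.\<close>
lemma landau_nonneg:
  fixes x :: "nat \<Rightarrow> real"
  assumes x: "\<And>n. x n \<ge> 0" and g: "g holomorphic_on {s. Re s > 0}"
    and sm: "summable (\<lambda>n. x n * exp (- (ln (real n) * (3 / 2))))"
    and eq: "\<And>s. Re s > 1 \<Longrightarrow> (\<lambda>n. of_real (x n) * exp (- of_real (ln (real n)) * s)) sums g s"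
  shows "(\<Sum>n<M. x n * exp (- (ln (real n) / 2))) \<le> Re (g (1 / 2))"
proof -
  let ?l = "\<lambda>n. - of_real (ln (real n)) :: complex"
  define P where "P M s = (\<Sum>n<M. of_real (x n) * exp (?l n * s))" for M s
  have lim: "uniform_limit (ball 2 (1/2)) P g sequentially"
  proof -
    have "uniform_limit (ball 2 (1/2)) P (\<lambda>s. \<Sum>n. of_real (x n) * exp (?l n * s)) sequentially"
      unfolding P_def
    proof (rule Weierstrass_m_test[OF _ sm])
      fix n and s :: complex assume "s \<in> ball 2 (1/2)"
      then have "\<bar>Re (s - 2)\<bar> < 1 / 2" using abs_Re_le_cmod[of "s - 2"] by (simp add: dist_norm norm_minus_commute)
      then have s: "Re s \<ge> 3 / 2" unfolding abs_less_iff by simp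
      have l0: "ln (real n) \<ge> 0" by (cases "n = 0") auto
      have "norm (exp (?l n * s)) = exp (- (ln (real n) * Re s))" by (simp add: norm_exp_eq_Re)
      also have "\<dots> \<le> exp (- (ln (real n) * (3 / 2)))" using mult_left_mono[OF s l0] by simp
      finally show "norm (of_real (x n) * exp (?l n * s)) \<le> x n * exp (- (ln (real n) * (3 / 2)))"
        using x[of n] by (simp add: norm_mult mult_left_mono)
    qed
    moreover have eqg: "(\<Sum>n. of_real (x n) * exp (?l n * s)) = g s" if "s \<in> ball 2 (1/2)" for s
    proof -
      have "\<bar>Re (s - 2)\<bar> < 1 / 2" using abs_Re_le_cmod[of "s - 2"] that by (simp add: dist_norm norm_minus_commute)
      then have "Re s > 1" unfolding abs_less_iff by simp
      then show ?thesis using eq sums_unique by metis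
    qed
    ultimately show ?thesis by (simp only: uniform_limit_iff eqg cong: ball_cong)
  qed
  define d where "d k = (deriv ^^ k) g 2" for k
  have dP: "(deriv ^^ k) (P M) 2 = of_real ((-1) ^ k * (\<Sum>n<M. x n * ln (real n) ^ k * exp (- (ln (real n) * 2))))" for k M
  proof -
    have "(deriv ^^ k) (P M) 2 = (\<Sum>n<M. of_real (x n) * ?l n ^ k * exp (?l n * 2))"
      unfolding P_def higher_deriv_exp_sum ..
    also have "\<dots> = (\<Sum>n<M. of_real ((-1) ^ k * (x n * ln (real n) ^ k * exp (- (ln (real n) * 2)))))"
    proof (intro sum.cong refl)
      fix n
      have "?l n ^ k = of_real ((-1) ^ k * ln (real n) ^ k)"
        using power_minus[of "of_real (ln (real n)) :: complex" k] by simp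
      moreover have "exp (?l n * 2) = of_real (exp (- (ln (real n) * 2)))" by (simp flip: exp_of_real)
      ultimately show "of_real (x n) * ?l n ^ k * exp (?l n * 2) = of_real ((-1) ^ k * (x n * ln (real n) ^ k * exp (- (ln (real n) * 2))))"
        by (simp only: of_real_mult[symmetric]) (simp add: mult_ac)
    qed
    also have "\<dots> = of_real ((-1) ^ k * (\<Sum>n<M. x n * ln (real n) ^ k * exp (- (ln (real n) * 2))))"
      by (simp add: sum_distrib_left)
    finally show ?thesis .
  qed
  have dlim: "(\<lambda>M. (deriv ^^ k) (P M) 2) \<longlonglongrightarrow> d k" for k
    unfolding d_def
  proof (rule higher_deriv_complex_uniform_limit[OF lim])
    have "P M holomorphic_on ball 2 (1/2)" for M
      unfolding P_def[abs_def] by (intro holomorphic_intros)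
    then show "\<forall>\<^sub>F M in sequentially. P M holomorphic_on ball 2 (1/2)" by simp
  qed auto
  have dge: "(\<Sum>n<M. x n * ln (real n) ^ k * exp (- (ln (real n) * 2))) \<le> (-1) ^ k * Re (d k)" for k
  proof (rule LIMSEQ_le_const)
    have "(\<lambda>M. (-1) ^ k * Re ((deriv ^^ k) (P M) 2)) \<longlonglongrightarrow> (-1) ^ k * Re (d k)"
      by (intro tendsto_intros dlim)
    moreover have "(-1) ^ k * Re ((deriv ^^ k) (P M) 2) = (\<Sum>n<M. x n * ln (real n) ^ k * exp (- (ln (real n) * 2)))" for M
      unfolding dP by (simp flip: mult.assoc power_add add: mult_2[symmetric])
    ultimately show "(\<lambda>M. \<Sum>n<M. x n * ln (real n) ^ k * exp (- (ln (real n) * 2))) \<longlonglongrightarrow> (-1) ^ k * Re (d k)"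
      by simp
    have "(\<Sum>n<M. x n * ln (real n) ^ k * exp (- (ln (real n) * 2))) \<le> (\<Sum>n<m. x n * ln (real n) ^ k * exp (- (ln (real n) * 2)))" if "m \<ge> M" for m
    proof (rule sum_mono2)
      fix n
      have "ln (real n) \<ge> 0" by (cases "n = 0") auto
      then show "0 \<le> x n * ln (real n) ^ k * exp (- (ln (real n) * 2))" using x[of n] by simp
    qed (use that in auto)
    then show "\<exists>N. \<forall>m\<ge>N. (\<Sum>n<M. x n * ln (real n) ^ k * exp (- (ln (real n) * 2))) \<le> (\<Sum>n<m. x n * ln (real n) ^ k * exp (- (ln (real n) * 2)))"
      by blast
  qed
  have "ball 2 2 \<subseteq> {s::complex. Re s > 0}"
  proof
    fix s :: complex assume "s \<in> ball 2 2"
    then have "\<bar>Re (s - 2)\<bar> < 2" using abs_Re_le_cmod[of "s - 2"] by (simp add: dist_norm norm_minus_commute)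
    then show "s \<in> {s. Re s > 0}" unfolding abs_less_iff by simp
  qed
  then have "g holomorphic_on ball 2 2" using g holomorphic_on_subset by blast
  moreover have "(1 / 2 :: complex) \<in> ball 2 2" by (simp add: dist_norm)
  ultimately have "(\<lambda>k. (deriv ^^ k) g 2 / fact k * (1 / 2 - 2) ^ k) sums g (1 / 2)"
    by (rule holomorphic_power_series)
  from sums_Re[OF this] have gs: "(\<lambda>k. ((-1) ^ k * Re (d k)) * ((3 / 2) ^ k / fact k)) sums Re (g (1 / 2))"
  proof (rule sums_cong[THEN iffD1, rotated])
    fix k
    have "(1 / 2 - 2 :: complex) ^ k = of_real ((-1) ^ k * (3 / 2) ^ k)"
      using power_minus[of "3 / 2 :: complex" k] by simp
    then have "(deriv ^^ k) g 2 / fact k * (1 / 2 - 2) ^ k = d k * of_real ((-1) ^ k * (3 / 2) ^ k / fact k)"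
      unfolding d_def by simp
    then have "Re ((deriv ^^ k) g 2 / fact k * (1 / 2 - 2) ^ k) = Re (d k) * ((-1) ^ k * (3 / 2) ^ k / fact k)"
      by (metis Re_complex_of_real Im_complex_of_real diff_zero mult_zero_right times_complex.sel(1))
    then show "Re ((deriv ^^ k) g 2 / fact k * (1 / 2 - 2) ^ k) = ((-1) ^ k * Re (d k)) * ((3 / 2) ^ k / fact k)"
      by simp
  qed
  have "(\<lambda>k. \<Sum>n<M. x n * exp (- (ln (real n) * 2)) * ((ln (real n) * (3 / 2)) ^ k /\<^sub>R fact k)) sums
      (\<Sum>n<M. x n * exp (- (ln (real n) * 2)) * exp (ln (real n) * (3 / 2)))"
    by (intro sums_sum sums_mult exp_converges)
  also have "(\<Sum>n<M. x n * exp (- (ln (real n) * 2)) * exp (ln (real n) * (3 / 2))) = (\<Sum>n<M. x n * exp (- (ln (real n) / 2)))"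
    by (intro sum.cong refl) (simp add: mult.assoc flip: exp_add)
  finally have ps: "(\<lambda>k. \<Sum>n<M. x n * exp (- (ln (real n) * 2)) * ((ln (real n) * (3 / 2)) ^ k /\<^sub>R fact k)) sums
      (\<Sum>n<M. x n * exp (- (ln (real n) / 2)))" .
  show ?thesis
  proof (rule sums_le[OF _ ps gs])
    fix k
    have "(\<Sum>n<M. x n * exp (- (ln (real n) * 2)) * ((ln (real n) * (3 / 2)) ^ k /\<^sub>R fact k))
      = (\<Sum>n<M. x n * ln (real n) ^ k * exp (- (ln (real n) * 2))) * ((3 / 2) ^ k / fact k)"
      unfolding sum_distrib_right
      by (intro sum.cong refl) (simp only: real_scaleR_def power_mult_distrib divide_inverse[of _ "fact k"] mult_ac)
    also have "\<dots> \<le> ((-1) ^ k * Re (d k)) * ((3 / 2) ^ k / fact k)"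
      by (intro mult_right_mono dge) simp
    finally show "(\<Sum>n<M. x n * exp (- (ln (real n) * 2)) * ((ln (real n) * (3 / 2)) ^ k /\<^sub>R fact k))
      \<le> ((-1) ^ k * Re (d k)) * ((3 / 2) ^ k / fact k)" .
  qed
qed

section \<open>The Tauberian theorem of Ingham and Newman\<close>

abbreviation right_arc :: "real \<Rightarrow> real \<Rightarrow> complex" where
  "right_arc R \<equiv> part_circlepath 0 R (- (pi / 2)) (pi / 2)"

lemma right_arc_image:
  assumes R: "R > 0" and z: "z \<in> path_image (right_arc R)"
  shows "norm z = R" "Re z \<ge> 0" "Re z = 0 \<Longrightarrow> z \<in> {\<i> * of_real R, - (\<i> * of_real R)}"
proof -
  obtain x where x: "- (pi / 2) \<le> x" "x \<le> pi / 2" "z = of_real R * exp (\<i> * of_real x)"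
    using z by (auto simp: path_image_part_circlepath)
  show n: "norm z = R" using R by (simp add: x norm_mult)
  have "cos x \<ge> 0" using x by (intro cos_ge_zero) auto
  then show "Re z \<ge> 0" using R by (simp add: x Re_exp)
  assume re: "Re z = 0"
  then have "\<bar>Im z\<bar> = R" using n by (simp add: cmod_eq_Im)
  then show "z \<in> {\<i> * of_real R, - (\<i> * of_real R)}"
    using re R by (auto simp: complex_eq_iff abs_if split: if_splits)
qed

lemma right_arc_ends:
  "pathstart (right_arc R) = - (\<i> * of_real R)" "pathfinish (right_arc R) = \<i> * of_real R"
proof -
  have "exp (\<i> * of_real (pi / 2)) = \<i>" "exp (\<i> * of_real (- (pi / 2))) = - \<i>"
    by (simp_all add: exp_eq_polar cis.ctr complex_eq_iff Re_exp Im_exp del: of_real_divide of_real_minus)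
  then show "pathstart (right_arc R) = - (\<i> * of_real R)" "pathfinish (right_arc R) = \<i> * of_real R"
    by (simp_all add: pathstart_part_circlepath pathfinish_part_circlepath mult.commute)
qed

text \<open>Cauchy's integral formula for a contour that consists of the right half of a circle and a
  path \<open>B\<close> back through the left. The winding number is computed with two branches of the
  logarithm: the principal one along the arc and \<open>Ln (- z)\<close> along \<open>B\<close>, each contributing
  \<open>\<pi> \<i>\<close>.\<close>
lemma semicircle_cauchy:
  assumes U: "open U" "convex U" and h: "h holomorphic_on U" and R: "R > 0"
    and A: "path_image (right_arc R) \<subseteq> U" and z0: "0 \<in> U"
    and B: "valid_path B" "path_image B \<subseteq> U" "pathstart B = \<i> * of_real R" "pathfinish B = - (\<i> * of_real R)"
    and Bneg: "\<And>z. z \<in> path_image B \<Longrightarrow> - z \<notin> \<real>\<^sub>\<le>\<^sub>0"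
  shows "contour_integral (right_arc R) (\<lambda>z. h z / z) + contour_integral B (\<lambda>z. h z / z) = 2 * of_real pi * \<i> * h 0"
    "(\<lambda>z. h z / z) contour_integrable_on (right_arc R)"
proof -
  let ?A = "right_arc R"
  have vA: "valid_path ?A" by simp
  have A0: "0 \<notin> path_image ?A" using right_arc_image[OF R, of 0] R by auto
  have B0: "0 \<notin> path_image B" using Bneg[of 0] by auto
  have hol: "(\<lambda>z. h z / z) holomorphic_on (U - {0})"
    by (intro holomorphic_intros holomorphic_on_subset[OF h]) auto
  have iA: "(\<lambda>z. h z / z) contour_integrable_on ?A" and iB: "(\<lambda>z. h z / z) contour_integrable_on B"
    using A A0 B B0 U by (auto intro!: contour_integrable_holomorphic_simple[OF hol])
  show "(\<lambda>z. h z / z) contour_integrable_on ?A" by (rule iA)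
  have ii: "Ln (\<i> * of_real R) - Ln (- (\<i> * of_real R)) = of_real pi * \<i>"
  proof -
    have "Ln (of_real R * \<i>) = Ln (of_real R) + Ln \<i>" "Ln (of_real R * - \<i>) = Ln (of_real R) + Ln (- \<i>)"
      using Ln_times_of_real[OF R, of \<i>] Ln_times_of_real[OF R, of "- \<i>"] by simp_all
    moreover have "\<i> * of_real R = of_real R * \<i>" "- (\<i> * of_real R) = of_real R * - \<i>" by simp_all
    ultimately have "Ln (\<i> * of_real R) = Ln (of_real R) + Ln \<i>" "Ln (- (\<i> * of_real R)) = Ln (of_real R) + Ln (- \<i>)"
      by (simp_all only:)
    then have "Ln (\<i> * of_real R) - Ln (- (\<i> * of_real R)) = Ln \<i> - Ln (- \<i>)" by (simp only: add_diff_cancel_left)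
    then show ?thesis by (simp only: Ln_ii Ln_minus_ii) simp
  qed
  have "((\<lambda>z. 1 / z) has_contour_integral (Ln (pathfinish ?A) - Ln (pathstart ?A))) ?A"
  proof (rule contour_integral_primitive[OF _ vA])
    show "path_image ?A \<subseteq> - \<real>\<^sub>\<le>\<^sub>0"
    proof
      fix z assume z: "z \<in> path_image ?A"
      have "z \<noteq> 0" using z A0 by auto
      then show "z \<in> - \<real>\<^sub>\<le>\<^sub>0"
        using right_arc_image(2)[OF R z] by (auto simp: complex_nonpos_Reals_iff complex_eq_iff)
    qed
    show "(Ln has_field_derivative 1 / x) (at x within - \<real>\<^sub>\<le>\<^sub>0)" if "x \<in> - \<real>\<^sub>\<le>\<^sub>0" for x
      using that by (auto intro!: derivative_eq_intros simp: field_simps)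
  qed
  then have dA: "((\<lambda>z. 1 / z) has_contour_integral (of_real pi * \<i>)) ?A" by (simp only: right_arc_ends ii)
  have "((\<lambda>z. 1 / z) has_contour_integral (Ln (- pathfinish B) - Ln (- pathstart B))) B"
  proof (rule contour_integral_primitive[OF _ B(1)])
    show "path_image B \<subseteq> {z. - z \<notin> \<real>\<^sub>\<le>\<^sub>0}" using Bneg by auto
    show "((\<lambda>z. Ln (- z)) has_field_derivative 1 / x) (at x within {z. - z \<notin> \<real>\<^sub>\<le>\<^sub>0})" if "x \<in> {z. - z \<notin> \<real>\<^sub>\<le>\<^sub>0}" for x
      using that by (auto intro!: derivative_eq_intros simp: field_simps)
  qed
  then have dB: "((\<lambda>z. 1 / z) has_contour_integral (of_real pi * \<i>)) B" using ii by (simp add: B)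
  define q where "q z = (if z = 0 then deriv h 0 else (h z - h 0) / (z - 0))" for z
  have "q holomorphic_on U" unfolding q_def by (rule pole_lemma_open[OF h U(1)])
  moreover have ends: "pathfinish ?A = pathstart B" by (simp only: right_arc_ends B(3))
  moreover have "pathfinish (?A +++ B) = pathstart (?A +++ B)"
    by (simp only: pathfinish_join pathstart_join right_arc_ends B(4))
  moreover have "path_image (?A +++ B) \<subseteq> U" using A B(2) by (subst path_image_join[OF ends]) blast
  ultimately have "(q has_contour_integral 0) (?A +++ B)"
    using U(2) vA B(1) by (intro Cauchy_theorem_convex_simple valid_path_join)
  moreover have "(q has_contour_integral (contour_integral ?A (\<lambda>z. h z / z) - h 0 * (of_real pi * \<i>)
       + (contour_integral B (\<lambda>z. h z / z) - h 0 * (of_real pi * \<i>)))) (?A +++ B)"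
  proof (rule has_contour_integral_join[OF _ _ vA B(1)])
    have "((\<lambda>z. h z / z - h 0 * (1 / z)) has_contour_integral (contour_integral ?A (\<lambda>z. h z / z) - h 0 * (of_real pi * \<i>))) ?A"
      by (intro has_contour_integral_diff has_contour_integral_lmul dA has_contour_integral_integral iA)
    then show "(q has_contour_integral (contour_integral ?A (\<lambda>z. h z / z) - h 0 * (of_real pi * \<i>))) ?A"
      by (rule has_contour_integral_eq) (use A0 in \<open>auto simp: q_def diff_divide_distrib\<close>)
    have "((\<lambda>z. h z / z - h 0 * (1 / z)) has_contour_integral (contour_integral B (\<lambda>z. h z / z) - h 0 * (of_real pi * \<i>))) B"
      by (intro has_contour_integral_diff has_contour_integral_lmul dB has_contour_integral_integral iB)
    then show "(q has_contour_integral (contour_integral B (\<lambda>z. h z / z) - h 0 * (of_real pi * \<i>))) B"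
      by (rule has_contour_integral_eq) (use B0 in \<open>auto simp: q_def diff_divide_distrib\<close>)
  qed
  ultimately have "contour_integral ?A (\<lambda>z. h z / z) - h 0 * (of_real pi * \<i>)
       + (contour_integral B (\<lambda>z. h z / z) - h 0 * (of_real pi * \<i>)) = 0"
    using has_contour_integral_unique by blast
  then show "contour_integral ?A (\<lambda>z. h z / z) + contour_integral B (\<lambda>z. h z / z) = 2 * of_real pi * \<i> * h 0"
    by (simp add: algebra_simps)
qed

text \<open>Comparison with the integral of \<open>y\<^bsup>- 1 - x\<^esup>\<close>, in telescoping form.\<close>
lemma powr_telescope_upper:
  assumes x: "x > 0" and N: "N \<ge> (1::nat)"
  shows "(\<Sum>n\<in>{N<..M}. real n powr (- 1 - x)) \<le> 1 / (x * real N powr x)"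
proof (cases "M > N")
  case False
  then show ?thesis using x by simp
next
  case True
  have step: "real (Suc n) powr (- 1 - x) \<le> (real n powr (- x) - real (Suc n) powr (- x)) / x" if n: "n \<ge> 1" for n
  proof -
    have "\<exists>z. real n < z \<and> z < real (Suc n) \<and>
        real (Suc n) powr (- x) - real n powr (- x) = (real (Suc n) - real n) * (- x * z powr (- x - 1))"
    proof (rule MVT2)
      fix y :: real assume "real n \<le> y"
      then have "y > 0" using n by linarith
      then show "((\<lambda>y. y powr (- x)) has_real_derivative - x * y powr (- x - 1)) (at y)"
        by (rule has_real_derivative_powr)
    qed simp
    then obtain z where z: "real n < z" "z < real (Suc n)"
        "real (Suc n) powr (- x) - real n powr (- x) = (real (Suc n) - real n) * (- x * z powr (- x - 1))"
      by blast
    have "real (Suc n) powr (- x - 1) \<le> z powr (- x - 1)"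
      by (rule powr_mono2') (use z n x in linarith)+
    then have "x * real (Suc n) powr (- x - 1) \<le> x * z powr (- x - 1)" using x by simp
    moreover have "- 1 - x = - x - 1" by simp
    ultimately have "x * real (Suc n) powr (- 1 - x) \<le> x * z powr (- x - 1)" by (simp only:)
    moreover have "real (Suc n) - real n = 1" by simp
    ultimately have "x * real (Suc n) powr (- 1 - x) \<le> real n powr (- x) - real (Suc n) powr (- x)"
      using z(3) by simp
    then show ?thesis using x by (simp add: field_simps)
  qed
  have "(\<Sum>n\<in>{N<..M}. real n powr (- 1 - x)) = (\<Sum>n\<in>{N..<M}. real (Suc n) powr (- 1 - x))"
    by (rule sum.reindex_bij_witness[of _ Suc "\<lambda>n. n - 1"]) auto
  also have "\<dots> \<le> (\<Sum>n\<in>{N..<M}. (real n powr (- x) - real (Suc n) powr (- x)) / x)"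
    using N by (intro sum_mono step) auto
  also have "\<dots> = (real N powr (- x) - real M powr (- x)) / x"
    using sum_Suc_diff'[of N M "\<lambda>n. - (real n powr (- x))"] True by (simp flip: sum_divide_distrib)
  also have "\<dots> \<le> real N powr (- x) / x" using x by (intro divide_right_mono) auto
  also have "\<dots> = 1 / (x * real N powr x)" by (simp add: powr_minus field_simps)
  finally show ?thesis .
qed

text \<open>Comparison with the integral of \<open>y\<^bsup>x - 1\<^esup>\<close>. The integrand increases for \<open>x \<ge> 1\<close> and
  decreases otherwise; in the first case the last term has to be split off, which accounts
  for \<open>1 / N\<close>.\<close>
lemma powr_telescope_lower:
  assumes x: "x > 0" and N: "N \<ge> (1::nat)"
  shows "(\<Sum>n\<in>{1..N}. real n powr (x - 1)) \<le> real N powr x * (1 / real N + 1 / x)"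
proof -
  have mvt: "\<exists>z. real n < z \<and> z < real (Suc n) \<and> real (Suc n) powr x - real n powr x = x * z powr (x - 1)" if "n \<ge> 1" for n
  proof -
    have "\<exists>z. real n < z \<and> z < real (Suc n) \<and> real (Suc n) powr x - real n powr x = (real (Suc n) - real n) * (x * z powr (x - 1))"
      using that by (intro MVT2) (auto intro!: derivative_eq_intros)
    then show ?thesis by auto
  qed
  show ?thesis
  proof (cases "x \<ge> 1")
    case True
    have "(\<Sum>n\<in>{1..N}. real n powr (x - 1)) = (\<Sum>n\<in>{1..<N}. real n powr (x - 1)) + real N powr (x - 1)"
      using N by (simp add: sum.last_plus add.commute)
    also have "(\<Sum>n\<in>{1..<N}. real n powr (x - 1)) \<le> (\<Sum>n\<in>{1..<N}. (real (Suc n) powr x - real n powr x) / x)"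
    proof (rule sum_mono)
      fix n assume "n \<in> {1..<N}"
      then have n: "n \<ge> 1" by simp
      obtain z where z: "real n < z" "real (Suc n) powr x - real n powr x = x * z powr (x - 1)" using mvt[OF n] by auto
      have "real n powr (x - 1) \<le> z powr (x - 1)" using z True by (intro powr_mono2) auto
      then show "real n powr (x - 1) \<le> (real (Suc n) powr x - real n powr x) / x" using z(2) x by simp
    qed
    also have "\<dots> = (real N powr x - 1) / x"
      using sum_Suc_diff'[of 1 N "\<lambda>n. real n powr x"] N by (simp flip: sum_divide_distrib)
    also have "\<dots> \<le> real N powr x / x" using x by (intro divide_right_mono) auto
    finally have "(\<Sum>n\<in>{1..N}. real n powr (x - 1)) \<le> real N powr x / x + real N powr (x - 1)" by simp
    also have "real N powr (x - 1) = real N powr x / real N" using N by (simp add: powr_diff)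
    finally show ?thesis by (simp add: ring_distribs)
  next
    case False
    have "(\<Sum>n\<in>{1..N}. real n powr (x - 1)) = (\<Sum>n\<in>{0..<N}. real (Suc n) powr (x - 1))"
      by (rule sum.reindex_bij_witness[of _ Suc "\<lambda>n. n - 1"]) auto
    also have "\<dots> \<le> (\<Sum>n\<in>{0..<N}. (real (Suc n) powr x - real n powr x) / x)"
    proof (rule sum_mono)
      fix n
      show "real (Suc n) powr (x - 1) \<le> (real (Suc n) powr x - real n powr x) / x"
      proof (cases "n = 0")
        case True
        then show ?thesis using x False by simp
      next
        case n: False
        then obtain z where z: "real n < z" "z < real (Suc n)" "real (Suc n) powr x - real n powr x = x * z powr (x - 1)" using mvt[of n] by auto
        have "real (Suc n) powr (x - 1) \<le> z powr (x - 1)" using z False n by (intro powr_mono2') auto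
        then show ?thesis using z(3) x by simp
      qed
    qed
    also have "\<dots> = real N powr x / x"
      using sum_Suc_diff'[of 0 N "\<lambda>n. real n powr x"] x by (simp flip: sum_divide_distrib)
    also have "\<dots> \<le> real N powr x * (1 / real N + 1 / x)" by (simp add: ring_distribs)
    finally show ?thesis .
  qed
qed

text \<open>Dominated convergence: the integrand tends to 0 except at the ends of the segment, which
  may lie on the imaginary axis.\<close>
lemma linepath_exp_decay:
  fixes G :: "complex \<Rightarrow> complex" and L :: "nat \<Rightarrow> real"
  assumes G: "continuous_on (closed_segment p q) G"
    and neg: "\<And>t. 0 < t \<Longrightarrow> t < 1 \<Longrightarrow> Re (linepath p q t) < 0"
    and neg0: "Re p \<le> 0" "Re q \<le> 0"
    and L: "\<And>n. L n \<ge> 0" "filterlim L at_top sequentially"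
  shows "(\<lambda>n. contour_integral (linepath p q) (\<lambda>z. G z * exp (z * of_real (L n)))) \<longlonglongrightarrow> 0"
proof -
  obtain M where M: "\<And>z. z \<in> closed_segment p q \<Longrightarrow> norm (G z) \<le> M"
    using compact_imp_bounded[OF compact_continuous_image[OF G compact_segment(1)]] unfolding bounded_iff by blast
  define g where "g n t = (if t \<in> {0,1} then 0 else G (linepath p q t) * exp (linepath p q t * of_real (L n)) * (q - p))" for n and t :: real
  have neg': "Re (linepath p q t) \<le> 0" if "t \<in> {0..1}" for t
    using neg[of t] neg0 that by (cases "t = 0 \<or> t = 1") (auto simp: linepath_def)
  have "contour_integral (linepath p q) (\<lambda>z. G z * exp (z * of_real (L n))) = integral {0..1} (g n) \<and> g n integrable_on {0..1}" for n
  proof -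
    have "(\<lambda>z. G z * exp (z * of_real (L n))) contour_integrable_on linepath p q"
      by (intro contour_integrable_continuous_linepath continuous_on_mult G continuous_on_exp continuous_on_id continuous_on_const)
    then have "((\<lambda>t. G (linepath p q t) * exp (linepath p q t * of_real (L n)) * (q - p)) has_integral
        contour_integral (linepath p q) (\<lambda>z. G z * exp (z * of_real (L n)))) {0..1}"
      using has_contour_integral_integral[of _ "linepath p q"] unfolding has_contour_integral_linepath by blast
    then have "(g n has_integral contour_integral (linepath p q) (\<lambda>z. G z * exp (z * of_real (L n)))) {0..1}"
      by (rule has_integral_spike_finite[of "{0,1}", rotated 2]) (auto simp: g_def)
    then show ?thesis by (auto simp: has_integral_iff)
  qed
  note eq = this
  have "(\<lambda>n. integral {0..1} (g n)) \<longlonglongrightarrow> integral {0..1} (\<lambda>_::real. 0)"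
  proof (rule dominated_convergence(2))
    show "g n integrable_on {0..1}" for n using eq by blast
    show "(\<lambda>_. M * norm (q - p)) integrable_on {0..1::real}" by (rule integrable_const_ivl)
    show "norm (g n t) \<le> M * norm (q - p)" if t: "t \<in> {0..1}" for n t
    proof -
      have l: "linepath p q t \<in> closed_segment p q" using t by (metis imageI path_image_def path_image_linepath)
      have M0: "0 \<le> M" using M[OF l] norm_ge_zero order_trans by blast
      have "Re (linepath p q t) * L n \<le> 0" using neg'[OF t] L(1)[of n] by (rule mult_nonpos_nonneg)
      then have "norm (exp (linepath p q t * of_real (L n))) \<le> 1" by (simp add: norm_exp_eq_Re)
      then have "norm (G (linepath p q t)) * norm (exp (linepath p q t * of_real (L n))) * norm (q - p) \<le> M * 1 * norm (q - p)"
        using M[OF l] M0 by (intro mult_mono) auto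
      then show ?thesis using M0 by (auto simp: g_def norm_mult)
    qed
    show "(\<lambda>n. g n t) \<longlonglongrightarrow> 0" if t: "t \<in> {0..1}" for t
    proof (cases "t \<in> {0,1}")
      case True
      then show ?thesis by (simp add: g_def)
    next
      case False
      then have r: "Re (linepath p q t) < 0" using neg[of t] t by auto
      have "filterlim (\<lambda>n. Re (linepath p q t) * L n) at_bot sequentially"
        using filterlim_tendsto_neg_mult_at_bot[OF tendsto_const r L(2)] .
      then have "(\<lambda>n. exp (Re (linepath p q t) * L n)) \<longlonglongrightarrow> 0"
        using filterlim_compose[OF exp_at_bot] by blast
      then have "(\<lambda>n. norm (exp (linepath p q t * of_real (L n)))) \<longlonglongrightarrow> 0" by (simp add: norm_exp_eq_Re)
      then have "(\<lambda>n. exp (linepath p q t * of_real (L n))) \<longlonglongrightarrow> 0" by (rule tendsto_norm_zero_cancel)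
      from tendsto_mult_left_zero[OF tendsto_mult_right_zero[OF this, of "G (linepath p q t)"], of "q - p"]
      show ?thesis using False by (simp add: g_def)
    qed
  qed
  then show ?thesis using eq by simp
qed


lemma tail_bound:
  fixes a :: "nat \<Rightarrow> complex"
  assumes a: "\<And>n. norm (a n) \<le> 1" and x: "Re z > 0" and N: "N \<ge> 1"
    and F: "(\<lambda>n. a n * of_nat n powr (- (z + 1))) sums F"
  shows "norm (F - (\<Sum>n\<in>{1..N}. a n * of_nat n powr (- (z + 1)))) \<le> 1 / (Re z * real N powr Re z)"
proof -
  let ?u = "\<lambda>n. a n * of_nat n powr (- (z + 1))"
  have "(\<lambda>M. \<Sum>n\<le>M. ?u n) \<longlonglongrightarrow> F" using F by (simp add: sums_def_le)
  then have lim: "(\<lambda>M. (\<Sum>n\<le>M. ?u n) - (\<Sum>n\<in>{1..N}. ?u n)) \<longlonglongrightarrow> F - (\<Sum>n\<in>{1..N}. ?u n)"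
    by (intro tendsto_diff tendsto_const)
  have bd: "norm ((\<Sum>n\<le>M. ?u n) - (\<Sum>n\<in>{1..N}. ?u n)) \<le> 1 / (Re z * real N powr Re z)" if M: "M \<ge> N" for M
  proof -
    have "{..M} = insert 0 ({1..N} \<union> {N<..M})" using M N by auto
    then have "(\<Sum>n\<le>M. ?u n) = ?u 0 + (\<Sum>n\<in>{1..N} \<union> {N<..M}. ?u n)" by simp
    also have "(\<Sum>n\<in>{1..N} \<union> {N<..M}. ?u n) = (\<Sum>n\<in>{1..N}. ?u n) + (\<Sum>n\<in>{N<..M}. ?u n)"
      by (rule sum.union_disjoint) auto
    finally have "(\<Sum>n\<le>M. ?u n) - (\<Sum>n\<in>{1..N}. ?u n) = (\<Sum>n\<in>{N<..M}. ?u n)" by simp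
    also have "norm \<dots> \<le> (\<Sum>n\<in>{N<..M}. real n powr (- 1 - Re z))"
    proof (rule sum_norm_le)
      fix n assume "n \<in> {N<..M}"
      have "norm (?u n) \<le> 1 * norm (of_nat n powr (- (z + 1)) :: complex)"
        unfolding norm_mult by (intro mult_right_mono a) simp
      also have "norm (of_nat n powr (- (z + 1)) :: complex) = real n powr (- 1 - Re z)"
      proof -
        have "norm (of_nat n powr (- (z + 1)) :: complex) = real n powr Re (- (z + 1))"
          using norm_powr_real_powr[of "of_nat n" "- (z + 1)"] by simp
        moreover have "Re (- (z + 1)) = - 1 - Re z" by simp
        ultimately show ?thesis by (simp only:)
      qed
      finally show "norm (?u n) \<le> real n powr (- 1 - Re z)" by simp
    qed
    also have "\<dots> \<le> 1 / (Re z * real N powr Re z)" by (rule powr_telescope_upper[OF x N])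
    finally show ?thesis .
  qed
  show ?thesis
    by (rule LIMSEQ_le_const2[OF tendsto_norm[OF lim]]) (use bd in blast)
qed

lemma partial_sum_bound:
  fixes a :: "nat \<Rightarrow> complex"
  assumes a: "\<And>n. norm (a n) \<le> 1" and x: "Re z > 0" and N: "N \<ge> 1"
  shows "norm (\<Sum>n\<in>{1..N}. a n * of_nat n powr (- (- z + 1))) \<le> real N powr Re z * (1 / real N + 1 / Re z)"
proof -
  have "norm (\<Sum>n\<in>{1..N}. a n * of_nat n powr (- (- z + 1))) \<le> (\<Sum>n\<in>{1..N}. real n powr (Re z - 1))"
  proof (rule sum_norm_le)
    fix n
    have "norm (a n * of_nat n powr (- (- z + 1))) \<le> 1 * norm (of_nat n powr (- (- z + 1)) :: complex)"
      unfolding norm_mult by (intro mult_right_mono a) simp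
    also have "norm (of_nat n powr (- (- z + 1)) :: complex) = real n powr (Re z - 1)"
      using norm_powr_real_powr[of "of_nat n" "- (- z + 1)"] by simp
    finally show "norm (a n * of_nat n powr (- (- z + 1))) \<le> real n powr (Re z - 1)" by simp
  qed
  also have "\<dots> \<le> real N powr Re z * (1 / real N + 1 / Re z)" by (rule powr_telescope_lower[OF x N])
  finally show ?thesis .
qed

text \<open>Newman's proof of Ingham's theorem. Let \<open>f z = F (z + 1)\<close>, let \<open>P N\<close> be the \<open>N\<close>-th partial
  sum of \<open>f\<close>, and integrate against the kernel \<open>N\<^sup>z (1 / z + z / R\<^sup>2)\<close>. For \<open>f\<close> the contour
  is the right half of the circle of radius \<open>R\<close>, closed by two segments inside the region of
  holomorphy; for the entire function \<open>P N\<close> it is the full circle, the left half of which is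
  carried to the right half by \<open>z \<mapsto> - z\<close>. On the arc the kernel is \<open>2 N\<^sup>z Re z / R\<^sup>2\<close>, which
  cancels the factor \<open>1 / Re z\<close> in the bounds for \<open>f - P N\<close> and for \<open>P N (- z)\<close>; so both
  contribute \<open>O(1 / R + 1 / N)\<close> to \<open>f 0 - P N 0\<close>. On the segments \<open>N\<^sup>z\<close> decays as \<open>N\<close> grows.
  Finally \<open>R\<close> is arbitrary.\<close>
lemma newman_ingham:
  fixes a :: "nat \<Rightarrow> complex"
  assumes a: "\<And>n. norm (a n) \<le> 1" and S: "open S" "{s. Re s \<ge> 1} \<subseteq> S" "F holomorphic_on S"
    and F: "\<And>s. Re s > 1 \<Longrightarrow> (\<lambda>n. a n * of_nat n powr (- s)) sums F s"
  shows "(\<lambda>n. a n / of_nat n) sums F 1"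
proof -
  define f where "f z = F (z + 1)" for z
  define P where "P N z = (\<Sum>n\<in>{1..N}. a n * of_nat n powr (- (z + 1)))" for N :: nat and z
  have P_hol: "P N holomorphic_on T" for N T
    unfolding P_def by (intro holomorphic_intros) auto
  let ?B = "\<lambda>R d. linepath (\<i> * of_real R) (- of_real d) +++ linepath (- of_real d) (- (\<i> * of_real R))"
  let ?k = "\<lambda>R z. 1 + z ^ 2 / of_real R ^ 2 :: complex"
  have key: "\<exists>E :: nat \<Rightarrow> complex. E \<longlonglongrightarrow> 0 \<and> (\<forall>N\<ge>1. norm (F 1 - P N 0) \<le> 2 / R + 1 / real N + norm (E N))" if R: "R > 0" for R :: real
  proof -
    have eA: "path_image (right_arc R) \<subseteq> {z. norm z = R \<and> Re z \<ge> 0}" using right_arc_image[OF R] by auto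
    \<comment> \<open>By compactness of the segment, the domain of \<open>f\<close> contains a strip of positive width \<open>e\<close> to its left;
      together with the right half-plane this gives a convex region around the contour.\<close>
    let ?K = "(\<lambda>y. \<i> * of_real y) ` {- (R + 1)..R + 1}"
    have K: "compact ?K" by (intro compact_continuous_image continuous_intros compact_Icc)
    have oS: "open {z. z + 1 \<in> S}"
      using open_vimage[OF S(1), of "\<lambda>z. z + 1"] by (simp add: vimage_def continuous_intros)
    have "?K \<subseteq> {z. z + 1 \<in> S}" using S(2) by auto
    then obtain e where e: "e > 0" "(\<Union>x\<in>?K. ball x e) \<subseteq> {z. z + 1 \<in> S}"
      using compact_subset_open_imp_ball_epsilon_subset[OF K oS] by blast
    define U where "U = {z. Re z > - e} \<inter> {z. Im z < R + 1} \<inter> {z. Im z > - (R + 1)}"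
    have U: "open U" "convex U" unfolding U_def
      by (intro open_Int open_halfspace_Re_gt open_halfspace_Im_lt open_halfspace_Im_gt
          convex_Int convex_halfspace_Re_gt convex_halfspace_Im_lt convex_halfspace_Im_gt)+
    have US: "z + 1 \<in> S" if z: "z \<in> U" for z
    proof (cases "Re z \<ge> 0")
      case True
      then show ?thesis using S(2) by auto
    next
      case False
      have "dist (\<i> * of_real (Im z)) z = \<bar>Re z\<bar>"
        unfolding dist_norm by (simp add: cmod_def)
      then have "z \<in> ball (\<i> * of_real (Im z)) e" using False z unfolding U_def by simp
      moreover have "\<i> * of_real (Im z) \<in> ?K" using z unfolding U_def by (intro imageI) auto
      ultimately show ?thesis using e(2) by blast
    qed
    have fU: "f holomorphic_on U"
      unfolding f_def using US
      by (intro holomorphic_on_compose_gen[OF _ S(3), unfolded o_def] holomorphic_intros) auto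
    \<comment> \<open>The segments return through the point \<open>- d\<close>.\<close>
    define d where "d = e / 2"
    have d: "d > 0" "d < e" using e by (auto simp: d_def)
    let ?b = "?B R d"
    have AU: "path_image (right_arc R) \<subseteq> U"
    proof
      fix z assume "z \<in> path_image (right_arc R)"
      then have "norm z = R" "Re z \<ge> 0" using right_arc_image[OF R] by auto
      moreover have "\<bar>Im z\<bar> \<le> norm z" by (rule abs_Im_le_cmod)
      ultimately show "z \<in> U" using e(1) unfolding U_def by auto
    qed
    have "\<i> * of_real R \<in> U" "- of_real d \<in> U" "- (\<i> * of_real R) \<in> U" "0 \<in> U"
      using R d e by (auto simp: U_def)
    then have "closed_segment (\<i> * of_real R) (- of_real d) \<subseteq> U" "closed_segment (- of_real d) (- (\<i> * of_real R)) \<subseteq> U"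
        and z0: "0 \<in> U"
      by (simp_all add: closed_segment_subset[OF _ _ U(2)])
    then have BU: "path_image ?b \<subseteq> U"
      by (subst path_image_join) (simp_all only: pathfinish_linepath pathstart_linepath path_image_linepath Un_least)
    have lp1: "Re (linepath (\<i> * of_real R) (- of_real d) t) = - (t * d)"
      "Im (linepath (\<i> * of_real R) (- of_real d) t) = (1 - t) * R"
      "Re (linepath (- of_real d) (- (\<i> * of_real R)) t) = - ((1 - t) * d)"
      "Im (linepath (- of_real d) (- (\<i> * of_real R)) t) = - (t * R)" for t
      by (simp_all add: linepath_def scaleR_conv_of_real)
    have Bneg: "- z \<notin> \<real>\<^sub>\<le>\<^sub>0" if zb: "z \<in> path_image ?b" for z
    proof -
      consider (upper) t where "t \<in> {0..1}" "z = linepath (\<i> * of_real R) (- of_real d) t"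
        | (lower) t where "t \<in> {0..1}" "z = linepath (- of_real d) (- (\<i> * of_real R)) t"
      proof -
        have "z \<in> path_image (linepath (\<i> * of_real R) (- of_real d)) \<union> path_image (linepath (- of_real d) (- (\<i> * of_real R)))"
          using zb by (subst (asm) path_image_join) simp_all
        then show thesis using that unfolding path_image_def by blast
      qed
      then show ?thesis
      proof cases
        case upper
        then show ?thesis using R d lp1[of t] by (auto simp: complex_nonpos_Reals_iff mult_le_0_iff)
      next
        case lower
        then show ?thesis using R d lp1[of t] by (auto simp: complex_nonpos_Reals_iff mult_le_0_iff)
      qed
    qed
    define G where "G z = f z * ?k R z / z" for z
    \<comment> \<open>The maximum with 1 keeps the logarithm nonnegative at 0.\<close>
    define l where "l N = ln (real (max N 1))" for N
    define E where "E N = contour_integral ?b (\<lambda>z. G z * exp (z * of_real (l N))) / (2 * of_real pi * \<i>)" for N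
    have B0: "0 \<notin> path_image ?b" using Bneg[of 0] by auto
    have GB: "continuous_on (path_image ?b) G"
      unfolding G_def using B0 R BU
      by (intro continuous_intros holomorphic_on_imp_continuous_on[OF holomorphic_on_subset[OF fU]]) auto
    have l: "l N \<ge> 0" for N by (simp add: l_def)
    have linf: "filterlim l at_top sequentially"
    proof -
      have "filterlim (\<lambda>N. ln (real N)) at_top sequentially"
        by (rule filterlim_compose[OF ln_at_top filterlim_real_sequentially])
      then show ?thesis
        by (rule filterlim_cong[THEN iffD1, OF refl refl, rotated])
          (auto simp: l_def eventually_sequentially max_def intro!: exI[of _ 1])
    qed
    have seg: "closed_segment (\<i> * of_real R) (- of_real d) \<subseteq> path_image ?b" "closed_segment (- of_real d) (- (\<i> * of_real R)) \<subseteq> path_image ?b"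
      by (auto simp: path_image_join)
    have "(\<lambda>N. contour_integral (linepath (\<i> * of_real R) (- of_real d)) (\<lambda>z. G z * exp (z * of_real (l N)))
       + contour_integral (linepath (- of_real d) (- (\<i> * of_real R))) (\<lambda>z. G z * exp (z * of_real (l N)))) \<longlonglongrightarrow> 0 + 0"
      using d by (intro tendsto_add linepath_exp_decay continuous_on_subset[OF GB] seg l linf) (auto simp: lp1)
    moreover have "contour_integral ?b (\<lambda>z. G z * exp (z * of_real (l N)))
       = contour_integral (linepath (\<i> * of_real R) (- of_real d)) (\<lambda>z. G z * exp (z * of_real (l N)))
       + contour_integral (linepath (- of_real d) (- (\<i> * of_real R))) (\<lambda>z. G z * exp (z * of_real (l N)))" for N
      by (intro contour_integral_join contour_integrable_continuous_linepath continuous_on_mult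
          continuous_on_subset[OF GB] seg continuous_on_exp continuous_on_id continuous_on_const) auto
    ultimately have "(\<lambda>N. contour_integral ?b (\<lambda>z. G z * exp (z * of_real (l N)))) \<longlonglongrightarrow> 0" by simp
    then have E0: "E \<longlonglongrightarrow> 0"
      unfolding E_def by (intro tendsto_divide_zero)
    have fin: "norm (F 1 - P N 0) \<le> 2 / R + 1 / real N + norm (E N)" if N: "N \<ge> 1" for N
    proof -
      define L where "L = l N"
      have L: "exp (of_real r * L) = real N powr r" "exp (r * L) = real N powr r" for r
        using N by (simp_all add: L_def l_def powr_def)
      define h where "h z = f z * exp (z * of_real L) * ?k R z" for z
      define g where "g z = P N z * exp (z * of_real L) * ?k R z" for z
      have hU: "h holomorphic_on U" unfolding h_def using R by (intro holomorphic_intros fU) auto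
      have gU: "g holomorphic_on UNIV" unfolding g_def using R by (intro holomorphic_intros P_hol) auto
      have vb: "valid_path ?b" by (intro valid_path_join) auto
      have c1: "contour_integral (right_arc R) (\<lambda>z. h z / z) + contour_integral ?b (\<lambda>z. h z / z) = 2 * of_real pi * \<i> * h 0"
        and i1: "(\<lambda>z. h z / z) contour_integrable_on (right_arc R)"
        using semicircle_cauchy[OF U hU R AU z0 vb BU _ _ Bneg] by auto
      let ?A' = "uminus \<circ> right_arc R"
      have vA': "valid_path ?A'" by (intro valid_path_negatepath) simp
      have pA': "pathstart ?A' = \<i> * of_real R" "pathfinish ?A' = - (\<i> * of_real R)"
        using right_arc_ends[of R] by (simp_all add: pathstart_def pathfinish_def)
      have A'neg: "- z \<notin> \<real>\<^sub>\<le>\<^sub>0" if "z \<in> path_image ?A'" for z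
      proof -
        have "- z \<in> path_image (right_arc R)" using that by (auto simp: path_image_def)
        then have "norm (- z) = R" "Re (- z) \<ge> 0" using right_arc_image[OF R, of "- z"] by auto
        then show ?thesis using R by (auto simp: complex_nonpos_Reals_iff cmod_def)
      qed
      have c2: "contour_integral (right_arc R) (\<lambda>z. g z / z) + contour_integral ?A' (\<lambda>z. g z / z) = 2 * of_real pi * \<i> * g 0"
        and i2: "(\<lambda>z. g z / z) contour_integrable_on (right_arc R)"
        using semicircle_cauchy[OF open_UNIV convex_UNIV gU R _ _ vA' _ pA' A'neg] by auto
      have neg: "contour_integral ?A' (\<lambda>z. g z / z) = contour_integral (right_arc R) (\<lambda>z. g (- z) / z)"
      proof -
        have "contour_integral ?A' (\<lambda>z. g z / z) = - contour_integral (right_arc R) (\<lambda>z. g (- z) / (- z))"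
          by (rule contour_integral_negatepath) simp
        also have "(\<lambda>z. g (- z) / (- z)) = (\<lambda>z. - (g (- z) / z))" by simp
        finally show ?thesis by (simp only: contour_integral_neg minus_minus)
      qed
      have A0: "0 \<notin> path_image (right_arc R)" using right_arc_image[OF R, of 0] R by auto
      have i3: "(\<lambda>z. g (- z) / z) contour_integrable_on (right_arc R)"
      proof (rule contour_integrable_holomorphic_simple[where S = "- {0}"])
        show "(\<lambda>z. g (- z) / z) holomorphic_on - {0}"
          by (intro holomorphic_intros holomorphic_on_compose_gen[OF _ gU, unfolded o_def]) auto
      qed (use A0 in auto)
      define J where "J z = h z / z - g z / z - g (- z) / z" for z
      have J: "(J has_contour_integral (contour_integral (right_arc R) (\<lambda>z. h z / z) - contour_integral (right_arc R) (\<lambda>z. g z / z)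
         - contour_integral (right_arc R) (\<lambda>z. g (- z) / z))) (right_arc R)"
        unfolding J_def by (intro has_contour_integral_diff has_contour_integral_integral i1 i2 i3)
      have "norm (contour_integral (right_arc R) (\<lambda>z. h z / z) - contour_integral (right_arc R) (\<lambda>z. g z / z)
         - contour_integral (right_arc R) (\<lambda>z. g (- z) / z)) \<le> (4 / R\<^sup>2 + 2 / (real N * R)) * R * (pi / 2 - - (pi / 2))"
      proof (rule has_contour_integral_bound_part_circlepath_strong[OF J, of "{\<i> * of_real R, - (\<i> * of_real R)}"])
        fix z assume z: "z \<in> path_image (right_arc R) - {\<i> * of_real R, - (\<i> * of_real R)}"
        then have n: "norm z = R" and x: "Re z > 0"
          using right_arc_image[OF R, of z] by force+
        have z0: "z \<noteq> 0" using x by auto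
        have "z * cnj z = of_real (R\<^sup>2)" using n by (metis complex_norm_square)
        then have inv: "1 / z = cnj z / of_real (R\<^sup>2)" using z0 R by (simp add: field_simps)
        \<comment> \<open>On the circle \<open>1 / z = cnj z / R\<^sup>2\<close>.\<close>
        have kz: "?k R z / z = of_real (2 * Re z / R\<^sup>2)"
        proof -
          have "?k R z / z = 1 / z + z / of_real (R\<^sup>2)" using z0 R by (simp add: field_simps power2_eq_square)
          also have "\<dots> = (z + cnj z) / of_real (R\<^sup>2)" unfolding inv by (simp add: add_divide_distrib add.commute)
          also have "z + cnj z = of_real (2 * Re z)" by (simp add: complex_add_cnj)
          finally show ?thesis by simp
        qed
        have Rez: "Re z \<le> R" using n complex_Re_le_cmod[of z] by simp
        have "J z = ((f z - P N z) * exp (z * of_real L) - P N (- z) * exp (- z * of_real L)) * (?k R z / z)"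
          using z0 by (simp add: J_def h_def g_def field_simps)
        also have "norm \<dots> = norm ((f z - P N z) * exp (z * of_real L) - P N (- z) * exp (- z * of_real L)) * (2 * Re z / R\<^sup>2)"
          unfolding kz norm_mult norm_of_real using x by simp
        also have "\<dots> \<le> (1 / Re z + (1 / real N + 1 / Re z)) * (2 * Re z / R\<^sup>2)"
        proof (rule mult_right_mono)
          have Nx: "real N powr Re z > 0" using N by simp
          have "norm ((f z - P N z) * exp (z * of_real L)) = norm (f z - P N z) * real N powr Re z"
            using L(2)[of "Re z"] by (simp add: norm_mult norm_exp_eq_Re)
          also have "\<dots> \<le> 1 / (Re z * real N powr Re z) * real N powr Re z"
            unfolding P_def f_def using x
            by (intro mult_right_mono tail_bound[OF a x N] F) auto
          also have "\<dots> = 1 / Re z" using Nx by simp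
          finally have b1: "norm ((f z - P N z) * exp (z * of_real L)) \<le> 1 / Re z" .
          have "norm (P N (- z) * exp (- z * of_real L)) = norm (P N (- z)) * real N powr (- Re z)"
            using L(2)[of "- Re z"] by (simp add: norm_mult norm_exp_eq_Re)
          also have "\<dots> \<le> (real N powr Re z * (1 / real N + 1 / Re z)) * real N powr (- Re z)"
            unfolding P_def by (intro mult_right_mono partial_sum_bound[OF a x N]) auto
          also have "\<dots> = 1 / real N + 1 / Re z" using Nx by (simp add: powr_minus)
          finally have b2: "norm (P N (- z) * exp (- z * of_real L)) \<le> 1 / real N + 1 / Re z" .
          show "norm ((f z - P N z) * exp (z * of_real L) - P N (- z) * exp (- z * of_real L)) \<le> 1 / Re z + (1 / real N + 1 / Re z)"
            using norm_triangle_ineq4[of "(f z - P N z) * exp (z * of_real L)" "P N (- z) * exp (- z * of_real L)"] b1 b2 by linarith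
        qed (use x in simp)
        also have "\<dots> = 4 / R\<^sup>2 + 2 * Re z / (real N * R\<^sup>2)" using x N R by (simp add: field_simps)
        also have "2 * Re z / (real N * R\<^sup>2) \<le> 2 * R / (real N * R\<^sup>2)" using Rez N by (intro divide_right_mono) auto
        also have "2 * R / (real N * R\<^sup>2) = 2 / (real N * R)" using R by (simp add: power2_eq_square)
        finally show "norm (J z) \<le> 4 / R\<^sup>2 + 2 / (real N * R)" by simp
      qed (use R in auto)
      also have "(4 / R\<^sup>2 + 2 / (real N * R)) * R * (pi / 2 - - (pi / 2)) = 2 * pi * (2 / R + 1 / real N)"
        using R N by (simp add: field_simps power2_eq_square)
      finally have bound: "norm (contour_integral (right_arc R) (\<lambda>z. h z / z) - contour_integral (right_arc R) (\<lambda>z. g z / z)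
         - contour_integral (right_arc R) (\<lambda>z. g (- z) / z)) \<le> 2 * pi * (2 / R + 1 / real N)" .
      have hb: "contour_integral ?b (\<lambda>z. h z / z) = 2 * of_real pi * \<i> * E N"
        unfolding E_def h_def G_def L_def by (simp add: mult_ac)
      have h0: "h 0 - g 0 = F 1 - P N 0" by (simp add: h_def g_def f_def)
      have eqn: "2 * of_real pi * \<i> * (F 1 - P N 0) = (contour_integral (right_arc R) (\<lambda>z. h z / z) - contour_integral (right_arc R) (\<lambda>z. g z / z)
         - contour_integral (right_arc R) (\<lambda>z. g (- z) / z)) + 2 * of_real pi * \<i> * E N"
        unfolding h0[symmetric] right_diff_distrib c1[symmetric] c2[symmetric] hb neg by simp
      have "norm (2 * of_real pi * \<i> * (F 1 - P N 0)) \<le> 2 * pi * (2 / R + 1 / real N) + norm (2 * of_real pi * \<i> * E N)"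
        unfolding eqn by (rule norm_triangle_mono[OF bound order_refl])
      moreover have "norm (2 * of_real pi * \<i> * w) = 2 * pi * norm w" for w by (simp add: norm_mult)
      ultimately have "2 * pi * norm (F 1 - P N 0) \<le> 2 * pi * (2 / R + 1 / real N + norm (E N))"
        by (simp only: distrib_left)
      then show ?thesis by (rule mult_left_le_imp_le) simp
    qed
    show ?thesis by (rule exI[of _ E], intro conjI E0 allI impI, rule fin)
  qed
  have "(\<lambda>N. P N 0) \<longlonglongrightarrow> F 1"
  proof (rule LIMSEQ_I)
    fix r :: real assume r: "r > 0"
    obtain E :: "nat \<Rightarrow> complex" where E: "E \<longlonglongrightarrow> 0" "\<And>N. N \<ge> 1 \<Longrightarrow> norm (F 1 - P N 0) \<le> 2 / (6 / r) + 1 / real N + norm (E N)"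
      using key[of "6 / r"] r by auto
    obtain N1 where N1: "\<And>N. N \<ge> N1 \<Longrightarrow> norm (E N) < r / 3" using LIMSEQ_D[OF E(1), of "r / 3"] r by auto
    obtain N2 where N2: "\<And>N. N \<ge> N2 \<Longrightarrow> norm (1 / real N) < r / 3" using LIMSEQ_D[OF lim_1_over_n[where ?'a = real], of "r / 3"] r by auto
    have "norm (P N 0 - F 1) < r" if "N \<ge> max 1 (max N1 N2)" for N
      using E(2)[of N] N1[of N] N2[of N] that r by (simp add: norm_minus_commute)
    then show "\<exists>no. \<forall>N\<ge>no. norm (P N 0 - F 1) < r" by blast
  qed
  moreover have "P N 0 = (\<Sum>n\<le>N. a n / of_nat n)" for N
  proof -
    have "{..N} = insert 0 {1..N}" by auto
    then have "(\<Sum>n\<le>N. a n / of_nat n) = (\<Sum>n\<in>{1..N}. a n / of_nat n)" by simp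
    also have "\<dots> = P N 0" unfolding P_def
      by (intro sum.cong refl) (simp add: powr_minus field_simps)
    finally show ?thesis ..
  qed
  ultimately show ?thesis by (simp add: sums_def_le)
qed

section \<open>Non-vanishing of L-functions on the line of real part 1\<close>

lemma of_nat_powr_mult: "of_nat (a * b) powr w = of_nat a powr w * (of_nat b powr w :: complex)"
  using powr_times_real[of "of_nat a" "of_nat b" w] by simp

lemma of_nat_powr_exp: "n > 0 \<Longrightarrow> of_nat n powr w = (exp (of_real (ln (real n)) * w) :: complex)"
  by (simp add: powr_def mult.commute)

lemma cnj_of_nat_powr: "cnj (of_nat n powr w :: complex) = of_nat n powr (cnj w)"
  by (cases "n = 0") (simp_all add: of_nat_powr_exp exp_cnj)

lemma dconv_0 [simp]: "dconv f g 0 = 0"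
  by (simp add: dconv_def)

lemma dconv_powr:
  "dconv (\<lambda>k. f k * of_nat k powr w) (\<lambda>k. g k * of_nat k powr w) n = dconv f g n * (of_nat n powr w :: complex)"
proof (cases "n = 0")
  case False
  show ?thesis unfolding dconv_def sum_distrib_right
  proof (intro sum.cong refl)
    fix d assume "d \<in> {d. d dvd n}"
    then have "of_nat n powr w = (of_nat d powr w * of_nat (n div d) powr w :: complex)"
      by (simp flip: of_nat_powr_mult)
    then show "f d * of_nat d powr w * (g (n div d) * of_nat (n div d) powr w) = f d * g (n div d) * of_nat n powr w"
      by (simp add: mult_ac)
  qed
qed simp

lemma summable_bounded_powr:
  assumes "\<And>k. norm (f k :: complex) \<le> 1" "Re s > 1"
  shows "summable (\<lambda>k. norm (f k * of_nat k powr (- s)))"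
proof (rule summable_comparison_test')
  show "summable (\<lambda>k. real k powr (- Re s))" using assms(2) by (simp add: summable_real_powr_iff)
  show "norm (norm (f k * of_nat k powr (- s))) \<le> real k powr (- Re s)" for k
  proof -
    have "norm (of_nat k powr (- s) :: complex) = real k powr (- Re s)" by (subst norm_powr_real_powr) auto
    then show ?thesis using assms(1)[of k] by (simp add: norm_mult mult_left_le_one_le)
  qed
qed

lemma dirichlet_char_norm_le: "n > 0 \<Longrightarrow> dirichlet_char n chi \<Longrightarrow> norm (chi a) \<le> 1"
  by (simp add: dirichlet_char_norm)

lemma moebius_char_norm_le:
  assumes "n > 0" "dirichlet_char n chi"
  shows "norm (of_int (moebius_mu k) * chi a) \<le> 1"
proof -
  have "norm (of_int (moebius_mu k) :: complex) \<le> 1" by (simp add: moebius_mu_def norm_power)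
  then have "norm (of_int (moebius_mu k) :: complex) * norm (chi a) \<le> 1 * 1"
    by (intro mult_mono dirichlet_char_norm_le[OF assms]) auto
  then show ?thesis by (simp add: norm_mult)
qed

text \<open>The sum over a full period vanishes.\<close>
lemma char_partial_sums_bounded:
  assumes n: "n > 0" and c: "dirichlet_char n chi" and np: "coprime a (int n)" "chi a \<noteq> 1"
  shows "norm (\<Sum>k\<le>N. chi (int k)) \<le> real n"
proof -
  define S where "S m = (\<Sum>k<m. chi (int k))" for m :: nat
  have add: "S (m + l) = S m + (\<Sum>j<l. chi (int (m + j)))" for m l
    by (induction l) (simp_all add: S_def)
  have "S n = (\<Sum>a\<in>{0..<int n}. chi a)"
    unfolding S_def by (rule sum.reindex_bij_witness[of _ nat int]) auto
  then have Sn: "S n = 0" using sum_dirichlet_char_residues[OF n c] np by auto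
  have "norm (S m) \<le> real n" for m
  proof (induction m rule: less_induct)
    case (less m)
    show ?case
    proof (cases "m < n")
      case True
      have "norm (S m) \<le> (\<Sum>k<m. 1)" unfolding S_def by (intro sum_norm_le dirichlet_char_norm_le[OF n c])
      then show ?thesis using True by simp
    next
      case False
      have "chi (int (n + j)) = chi (int j)" for j
        using dirichlet_char_cong[OF c, of "int (n + j)" "int j"] by (simp add: cong_def)
      then have "S (n + (m - n)) = S (m - n)" unfolding add[of n] Sn by (simp add: S_def)
      then show ?thesis using less[of "m - n"] False n by simp
    qed
  qed
  from this[of "Suc N"] show ?thesis by (simp add: S_def lessThan_Suc_atMost)
qed

definition char_L :: "(int \<Rightarrow> complex) \<Rightarrow> complex \<Rightarrow> complex" where
  "char_L chi = abel_dirichlet (\<lambda>k. chi (int k))"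

lemma char_L:
  assumes n: "n > 0" and c: "dirichlet_char n chi" and np: "coprime a (int n)" "chi a \<noteq> 1"
  shows "char_L chi holomorphic_on {s. Re s > 0}"
    "Re s > 0 \<Longrightarrow> (\<lambda>k. chi (int k) * of_nat k powr (- s)) sums char_L chi s"
proof -
  have "n \<noteq> 1"
  proof
    assume "n = 1"
    then have "chi a = chi 1" by (intro dirichlet_char_cong[OF c]) (simp add: cong_def)
    then show False using np dirichlet_char_1[OF c] by simp
  qed
  then have c0: "chi 0 = 0" using dirichlet_char_nonzero_iff[OF c, of 0] by auto
  show "char_L chi holomorphic_on {s. Re s > 0}"
    "Re s > 0 \<Longrightarrow> (\<lambda>k. chi (int k) * of_nat k powr (- s)) sums char_L chi s"
    unfolding char_L_def
    using abel_dirichlet[of "\<lambda>k. chi (int k)" "real n"] c0 char_partial_sums_bounded[OF n c np] by auto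
qed

text \<open>At \<open>n = m\<^sup>2\<close> the factor \<open>exp (- ln n / 2)\<close> equals \<open>1 / m\<close>, so the sums dominate the
  harmonic series.\<close>
lemma sum_squares_harmonic_unbounded:
  fixes x :: "nat \<Rightarrow> real"
  assumes x: "\<And>n. x n \<ge> 0" "\<And>m. m > 0 \<Longrightarrow> x (m ^ 2) \<ge> 1"
    and B: "\<And>M. (\<Sum>n<M. x n * exp (- (ln (real n) / 2))) \<le> B"
  shows False
proof -
  have "summable (\<lambda>m. inverse (real (Suc m)))"
  proof (rule summableI_nonneg_bounded[where x = B])
    fix K
    let ?g = "\<lambda>m::nat. (Suc m) ^ 2"
    have inj: "inj_on ?g {..<K}" by (auto intro!: inj_onI dest: power_inject_base[of _ 1, folded numeral_2_eq_2])
    have "(\<Sum>m<K. inverse (real (Suc m))) \<le> (\<Sum>m<K. x (?g m) * exp (- (ln (real (?g m)) / 2)))"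
    proof (rule sum_mono)
      fix m
      have "exp (- (ln (real (?g m)) / 2)) = inverse (real (Suc m))"
        by (simp add: ln_realpow exp_minus del: of_nat_Suc)
      then show "inverse (real (Suc m)) \<le> x (?g m) * exp (- (ln (real (?g m)) / 2))"
        using x(2)[of "Suc m"] by (simp add: mult_le_cancel_right1 del: of_nat_Suc)
    qed
    also have "\<dots> = (\<Sum>n\<in>?g ` {..<K}. x n * exp (- (ln (real n) / 2)))"
      by (simp add: sum.reindex[OF inj])
    also have "\<dots> \<le> (\<Sum>n<K ^ 2 + 1. x n * exp (- (ln (real n) / 2)))"
      by (rule sum_mono2) (auto intro!: mult_nonneg_nonneg x le_imp_less_Suc power_mono)
    also have "\<dots> \<le> B" by (rule B)
    finally show "(\<Sum>m<K. inverse (real (Suc m))) \<le> B" .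
  qed simp
  then have "summable (\<lambda>m. inverse (real m))" by (subst (asm) summable_Suc_iff)
  then show False using not_summable_harmonic[where 'a = real] by simp
qed

text \<open>Suppose that \<open>L(1 + it, \<chi>) = 0\<close>, hence also \<open>L(1 - it, cnj \<chi>) = 0\<close>. In
  \<open>g s = \<zeta>(s)\<^sup>2 L(s + it, \<chi>) L(s - it, cnj \<chi>)\<close> the double pole of \<open>\<zeta>\<^sup>2\<close> at 1 is then
  cancelled by the two zeros, so \<open>g\<close> is holomorphic for \<open>Re s > 0\<close>. But its Dirichlet
  coefficients are nonnegative and at least 1 at squares, so by Landau's lemma the harmonic
  series would be bounded by \<open>g (1 / 2)\<close>. The argument treats real and complex characters,
  and \<open>t = 0\<close> and \<open>t \<noteq> 0\<close>, alike.\<close>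
theorem char_L_nonzero:
  assumes n: "n > 0" and c: "dirichlet_char n chi" and np: "coprime b (int n)" "chi b \<noteq> 1"
    and s0: "Re s0 = 1"
  shows "char_L chi s0 \<noteq> 0"
proof
  assume zero: "char_L chi s0 = 0"
  define t where "t = Im s0"
  have s0': "s0 = 1 + \<i> * of_real t" using s0 by (simp add: complex_eq_iff t_def)
  let ?cc = "conj_char chi"
  have cc: "dirichlet_char n ?cc" by (rule dirichlet_char_conj[OF c])
  have npc: "?cc b \<noteq> 1" using np(2) by (simp add: conj_char_def)
  note L = char_L[OF n c np] and Lc = char_L[OF n cc np(1) npc]
  have zero': "char_L ?cc (1 - \<i> * of_real t) = 0"
  proof -
    have "(\<lambda>k. cnj (chi (int k) * of_nat k powr (- s0))) sums cnj (char_L chi s0)"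
      unfolding sums_cnj by (rule L(2)) (simp add: s0)
    then have "(\<lambda>k. ?cc (int k) * of_nat k powr (- (1 - \<i> * of_real t))) sums 0"
      by (simp add: zero[unfolded s0'] cnj_of_nat_powr conj_char_def s0')
    moreover have "(\<lambda>k. ?cc (int k) * of_nat k powr (- (1 - \<i> * of_real t))) sums char_L ?cc (1 - \<i> * of_real t)"
      by (rule Lc(2)) simp
    ultimately show ?thesis using sums_unique2 by blast
  qed
  obtain z where z: "z holomorphic_on {s. Re s > 0}" "\<And>s. Re s > 1 \<Longrightarrow> (\<lambda>k. of_nat k powr (- s)) sums (z s / (s - 1))"
    using zeta_continuation by blast
  \<comment> \<open>Coefficients of \<open>L(s + it, \<chi>)\<close>, of \<open>\<zeta>(s) L(s + it, \<chi>)\<close>, and of \<open>g\<close>.\<close>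
  define a where "a k = chi (int k) * of_nat k powr (- (\<i> * of_real t))" for k :: nat
  define l where "l = dconv (\<lambda>_. 1) a"
  define e where "e = dconv l (\<lambda>k. cnj (l k))"
  have an: "norm (a k) = 1 \<or> a k = 0" if "k > 0" for k
  proof -
    have "norm (of_nat k powr (- (\<i> * of_real t)) :: complex) = 1"
      using that by (subst norm_powr_real_powr) auto
    then show ?thesis using dirichlet_char_norm[OF c n, of "int k"] by (auto simp: a_def norm_mult split: if_splits)
  qed
  have a0: "a 0 = 0" by (simp add: a_def)
  have an1: "norm (a k) \<le> 1" for k using an[of k] a0 by (cases "k = 0") auto
  have "\<exists>x\<ge>0. e k = of_real x \<and> ((\<exists>m. k = m ^ 2) \<longrightarrow> x \<ge> 1)" if "k > 0" for k
    unfolding e_def l_def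
  proof (rule conv_square_nonneg[OF _ _ an that])
    show "a 1 = 1" by (simp add: a_def dirichlet_char_1[OF c])
    show "a (x * y) = a x * a y" for x y
      by (simp only: a_def of_nat_powr_mult of_nat_mult[where 'a = int] dirichlet_char_mult[OF c] mult_ac)
  qed
  then obtain y where y: "\<And>k. k > 0 \<Longrightarrow> y k \<ge> 0 \<and> e k = of_real (y k) \<and> ((\<exists>m. k = m ^ 2) \<longrightarrow> y k \<ge> 1)"
    by metis
  define x where "x k = (if k = 0 then 0 else y k)" for k
  have series: "summable (\<lambda>k. norm (e k * of_nat k powr (- s))) \<and>
      (\<Sum>k. e k * of_nat k powr (- s)) = (z s / (s - 1)) * char_L chi (s + \<i> * of_real t) * ((z s / (s - 1)) * char_L ?cc (s - \<i> * of_real t))"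
    if s: "Re s > 1" for s
  proof -
    let ?p = "\<lambda>f k. f k * of_nat k powr (- s) :: complex"
    have 1: "summable (\<lambda>k. norm (?p (\<lambda>_. 1) k))" by (rule summable_bounded_powr[OF _ s]) simp
    have 2: "summable (\<lambda>k. norm (?p a k))" by (rule summable_bounded_powr[OF an1 s])
    have 3: "summable (\<lambda>k. norm (?p (\<lambda>k. cnj (a k)) k))" by (rule summable_bounded_powr[OF _ s]) (simp add: an1)
    have v1: "(\<Sum>k. ?p (\<lambda>_. 1) k) = z s / (s - 1)" using sums_unique[OF z(2)[OF s]] by simp
    have "?p a = (\<lambda>k. chi (int k) * of_nat k powr (- (s + \<i> * of_real t)))"
      by (simp add: a_def fun_eq_iff powr_add[symmetric] algebra_simps)
    then have v2: "(\<Sum>k. ?p a k) = char_L chi (s + \<i> * of_real t)"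
      using sums_unique[OF L(2), of "s + \<i> * of_real t"] s by simp
    have "?p (\<lambda>k. cnj (a k)) = (\<lambda>k. ?cc (int k) * of_nat k powr (- (s - \<i> * of_real t)))"
      by (simp add: a_def conj_char_def cnj_of_nat_powr fun_eq_iff powr_add[symmetric] algebra_simps)
    then have v3: "(\<Sum>k. ?p (\<lambda>k. cnj (a k)) k) = char_L ?cc (s - \<i> * of_real t)"
      using sums_unique[OF Lc(2), of "s - \<i> * of_real t"] s by simp
    have lc: "(\<lambda>k. cnj (l k)) = dconv (\<lambda>_. 1) (\<lambda>k. cnj (a k))" by (simp add: l_def dconv_def fun_eq_iff)
    have p: "dconv (?p f) (?p g) = ?p (dconv f g)" for f g by (rule ext) (rule dconv_powr)
    have conv: "summable (\<lambda>k. norm (?p (dconv f g) k)) \<and> (\<Sum>k. ?p (dconv f g) k) = (\<Sum>k. ?p f k) * (\<Sum>k. ?p g k)"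
      if "summable (\<lambda>k. norm (?p f k))" "summable (\<lambda>k. norm (?p g k))" for f g
      using dconv_sums[of "?p f" "?p g"] that unfolding p by simp
    have l1: "summable (\<lambda>k. norm (?p l k))" "(\<Sum>k. ?p l k) = z s / (s - 1) * char_L chi (s + \<i> * of_real t)"
      using conv[OF 1 2] unfolding l_def[symmetric] v1 v2 by blast+
    have l2: "summable (\<lambda>k. norm (?p (\<lambda>k. cnj (l k)) k))"
        "(\<Sum>k. ?p (\<lambda>k. cnj (l k)) k) = z s / (s - 1) * char_L ?cc (s - \<i> * of_real t)"
      using conv[OF 1 3] unfolding lc[symmetric] v1 v3 by blast+
    show ?thesis using conv[OF l1(1) l2(1)] unfolding e_def[symmetric] l1(2) l2(2) .
  qed
  define F1 where "F1 s = char_L chi (s + \<i> * of_real t)" for s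
  define F2 where "F2 s = char_L ?cc (s - \<i> * of_real t)" for s
  have F: "F1 holomorphic_on {s. Re s > 0}" "F2 holomorphic_on {s. Re s > 0}"
    unfolding F1_def F2_def
    by (intro holomorphic_on_compose_gen[OF _ L(1), unfolded o_def] holomorphic_on_compose_gen[OF _ Lc(1), unfolded o_def] holomorphic_intros; auto)+
  have F0: "F1 1 = 0" "F2 1 = 0" using zero zero' by (simp_all add: F1_def F2_def s0')
  \<comment> \<open>Dividing out the zeros at 1 cancels the poles of the squared zeta function.\<close>
  define Q where "Q F s = (if s = 1 then deriv F 1 else (F s - F 1) / (s - 1))" for F :: "complex \<Rightarrow> complex" and s
  have op: "open {s::complex. Re s > 0}" by (rule open_halfspace_Re_gt)
  have Q: "Q F1 holomorphic_on {s. Re s > 0}" "Q F2 holomorphic_on {s. Re s > 0}"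
    unfolding Q_def by (rule pole_lemma_open[OF F(1) op], rule pole_lemma_open[OF F(2) op])
  define g where "g s = z s * z s * Q F1 s * Q F2 s" for s
  have g: "g holomorphic_on {s. Re s > 0}" unfolding g_def by (intro holomorphic_on_mult z(1) Q)
  have term_eq: "of_real (x k) * exp (- of_real (ln (real k)) * s) = e k * of_nat k powr (- s)" for k s
    by (cases "k = 0") (simp_all add: x_def y of_nat_powr_exp)
  have gs: "(\<lambda>k. of_real (x k) * exp (- of_real (ln (real k)) * s)) sums g s" if s: "Re s > 1" for s
  proof -
    have "s \<noteq> 1" using s by auto
    then have "g s = (\<Sum>k. e k * of_nat k powr (- s))"
      using series[OF s] F0 by (simp add: g_def Q_def F1_def F2_def field_simps)
    moreover have "(\<lambda>k. e k * of_nat k powr (- s)) sums (\<Sum>k. e k * of_nat k powr (- s))"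
      using series[OF s] by (intro summable_sums) (auto dest: summable_norm_cancel)
    ultimately show ?thesis by (simp only: term_eq)
  qed
  have x0: "x k \<ge> 0" for k using y[of k] by (simp add: x_def)
  have sm: "summable (\<lambda>k. x k * exp (- (ln (real k) * (3 / 2))))"
  proof -
    have "norm (e k * of_nat k powr (- (3 / 2))) = x k * exp (- (ln (real k) * (3 / 2)))" for k
      unfolding term_eq[symmetric] using x0[of k] by (simp add: norm_mult norm_exp_eq_Re)
    moreover have "summable (\<lambda>k. norm (e k * of_nat k powr (- (3 / 2))))" using series[of "3 / 2"] by simp
    ultimately show ?thesis by simp
  qed
  have "(\<Sum>k<M. x k * exp (- (ln (real k) / 2))) \<le> Re (g (1 / 2))" for M
    by (rule landau_nonneg[OF x0 g sm gs])
  moreover have "x (m ^ 2) \<ge> 1" if "m > 0" for m using y[of "m ^ 2"] that by (auto simp: x_def)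
  ultimately show False using sum_squares_harmonic_unbounded[of x] x0 by blast
qed

lemma moebius_char_inverse:
  assumes n: "n > 0" and c: "dirichlet_char n chi" and s: "Re s > 1"
  shows "(\<Sum>k. of_int (moebius_mu k) * (chi (int k) * of_nat k powr (- s))) * (\<Sum>k. chi (int k) * of_nat k powr (- s)) = 1"
proof (rule moebius_dirichlet_inverse)
  show "chi (int (a * b)) * of_nat (a * b) powr (- s) = chi (int a) * of_nat a powr (- s) * (chi (int b) * of_nat b powr (- s))" for a b
    by (simp only: of_nat_mult[where 'a = int] dirichlet_char_mult[OF c] of_nat_powr_mult mult_ac)
  show "summable (\<lambda>k. norm (chi (int k) * of_nat k powr (- s)))"
    by (intro summable_bounded_powr s dirichlet_char_norm_le[OF n c])
qed (simp_all add: dirichlet_char_1[OF c])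

text \<open>The reciprocal of \<open>L(s, \<chi>)\<close> is the Dirichlet series of \<open>\<mu> \<chi>\<close> for \<open>Re s > 1\<close> and extends
  holomorphically to a neighbourhood of \<open>Re s \<ge> 1\<close>, so the Tauberian theorem applies.\<close>
lemma moebius_char_sums_1:
  assumes n: "n > 0" and c: "dirichlet_char n chi" and np: "coprime b (int n)" "chi b \<noteq> 1"
  shows "(\<lambda>k. of_int (moebius_mu k) * chi (int k) / of_nat k) sums (1 / char_L chi 1)"
proof -
  note L = char_L[OF n c np]
  let ?S = "{s. Re s > 0} \<inter> char_L chi -` (- {0})"
  have op: "open ?S"
    by (intro continuous_open_preimage holomorphic_on_imp_continuous_on[OF L(1)] open_halfspace_Re_gt) auto
  have sub: "{s. Re s \<ge> 1} \<subseteq> ?S"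
  proof
    fix s assume "s \<in> {s. Re s \<ge> 1}"
    then have s: "Re s \<ge> 1" by simp
    have "char_L chi s \<noteq> 0"
    proof (cases "Re s = 1")
      case True
      then show ?thesis by (rule char_L_nonzero[OF n c np])
    next
      case False
      then have s1: "Re s > 1" using s by simp
      let ?h = "\<lambda>k. chi (int k) * of_nat k powr (- s)"
      have "(\<Sum>k. of_int (moebius_mu k) * ?h k) * (\<Sum>k. ?h k) = 1"
        by (rule moebius_char_inverse[OF n c s1])
      then show ?thesis using sums_unique[OF L(2), of s] s1 by auto
    qed
    then show "s \<in> ?S" using s by simp
  qed
  have hol: "(\<lambda>s. 1 / char_L chi s) holomorphic_on ?S"
    by (intro holomorphic_intros holomorphic_on_subset[OF L(1)]) auto
  note nm = moebius_char_norm_le[OF n c]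
  show ?thesis
  proof (rule newman_ingham[OF nm op sub hol])
    fix s assume s: "Re s > 1"
    let ?h = "\<lambda>k. chi (int k) * of_nat k powr (- s)"
    have "(\<Sum>k. ?h k) = char_L chi s" using sums_unique[OF L(2), of s] s by simp
    then have inv: "(\<Sum>k. of_int (moebius_mu k) * ?h k) * char_L chi s = 1"
      using moebius_char_inverse[OF n c s] by simp
    then have "char_L chi s \<noteq> 0" by auto
    with inv have "(\<Sum>k. of_int (moebius_mu k) * ?h k) = 1 / char_L chi s" by (simp add: eq_divide_eq)
    moreover have "summable (\<lambda>k. of_int (moebius_mu k) * chi (int k) * of_nat k powr (- s))"
      using summable_bounded_powr[OF nm s] by (rule summable_norm_cancel)
    ultimately show "(\<lambda>k. of_int (moebius_mu k) * chi (int k) * of_nat k powr (- s)) sums (1 / char_L chi s)"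
      by (simp only: sums_iff mult.assoc)
  qed
qed

section \<open>Euler factors and inverse cotangent numbers\<close>

lemma of_nat_powr_minus_nat:
  assumes "r > 0" shows "x * of_nat k powr (- of_nat r) = (x / of_nat k ^ r :: complex)"
  using assms by (cases "k = 0") (simp_all add: powr_minus powr_nat' field_simps)

text \<open>For \<open>r \<ge> 2\<close> both series converge absolutely. For \<open>r = 1\<close> the character is odd, hence not
  principal, and the analytic results above apply.\<close>
lemma parity_char_series:
  assumes n: "n > 0" and c: "dirichlet_char n chi" and par: "chi (-1) = (-1) ^ r" and r: "r > 0"
  obtains L M where "(\<lambda>k. chi (int k) / of_nat k ^ r) sums L"
    "(\<lambda>k. of_int (moebius_mu k) * chi (int k) / of_nat k ^ r) sums M" "M * L = 1"
proof (cases "r = 1")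
  case True
  have np: "coprime (-1) (int n)" "chi (-1) \<noteq> 1" using par True by auto
  have "(\<lambda>k. chi (int k) * of_nat k powr (- 1)) sums char_L chi 1"
    by (rule char_L(2)[OF n c np]) simp
  then have "(\<lambda>k. chi (int k) / of_nat k ^ r) sums char_L chi 1"
    using of_nat_powr_minus_nat[of 1] True by simp
  moreover have "(\<lambda>k. of_int (moebius_mu k) * chi (int k) / of_nat k ^ r) sums (1 / char_L chi 1)"
    using moebius_char_sums_1[OF n c np] True by simp
  moreover have "1 / char_L chi 1 * char_L chi 1 = 1"
    using char_L_nonzero[OF n c np, of 1] by simp
  ultimately show ?thesis using that by blast
next
  case False
  then have r2: "Re (of_nat r) > 1" using r by simp
  let ?s = "of_nat r :: complex"
  note mu = moebius_char_norm_le[OF n c]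
  have "summable (\<lambda>k. chi (int k) * of_nat k powr (- ?s))"
    using summable_bounded_powr[OF dirichlet_char_norm_le[OF n c] r2] by (rule summable_norm_cancel)
  then have 1: "(\<lambda>k. chi (int k) / of_nat k ^ r) sums (\<Sum>k. chi (int k) * of_nat k powr (- ?s))"
    unfolding of_nat_powr_minus_nat[OF r] by (rule summable_sums)
  have e: "of_int (moebius_mu k) * (chi (int k) * of_nat k powr (- ?s)) = of_int (moebius_mu k) * chi (int k) / of_nat k ^ r" for k
    using of_nat_powr_minus_nat[OF r, of "of_int (moebius_mu k) * chi (int k)" k] by (simp add: mult.assoc)
  have "summable (\<lambda>k. of_int (moebius_mu k) * (chi (int k) * of_nat k powr (- ?s)))"
    using summable_bounded_powr[OF mu r2] unfolding mult.assoc by (rule summable_norm_cancel)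
  then have 2: "(\<lambda>k. of_int (moebius_mu k) * chi (int k) / of_nat k ^ r) sums (\<Sum>k. of_int (moebius_mu k) * (chi (int k) * of_nat k powr (- ?s)))"
    unfolding e[symmetric] by (rule summable_sums)
  show ?thesis by (rule that[OF 1 2 moebius_char_inverse[OF n c r2]])
qed

text \<open>The multiples of \<open>p\<close> contribute \<open>b p * S\<close>. The argument only reindexes a subsequence, hence
  is valid for conditionally convergent series.\<close>
lemma sums_remove_prime_multiples:
  fixes b :: "nat \<Rightarrow> complex"
  assumes b: "\<And>k. b (p * k) = b p * b k" and S: "b sums S" and p: "prime p"
  shows "(\<lambda>k. if p dvd k then 0 else b k) sums (S * (1 - b p))"
proof -
  have p0: "p > 0" using p by (simp add: prime_gt_0_nat)
  have "(\<lambda>k. b p * b k) sums (b p * S)" by (rule sums_mult[OF S])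
  then have "(\<lambda>k. if p dvd p * k then b (p * k) else 0) sums (b p * S)" by (simp add: b)
  then have "(\<lambda>k. if p dvd k then b k else 0) sums (b p * S)"
    by (subst (asm) sums_mono_reindex[where g = "\<lambda>k. p * k" and f = "\<lambda>k. if p dvd k then b k else 0"])
      (use p0 in \<open>auto intro!: strict_monoI\<close>)
  from sums_diff[OF S this] have "(\<lambda>k. b k - (if p dvd k then b k else 0)) sums (S * (1 - b p))"
    by (simp add: algebra_simps)
  then show ?thesis by (rule sums_cong[THEN iffD1, rotated]) auto
qed

lemma sums_remove_primes:
  fixes b :: "nat \<Rightarrow> complex"
  assumes b: "\<And>j k. b (j * k) = b j * b k" and S: "b sums S"
    and P: "finite P" "\<And>p. p \<in> P \<Longrightarrow> prime p"
  shows "(\<lambda>k. if \<exists>p\<in>P. p dvd k then 0 else b k) sums (S * (\<Prod>p\<in>P. 1 - b p))"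
  using P
proof (induction P rule: finite_induct)
  case empty
  then show ?case using S by simp
next
  case (insert q P)
  let ?b = "\<lambda>k. if \<exists>p\<in>P. p dvd k then 0 else b k"
  have nd: "\<not> p dvd q" if "p \<in> P" for p
    using insert that by (metis insertI1 insertI2 primes_dvd_imp_eq)
  have m: "?b (q * k) = ?b q * ?b k" for k
  proof -
    have "p dvd q * k \<longleftrightarrow> p dvd k" if "p \<in> P" for p
      using nd[OF that] insert.prems that by (simp add: prime_dvd_mult_iff)
    then show ?thesis using nd b by auto
  qed
  have "(\<lambda>k. if q dvd k then 0 else ?b k) sums (S * (\<Prod>p\<in>P. 1 - b p) * (1 - ?b q))"
    by (rule sums_remove_prime_multiples[OF m insert.IH]) (use insert.prems in auto)
  moreover have "?b q = b q" using nd by auto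
  moreover have "(\<lambda>k. if q dvd k then 0 else ?b k) = (\<lambda>k. if \<exists>p\<in>insert q P. p dvd k then 0 else b k)"
    by (auto simp: fun_eq_iff)
  ultimately show ?case using insert.hyps by (simp add: mult_ac)
qed

text \<open>The series is \<open>1 / L(r, \<chi>)\<close>. Passing to the primitive character removes the Euler factors
  at the primes dividing \<open>n\<close>, and \<open>L(r, \<chi>\<^sub>f)\<close> is a multiple of \<open>B / \<tau>\<close> for the conjugate
  character. Since neither \<open>L\<close> nor \<open>\<tau>\<close> vanishes, \<open>B\<close> does not vanish either and the relation
  can be inverted.\<close>
lemma parity_char_moebius_value:
  assumes n: "n \<ge> 3" and r: "r > 0" and chi: "chi \<in> parity_chars n r"
  shows "(\<lambda>k. of_int (moebius_mu k) * chi (int k) / of_nat k ^ r) sums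
    (2 * (-1) ^ (r + 1) * fact r / (2 * of_real pi * \<i>) ^ r *
      (of_nat (conductor n chi) ^ (r - 1) *
       (\<Prod>p \<in> prime_factors n. inverse (1 - primitive_char n chi (int p) / of_nat p ^ r)) *
       (gauss_sum (conductor n (conj_char chi)) (primitive_char n (conj_char chi)) /
        gen_bernoulli r (conductor n (conj_char chi)) (primitive_char n (conj_char chi)))))"
proof -
  have n0: "n > 0" using n by simp
  have c: "dirichlet_char n chi" and par: "chi (-1) = (-1) ^ r" using chi by (auto simp: parity_chars_def)
  define f where "f = conductor n chi"
  define psi where "psi = primitive_char n chi"
  note props = primitive_char_props[OF n0 c, folded f_def psi_def]
  have psi_par: "psi (-1) = (-1) ^ r" using props(2)[of "-1"] par by simp
  obtain Lf where Lf: "(\<lambda>k. psi (int k) / of_nat k ^ r) sums Lf"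
    using parity_char_series[OF props(4,5) psi_par r] by blast
  obtain L M where L: "(\<lambda>k. chi (int k) / of_nat k ^ r) sums L"
    and M: "(\<lambda>k. of_int (moebius_mu k) * chi (int k) / of_nat k ^ r) sums M" and inv_eq: "M * L = 1"
    using parity_char_series[OF n0 c par r] by blast
  let ?E = "\<Prod>p\<in>prime_factors n. 1 - psi (int p) / of_nat p ^ r"
  have "L = Lf * ?E"
  proof (rule sums_unique2[OF L])
    have "(\<lambda>k. if \<exists>p\<in>prime_factors n. p dvd k then 0 else psi (int k) / of_nat k ^ r) sums (Lf * ?E)"
      by (rule sums_remove_primes[OF _ Lf]) (auto simp: dirichlet_char_mult[OF props(5)] power_mult_distrib)
    moreover have "(if \<exists>p\<in>prime_factors n. p dvd k then 0 else psi (int k) / of_nat k ^ r) = chi (int k) / of_nat k ^ r" for k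
    proof (cases "coprime k n")
      case True
      have "\<not> p dvd k" if "p \<in> prime_factors n" for p
        using that True by (metis coprime_common_divisor in_prime_factors_imp_dvd in_prime_factors_imp_prime not_prime_unit)
      then show ?thesis using props(2)[of "int k"] True by auto
    next
      case False
      then have "gcd k n \<noteq> 1" using coprime_iff_gcd_eq_1 by blast
      then obtain p where p: "prime p" "p dvd gcd k n" using prime_factor_nat by blast
      then have "p \<in> prime_factors n" "p dvd k" using n0 by (auto simp: prime_factors_dvd)
      moreover have "chi (int k) = 0"
        using False dirichlet_char_nonzero_iff[OF c, of "int k"] by auto
      ultimately show ?thesis by auto
    qed
    ultimately show "(\<lambda>k. chi (int k) / of_nat k ^ r) sums (Lf * ?E)" by simp
  qed
  have "Lf * ?E \<noteq> 0"
    using inv_eq unfolding \<open>L = Lf * ?E\<close> by (metis mult_zero_right zero_neq_one)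
  then have nz: "Lf \<noteq> 0" "?E \<noteq> 0" unfolding mult_eq_0_iff de_Morgan_disj by blast+
  let ?tau = "gauss_sum f (conj_char psi)"
  let ?B = "gen_bernoulli r f (conj_char psi)"
  let ?w = "(2 * of_real pi * \<i>) ^ r :: complex"
  have B: "?B * ?w = of_nat f ^ (r - 1) * ((-1) ^ (r + 1) * 2 * fact r * ?tau * Lf)"
    by (rule gen_bernoulli_eq_L[OF props(4,1) psi_par r Lf])
  have p': "primitive_dirichlet_char f (conj_char psi)" by (rule primitive_char_conj_primitive[OF props(1)])
  have tau: "?tau \<noteq> 0"
    using primitive_gauss_sum_nonzero[OF props(4) p'] gauss_sum_conv_twisted[OF props(4), of "conj_char psi"] p'
    unfolding primitive_dirichlet_char_def by simp
  have w: "?w \<noteq> 0" by simp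
  have "of_nat f ^ (r - 1) * ((-1) ^ (r + 1) * 2 * fact r * ?tau * Lf) \<noteq> 0"
    using nz tau props(4) by simp
  then have B0: "?B \<noteq> 0" using B by auto
  have alg: "1 / l = 2 * s * q / w * (F * (u / B))"
    if "B * w = F * (s * 2 * q * u * l)" "B \<noteq> 0" "w \<noteq> 0" "l \<noteq> 0" for B w F s q u l :: complex
  proof -
    have "2 * s * q / w * (F * (u / B)) * l = F * (s * 2 * q * u * l) / (B * w)"
      by (simp only: divide_inverse inverse_mult_distrib mult_ac)
    also have "\<dots> = 1" unfolding that(1)[symmetric] using that(2,3) by (intro divide_self) simp
    finally show ?thesis using nonzero_divide_eq_eq[OF that(4)] by metis
  qed
  have "1 / Lf = 2 * (-1) ^ (r + 1) * fact r / ?w * (of_nat f ^ (r - 1) * (?tau / ?B))"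
    by (rule alg[OF B B0 w nz(1)])
  then have inv_Lf: "1 / (Lf * ?E) = 2 * (-1) ^ (r + 1) * fact r / ?w * (of_nat f ^ (r - 1) * inverse ?E * (?tau / ?B))"
    by (simp only: divide_inverse inverse_mult_distrib mult_1_left) (simp only: mult_ac)
  have "M = 1 / (Lf * ?E)" using inv_eq nz \<open>L = Lf * ?E\<close> by (simp add: field_simps)
  also note inv_Lf
  also have "inverse ?E = (\<Prod>p\<in>prime_factors n. inverse (1 - psi (int p) / of_nat p ^ r))"
    by (rule prod_inversef[symmetric, unfolded o_def])
  finally show ?thesis
    using M unfolding conductor_conj primitive_char_conj[OF n0 c] f_def[symmetric] psi_def[symmetric] by simp
qed

lemma sum_symmetric_int:
  fixes g :: "int \<Rightarrow> real"
  assumes "g 0 = 0"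
  shows "(\<Sum>m | \<bar>m\<bar> \<le> int k \<and> Q m. g m) = (\<Sum>l\<le>k. (if Q (int l) then g (int l) else 0) + (if Q (- int l) then g (- int l) else 0))"
proof -
  let ?h = "\<lambda>m. if Q m then g m else 0"
  have fin: "finite {- int k..int k}" by simp
  have "{m. \<bar>m\<bar> \<le> int k \<and> Q m} = {m \<in> {- int k..int k}. Q m}" by auto
  then have "(\<Sum>m | \<bar>m\<bar> \<le> int k \<and> Q m. g m) = (\<Sum>m\<in>{- int k..int k}. ?h m)"
    by (simp only: sum.inter_filter[OF fin])
  also have "\<dots> = (\<Sum>l\<le>k. ?h (int l) + ?h (- int l))"
  proof (induction k)
    case 0
    show ?case
      unfolding of_nat_0 minus_zero atLeastAtMost_singleton atMost_0 by (simp add: assms)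
  next
    case (Suc k)
    have "{- int (Suc k)..int (Suc k)} = insert (int (Suc k)) (insert (- int (Suc k)) {- int k..int k})" by auto
    then have "(\<Sum>m\<in>{- int (Suc k)..int (Suc k)}. ?h m) = ?h (int (Suc k)) + (?h (- int (Suc k)) + (\<Sum>m\<in>{- int k..int k}. ?h m))"
      by simp
    then show ?case unfolding Suc by simp
  qed
  finally show ?thesis .
qed

text \<open>The terms for \<open>l\<close> and \<open>- l\<close> together carry the weight \<open>[l \<equiv> 1] + (-1)\<^sup>r [l \<equiv> -1]\<close>, which
  the orthogonality relation expresses through the characters of parity \<open>r\<close>.\<close>
lemma inv_cot_partial_sum:
  assumes n: "n \<ge> 3" and r: "r > 0"
  shows "of_real (\<Sum>m | \<bar>m\<bar> \<le> int k \<and> [m = 1] (mod int n). of_int (moebius_mu (nat \<bar>m\<bar>)) / of_int m ^ r)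
    = 2 / of_nat (totient n) * (\<Sum>chi\<in>parity_chars n r. \<Sum>l\<le>k. of_int (moebius_mu l) * chi (int l) / of_nat l ^ r)"
proof -
  have tot: "of_nat (totient n) \<noteq> (0::complex)" using n by simp
  let ?g = "\<lambda>m::int. of_int (moebius_mu (nat \<bar>m\<bar>)) / of_int m ^ r :: real"
  let ?Q = "\<lambda>m. [m = 1] (mod int n)"
  have term_eq: "of_real ((if ?Q (int l) then ?g (int l) else 0) + (if ?Q (- int l) then ?g (- int l) else 0))
      = 2 / of_nat (totient n) * (\<Sum>chi\<in>parity_chars n r. of_int (moebius_mu l) * chi (int l) / of_nat l ^ r)" for l
  proof -
    have q: "?Q (- int l) \<longleftrightarrow> [int l = -1] (mod int n)"
      using cong_minus_minus_iff[of "int l" "-1" "int n"] by simp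
    have neg: "?g (- int l) = (-1) ^ r * (of_int (moebius_mu l) / of_nat l ^ r)"
      using power_minus[of "real l" r] by (cases "even r") simp_all
    define u :: complex where "u = of_int (moebius_mu l) / of_nat l ^ r"
    define T :: complex where "T = of_nat (totient n)"
    define X :: complex where "X = (if ?Q (int l) then 1 else 0) + (-1) ^ r * (if [int l = -1] (mod int n) then 1 else 0)"
    have "(\<Sum>chi\<in>parity_chars n r. of_int (moebius_mu l) * chi (int l) / of_nat l ^ r)
       = u * (\<Sum>chi\<in>parity_chars n r. chi (int l))"
      by (simp add: sum_distrib_left u_def)
    also have "\<dots> = u * (T / 2 * X)"
      unfolding T_def X_def using n by (subst sum_parity_chars) auto
    finally have sum_eq: "(\<Sum>chi\<in>parity_chars n r. of_int (moebius_mu l) * chi (int l) / of_nat l ^ r) = u * (T / 2 * X)" .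
    have "2 / T * (\<Sum>chi\<in>parity_chars n r. of_int (moebius_mu l) * chi (int l) / of_nat l ^ r) = u * X"
      unfolding sum_eq using tot unfolding T_def[symmetric] by simp
    moreover have "of_real ((if ?Q (int l) then ?g (int l) else 0) + (if ?Q (- int l) then ?g (- int l) else 0)) = u * X"
      unfolding q neg X_def u_def by (simp add: distrib_left)
    ultimately show ?thesis by (simp only: T_def)
  qed
  have "of_real (\<Sum>m | \<bar>m\<bar> \<le> int k \<and> ?Q m. ?g m) = (\<Sum>l\<le>k. of_real ((if ?Q (int l) then ?g (int l) else 0) + (if ?Q (- int l) then ?g (- int l) else 0)) :: complex)"
    by (subst sum_symmetric_int) (use r in \<open>simp_all only: of_real_sum, simp_all\<close>)
  also have "\<dots> = 2 / of_nat (totient n) * (\<Sum>l\<le>k. \<Sum>chi\<in>parity_chars n r. of_int (moebius_mu l) * chi (int l) / of_nat l ^ r)"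
    by (simp only: term_eq sum_distrib_left)
  finally show ?thesis by (subst sum.swap)
qed

lemma inv_cot_summable:
  assumes r: "r \<ge> 2"
  shows "(\<lambda>m::int. of_int (moebius_mu (nat \<bar>m\<bar>)) / of_int m ^ r :: real) summable_on A"
proof -
  have s: "summable (\<lambda>k. 1 / real k ^ 2)" using inverse_power_summable[of 2] by (simp add: divide_inverse)
  have nat1: "(\<lambda>k. 1 / real k ^ 2) summable_on UNIV"
    by (rule norm_summable_imp_summable_on) (use s in simp)
  have nat2: "(\<lambda>k. 1 / real (Suc k) ^ 2) summable_on UNIV"
    by (rule norm_summable_imp_summable_on) (use s summable_Suc_iff[of "\<lambda>k. 1 / real k ^ 2"] in simp)
  let ?h = "\<lambda>m::int. 1 / real_of_int m ^ 2"
  have h1: "?h summable_on range int"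
    using nat1 by (subst summable_on_reindex) (auto simp: o_def)
  have h2: "?h summable_on range (\<lambda>k. - int (Suc k))"
    using nat2 by (subst summable_on_reindex) (auto simp: o_def inj_on_def power2_eq_square algebra_simps)
  have "m \<in> range int \<union> range (\<lambda>k. - int (Suc k))" for m
    by (cases m rule: int_cases) blast+
  then have U: "range int \<union> range (\<lambda>k. - int (Suc k)) = UNIV" by blast
  have "range int \<inter> range (\<lambda>k. - int (Suc k)) = {}" by auto
  then have h: "?h summable_on UNIV"
    using summable_on_Un_disjoint[OF h1 h2] unfolding U by blast
  have "(\<lambda>m::int. norm (of_int (moebius_mu (nat \<bar>m\<bar>)) / of_int m ^ r :: real)) summable_on A"
  proof (rule summable_on_comparison_test)
    show "?h summable_on A" using h summable_on_subset_banach by blast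
    fix m :: int
    show "norm (of_int (moebius_mu (nat \<bar>m\<bar>)) / of_int m ^ r :: real) \<le> ?h m"
    proof (cases "m = 0")
      case False
      have "\<bar>real_of_int m\<bar> \<ge> 1" using False by linarith
      then have "\<bar>real_of_int m\<bar> ^ 2 \<le> \<bar>real_of_int m\<bar> ^ r" using r by (intro power_increasing)
      moreover have "\<bar>real_of_int (moebius_mu (nat \<bar>m\<bar>))\<bar> \<le> 1" by (simp add: moebius_mu_def)
      ultimately have "\<bar>real_of_int (moebius_mu (nat \<bar>m\<bar>))\<bar> / \<bar>real_of_int m\<bar> ^ r \<le> 1 / \<bar>real_of_int m\<bar> ^ 2"
        using False by (intro frac_le) auto
      then show ?thesis by (simp add: abs_divide power_abs)
    qed (use r in \<open>simp add: power_0_left\<close>)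
  qed simp
  then show ?thesis by (rule abs_summable_summable)
qed

text \<open>For \<open>r = 1\<close> this is the definition; for \<open>r \<ge> 2\<close> the series converges absolutely, and the
  symmetric partial sums run through a cofinal family of finite sets.\<close>
lemma inv_cot_series_tendsto:
  assumes r: "r > 0"
    and lim: "(\<lambda>k. \<Sum>m | \<bar>m\<bar> \<le> int k \<and> [m = j] (mod int n). of_int (moebius_mu (nat \<bar>m\<bar>)) / of_int m ^ r :: real) \<longlonglongrightarrow> l"
  shows "inv_cot_series n r j = l"
proof (cases "r = 1")
  case True
  then show ?thesis using limI[OF lim] by (simp add: inv_cot_series_def)
next
  case False
  let ?f = "\<lambda>m::int. of_int (moebius_mu (nat \<bar>m\<bar>)) / of_int m ^ r :: real"
  let ?A = "{m. [m = j] (mod int n)}"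
  have "(?f has_sum infsum ?f ?A) ?A" using r False by (intro has_sum_infsum inv_cot_summable) simp
  then have "(sum ?f \<longlongrightarrow> infsum ?f ?A) (finite_subsets_at_top ?A)" by (simp add: has_sum_def)
  moreover have "filterlim (\<lambda>k. {m. \<bar>m\<bar> \<le> int k \<and> [m = j] (mod int n)}) (finite_subsets_at_top ?A) sequentially"
    unfolding filterlim_finite_subsets_at_top
  proof (intro allI impI)
    fix X assume X: "finite X \<and> X \<subseteq> ?A"
    then obtain K where K: "\<And>m. m \<in> X \<Longrightarrow> nat \<bar>m\<bar> \<le> K"
      using finite_nat_set_iff_bounded_le[of "(\<lambda>m. nat \<bar>m\<bar>) ` X"] by auto
    have fin: "finite {m. \<bar>m\<bar> \<le> int k \<and> [m = j] (mod int n)}" for k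
      by (rule finite_subset[of _ "{- int k..int k}"]) auto
    show "\<forall>\<^sub>F k in sequentially. finite {m. \<bar>m\<bar> \<le> int k \<and> [m = j] (mod int n)} \<and>
        X \<subseteq> {m. \<bar>m\<bar> \<le> int k \<and> [m = j] (mod int n)} \<and> {m. \<bar>m\<bar> \<le> int k \<and> [m = j] (mod int n)} \<subseteq> ?A"
    proof (rule eventually_sequentiallyI[of K])
      fix k assume k: "k \<ge> K"
      have "\<bar>m\<bar> \<le> int k" if "m \<in> X" for m using K[OF that] k by linarith
      then show "finite {m. \<bar>m\<bar> \<le> int k \<and> [m = j] (mod int n)} \<and>
        X \<subseteq> {m. \<bar>m\<bar> \<le> int k \<and> [m = j] (mod int n)} \<and> {m. \<bar>m\<bar> \<le> int k \<and> [m = j] (mod int n)} \<subseteq> ?A"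
        using X fin by blast
    qed
  qed
  ultimately have "(\<lambda>k. sum ?f {m. \<bar>m\<bar> \<le> int k \<and> [m = j] (mod int n)}) \<longlonglongrightarrow> infsum ?f ?A"
    by (rule filterlim_compose)
  then show ?thesis using LIMSEQ_unique[OF lim] False by (simp add: inv_cot_series_def)
qed

theorem theorem2:
  fixes n r :: nat
  assumes "n \<ge> 3" and "r \<ge> 1"
  shows "inv_cot_number n r 1 =
    (-1) ^ r * (2 powi (2 - int r) * of_nat r) / (of_nat (totient n) * of_nat n ^ r) *
    (\<Sum>chi \<in> parity_chars n r.
       of_nat (conductor n chi) ^ (r - 1) *
       (\<Prod>p \<in> prime_factors n. inverse (1 - primitive_char n chi (int p) / of_nat p ^ r)) *
       (gauss_sum (conductor n (conj_char chi)) (primitive_char n (conj_char chi)) /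
        gen_bernoulli r (conductor n (conj_char chi)) (primitive_char n (conj_char chi))))"
    (is "_ = _ * (\<Sum>chi \<in> _. ?X chi)")
proof -
  have r: "r > 0" using assms by simp
  let ?w = "(2 * of_real pi * \<i>) ^ r :: complex"
  define M where "M chi = 2 * (-1) ^ (r + 1) * fact r / ?w * ?X chi" for chi
  define Z where "Z = 2 / of_nat (totient n) * (\<Sum>chi\<in>parity_chars n r. M chi)"
  let ?G = "\<lambda>k. \<Sum>m | \<bar>m\<bar> \<le> int k \<and> [m = 1] (mod int n). of_int (moebius_mu (nat \<bar>m\<bar>)) / of_int m ^ r :: real"
  have "(\<lambda>k. \<Sum>l\<le>k. of_int (moebius_mu l) * chi (int l) / of_nat l ^ r) \<longlonglongrightarrow> M chi" if "chi \<in> parity_chars n r" for chi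
    using parity_char_moebius_value[OF assms(1) r that] unfolding M_def sums_def_le .
  then have "(\<lambda>k. 2 / of_nat (totient n) * (\<Sum>chi\<in>parity_chars n r. \<Sum>l\<le>k. of_int (moebius_mu l) * chi (int l) / of_nat l ^ r)) \<longlonglongrightarrow> Z"
    unfolding Z_def by (intro tendsto_mult_left tendsto_sum)
  then have lim: "(\<lambda>k. of_real (?G k) :: complex) \<longlonglongrightarrow> Z"
    by (simp only: inv_cot_partial_sum[OF assms(1) r])
  have re: "?G \<longlonglongrightarrow> Re Z" using tendsto_Re[OF lim] by simp
  have "Z = of_real (Re Z)" by (rule LIMSEQ_unique[OF lim tendsto_of_real[OF re]])
  moreover have "inv_cot_series n r 1 = Re Z" by (rule inv_cot_series_tendsto[OF r re])
  ultimately have series: "of_real (inv_cot_series n r 1) = Z" by simp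
  have fact_r: "fact r = of_nat r * (fact (r - 1) :: complex)" using fact_reduce[OF r] by simp
  have powi: "(2 :: complex) powi (2 - int r) = 4 / 2 ^ r"
    by (simp add: power_int_diff)
  have "inv_cot_number n r 1 = - (\<i> ^ r * of_real pi ^ r) / (fact (r - 1) * of_nat n ^ r) *
      (2 / of_nat (totient n) * (2 * (-1) ^ (r + 1) * (of_nat r * fact (r - 1)) / ?w * (\<Sum>chi\<in>parity_chars n r. ?X chi)))"
    unfolding inv_cot_number_def series Z_def M_def fact_r sum_distrib_left ..
  also have "- (\<i> ^ r * of_real pi ^ r) / (fact (r - 1) * of_nat n ^ r) *
      (2 / of_nat (totient n) * (2 * (-1) ^ (r + 1) * (of_nat r * fact (r - 1)) / ?w * S))
     = (-1) ^ r * (2 powi (2 - int r) * of_nat r) / (of_nat (totient n) * of_nat n ^ r) * S" for S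
    unfolding powi using assms by (simp add: power_mult_distrib field_simps)
  finally show ?thesis .
qed

end
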